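(* Let $\gamma,\beta\in\mathbb R$, and let $b,\sigma:\mathscr P\to\mathbb R$ be measurable. Assume there are constants $L_b,L_\sigma\ge0$ and $K\ge1$ such that for all $\mu,\nu\in\mathscr P_2$, $$|b(\mu)-b(\nu)|\le L_b\mathbb W_2(\mu,\nu),\quad |\sigma(\mu)-\sigma(\nu)|\le L_\sigma\mathbb W_2(\mu,\nu),\quad K^{-1}\le\sigma^2(\mu)\le K.$$ For $\mu_0\in\mathscr P_2$ let $P_t^*\mu_0$ be the law at time $t$ of the solution of $$\mathrm dX_t=(\gamma-\beta X_t)\,\mathrm dt+b(\mathscr L_{X_t})\,\mathrm dt+\sigma(\mathscr L_{X_t})\,\mathrm dW_t$$ with initial distribution $\mu_0$, and let $P_tf(\mu_0)=\int_{\mathbb R}f\,\mathrm d(P_t^*\mu_0)$. Then for every bounded measurable $f:\mathbb R\to(0,\infty)$, every $t>0$ and all $\mu_0,\nu_0\in\mathscr P_2$, $$P_t\log f(\mu_0)\le\log P_tf(\nu_0)+\Sigma(t)\,\mathbb W_2(\mu_0,\nu_0)^2,$$ where $$\Sigma(t)=\frac{2\beta K}{\mathrm e^{2\beta t}-1}+\frac{2\beta K}{\mathrm e^{2\beta t}-1}L_b^2\frac{\big(\mathrm e^{(L_b+\frac{L_\sigma^2}{2})t}-1\big)^2}{\big(L_b+\frac{L_\sigma^2}{2}\big)^2}+\frac{K+1}{2}\left(\frac{1-\mathrm e^{-2\beta t}}{2\beta}\right)^{-2}K^3L_\sigma^2\,\mathrm e^{-4\beta t}\frac{\big(\mathrm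 e^{(\beta+L_b+\frac{L_\sigma^2}{2})t}-1\big)^2}{\big(\beta+L_b+\frac{L_\sigma^2}{2}\big)^2}.$$
   Context: $W_t$ is a one-dimensional Brownian motion and $\mathscr L_{X_t}$ denotes the law of $X_t$. $\mathscr P$ is the set of probability measures on $\mathbb R$ with the weak topology, and $\mathscr P_2$ the subset of those with finite second moment. $\mathbb W_2(\mu,\nu)=\inf_\pi\big(\int|x-y|^2\,\pi(\mathrm dx,\mathrm dy)\big)^{1/2}$, with the infimum over all couplings $\pi$ of $\mu,\nu$. Under the stated Lipschitz conditions the SDE is strongly well-posed for initial distributions in $\mathscr P_2$, with laws staying in $\mathscr P_2$. $P_t\log f(\mu_0)=\int\log f\,\mathrm d(P_t^*\mu_0)\in[-\infty,\infty)$. Convention: $\frac{\mathrm e^{ct}-1}{c}:=t$ when $c=0$ (applied to all such ratios and their reciprocals, including $\frac{1-\mathrm e^{-2\beta t}}{2\beta}$ and $\frac{2\beta}{\mathrm e^{2\beta t}-1}$). *)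

theory Defs
  imports "HOL-Probability.Probability"
begin

section \<open>Probability measures on the real line\<close>

definition prob_measures :: "real measure set"  (\<open>\<P>\<close>) where
  "\<P> = {\<mu>. prob_space \<mu> \<and> sets \<mu> = sets borel}"

definition weak_topology :: "real measure topology" where
  "weak_topology = topology_generated_by
     {{\<mu> \<in> \<P>. (\<integral>x. g x \<partial>\<mu>) \<in> U} | g U.
        continuous_on UNIV (g :: real \<Rightarrow> real) \<and> bounded (range g) \<and> open (U :: real set)}"

definition borel_weak :: "real measure measure" where
  "borel_weak = sigma \<P> {S. openin weak_topology S}"

definition prob_measures2 :: "real measure set"  (\<open>\<P>\<^sub>2\<close>) where
  "\<P>\<^sub>2 = {\<mu> \<in> \<P>. integrable \<mu> (\<lambda>x. x\<^sup>2)}"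

definition couplings :: "real measure \<Rightarrow> real measure \<Rightarrow> (real \<times> real) measure set" where
  "couplings \<mu> \<nu> =
     {\<pi>. sets \<pi> = sets (borel \<Otimes>\<^sub>M borel) \<and> distr \<pi> borel fst = \<mu> \<and> distr \<pi> borel snd = \<nu>}"

text \<open>Meaningful for arguments in \<open>\<P>\<^sub>2\<close> only: there \<open>(x - y)\<^sup>2\<close> is integrable with respect to every
  coupling, so that no integral below takes its default value.\<close>

definition W2 :: "real measure \<Rightarrow> real measure \<Rightarrow> real"  (\<open>\<W>\<^sub>2\<close>) where
  "\<W>\<^sub>2 \<mu> \<nu> = (INF \<pi>\<in>couplings \<mu> \<nu>. sqrt (\<integral>(x, y). \<bar>x - y\<bar>\<^sup>2 \<partial>\<pi>))"

text \<open>The integral of a function bounded above, with values in \<open>[-\<infinity>, \<infinity>)\<close>.\<close>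

definition ext_integral :: "real measure \<Rightarrow> (real \<Rightarrow> real) \<Rightarrow> ereal" where
  "ext_integral \<mu> g =
     enn2ereal (\<integral>\<^sup>+x. ennreal (g x) \<partial>\<mu>) - enn2ereal (\<integral>\<^sup>+x. ennreal (- g x) \<partial>\<mu>)"


section \<open>Brownian motion and the Ito integral\<close>

text \<open>Time ranges over \<open>[0, \<infinity>)\<close>; the values of processes and filtrations at negative times play no role.
  The usual conditions are not imposed on the filtration.\<close>

definition filtered_prob_space :: "'a measure \<Rightarrow> (real \<Rightarrow> 'a measure) \<Rightarrow> bool" where
  "filtered_prob_space M F \<longleftrightarrow> prob_space M \<and> (\<forall>t\<ge>0. subalgebra M (F t)) \<and>
     (\<forall>s t. 0 \<le> s \<and> s \<le> t \<longrightarrow> sets (F s) \<subseteq> sets (F t))"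

definition adapted :: "(real \<Rightarrow> 'a measure) \<Rightarrow> (real \<Rightarrow> 'a \<Rightarrow> real) \<Rightarrow> bool" where
  "adapted F X \<longleftrightarrow> (\<forall>t\<ge>0. X t \<in> borel_measurable (F t))"

definition progressive :: "(real \<Rightarrow> 'a measure) \<Rightarrow> (real \<Rightarrow> 'a \<Rightarrow> real) \<Rightarrow> bool" where
  "progressive F H \<longleftrightarrow>
     (\<forall>t\<ge>0. (\<lambda>(s, \<omega>). H s \<omega>) \<in> borel_measurable (restrict_space borel {0..t} \<Otimes>\<^sub>M F t))"

definition brownian_motion ::
    "'a measure \<Rightarrow> (real \<Rightarrow> 'a measure) \<Rightarrow> (real \<Rightarrow> 'a \<Rightarrow> real) \<Rightarrow> bool" where
  "brownian_motion M F W \<longleftrightarrow>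
     adapted F W \<and>
     (AE \<omega> in M. W 0 \<omega> = 0) \<and>
     (AE \<omega> in M. continuous_on {0..} (\<lambda>t. W t \<omega>)) \<and>
     (\<forall>s t. 0 \<le> s \<and> s < t \<longrightarrow>
        distributed M lborel (\<lambda>\<omega>. W t \<omega> - W s \<omega>) (normal_density 0 (sqrt (t - s))) \<and>
        prob_space.indep_set M (sets (F s))
          {(\<lambda>\<omega>. W t \<omega> - W s \<omega>) -` A \<inter> space M | A. A \<in> sets borel})"

text \<open>A simple process is \<open>\<Sum>i<n. \<xi>\<^sub>i 1\<^bsub>(\<tau>\<^sub>i, \<tau>\<^sub>i\<^sub>+\<^sub>1]\<^esub>\<close> with \<open>0 \<le> \<tau>\<^sub>0 \<le> \<dots> \<le> \<tau>\<^sub>n\<close> and bounded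
  weights \<open>\<xi>\<^sub>i\<close> known at time \<open>\<tau>\<^sub>i\<close>.\<close>

definition simple_data ::
    "'a measure \<Rightarrow> (real \<Rightarrow> 'a measure) \<Rightarrow> nat \<Rightarrow> (nat \<Rightarrow> real) \<Rightarrow> (nat \<Rightarrow> 'a \<Rightarrow> real) \<Rightarrow> bool" where
  "simple_data M F n \<tau> \<xi> \<longleftrightarrow>
     0 \<le> \<tau> 0 \<and> (\<forall>i<n. \<tau> i \<le> \<tau> (Suc i)) \<and>
     (\<forall>i<n. \<xi> i \<in> borel_measurable (F (\<tau> i))) \<and>
     (\<exists>C. \<forall>i<n. \<forall>\<omega>\<in>space M. \<bar>\<xi> i \<omega>\<bar> \<le> C)"

definition simple_process ::
    "nat \<Rightarrow> (nat \<Rightarrow> real) \<Rightarrow> (nat \<Rightarrow> 'a \<Rightarrow> real) \<Rightarrow> real \<Rightarrow> 'a \<Rightarrow> real" where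
  "simple_process n \<tau> \<xi> s \<omega> = (\<Sum>i<n. \<xi> i \<omega> * indicator {\<tau> i<..\<tau> (Suc i)} s)"

definition simple_integral_W ::
    "(real \<Rightarrow> 'a \<Rightarrow> real) \<Rightarrow> nat \<Rightarrow> (nat \<Rightarrow> real) \<Rightarrow> (nat \<Rightarrow> 'a \<Rightarrow> real) \<Rightarrow> real \<Rightarrow> 'a \<Rightarrow> real" where
  "simple_integral_W W n \<tau> \<xi> t \<omega> =
     (\<Sum>i<n. \<xi> i \<omega> * (W (min t (\<tau> (Suc i))) \<omega> - W (min t (\<tau> i)) \<omega>))"

text \<open>\<open>ito_integral M F W H t I\<close> says that \<open>I\<close> is a version of \<open>\<integral>\<^sub>0\<^sup>t H\<^sub>s dW\<^sub>s\<close>. This is the \<open>L\<^sup>2\<close> theory: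
  it forces the expectation of \<open>\<integral>\<^sub>0\<^sup>t H\<^sub>s\<^sup>2 ds\<close> to be finite. By the Ito isometry, \<open>I\<close> exists for every progressive \<open>H\<close> with
  this property and is almost surely unique.\<close>

definition ito_integral ::
    "'a measure \<Rightarrow> (real \<Rightarrow> 'a measure) \<Rightarrow> (real \<Rightarrow> 'a \<Rightarrow> real) \<Rightarrow>
     (real \<Rightarrow> 'a \<Rightarrow> real) \<Rightarrow> real \<Rightarrow> ('a \<Rightarrow> real) \<Rightarrow> bool" where
  "ito_integral M F W H t I \<longleftrightarrow>
     progressive F H \<and> I \<in> borel_measurable M \<and>
     (\<exists>n \<tau> \<xi>.
        (\<forall>k. simple_data M F (n k) (\<tau> k) (\<xi> k)) \<and>
        (\<lambda>k. \<integral>\<^sup>+\<omega>. (\<integral>\<^sup>+s\<in>{0..t}. ennreal ((simple_process (n k) (\<tau> k) (\<xi> k) s \<omega> - H s \<omega>)\<^sup>2) \<partial>lborel) \<partial>M)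
          \<longlonglongrightarrow> 0 \<and>
        (\<lambda>k. \<integral>\<^sup>+\<omega>. ennreal ((simple_integral_W W (n k) (\<tau> k) (\<xi> k) t \<omega> - I \<omega>)\<^sup>2) \<partial>M)
          \<longlonglongrightarrow> 0)"


section \<open>The distribution-dependent SDE\<close>

abbreviation law :: "'a measure \<Rightarrow> ('a \<Rightarrow> real) \<Rightarrow> real measure" where
  "law M Z \<equiv> distr M borel Z"

text \<open>\<open>X\<close>, together with the filtered probability space and the Brownian motion \<open>W\<close> on it, solves
  \<open>dX\<^sub>t = (\<gamma> - \<beta> X\<^sub>t) dt + b(law of X\<^sub>t) dt + \<sigma>(law of X\<^sub>t) dW\<^sub>t\<close> with initial distribution \<open>\<mu>\<^sub>0\<close>, the laws
  staying in \<open>\<P>\<^sub>2\<close>.\<close>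

definition solves_sde ::
    "real \<Rightarrow> real \<Rightarrow> (real measure \<Rightarrow> real) \<Rightarrow> (real measure \<Rightarrow> real) \<Rightarrow> real measure \<Rightarrow>
     'a measure \<Rightarrow> (real \<Rightarrow> 'a measure) \<Rightarrow> (real \<Rightarrow> 'a \<Rightarrow> real) \<Rightarrow> (real \<Rightarrow> 'a \<Rightarrow> real) \<Rightarrow> bool" where
  "solves_sde \<gamma> \<beta> b \<sigma> \<mu>\<^sub>0 M F W X \<longleftrightarrow>
     filtered_prob_space M F \<and> brownian_motion M F W \<and>
     adapted F X \<and> (AE \<omega> in M. continuous_on {0..} (\<lambda>t. X t \<omega>)) \<and>
     law M (X 0) = \<mu>\<^sub>0 \<and> (\<forall>t\<ge>0. law M (X t) \<in> \<P>\<^sub>2) \<and>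
     (\<forall>t\<ge>0. \<exists>I. ito_integral M F W (\<lambda>s \<omega>. \<sigma> (law M (X s))) t I \<and>
        (AE \<omega> in M.
           set_integrable lborel {0..t} (\<lambda>s. (\<gamma> - \<beta> * X s \<omega>) + b (law M (X s))) \<and>
           X t \<omega> = X 0 \<omega> + (LINT s:{0..t}|lborel. (\<gamma> - \<beta> * X s \<omega>) + b (law M (X s))) + I \<omega>))"


section \<open>The constant in the log-Harnack inequality\<close>

definition exp_ratio :: "real \<Rightarrow> real \<Rightarrow> real" where
  "exp_ratio c t = (if c = 0 then t else (exp (c * t) - 1) / c)"

text \<open>\<open>2 \<beta> / (e\<^sup>2\<^sup>\<beta>\<^sup>t - 1)\<close> is \<open>1 / exp_ratio (2 * \<beta>) t\<close> and \<open>(1 - e\<^sup>-\<^sup>2\<^sup>\<beta>\<^sup>t) / (2 \<beta>)\<close> is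
  \<open>exp_ratio (- 2 * \<beta>) t\<close>, including the limit convention for \<open>\<beta> = 0\<close>.\<close>

definition harnack_Sigma :: "real \<Rightarrow> real \<Rightarrow> real \<Rightarrow> real \<Rightarrow> real \<Rightarrow> real" where
  "harnack_Sigma \<beta> K L\<^sub>b L\<^sub>\<sigma> t =
     K / exp_ratio (2 * \<beta>) t
     + K / exp_ratio (2 * \<beta>) t * L\<^sub>b\<^sup>2 * (exp_ratio (L\<^sub>b + L\<^sub>\<sigma>\<^sup>2 / 2) t)\<^sup>2
     + (K + 1) / 2 * (exp_ratio (- 2 * \<beta>) t) powi (- 2) * K ^ 3 * L\<^sub>\<sigma>\<^sup>2 * exp (- 4 * \<beta> * t)
         * (exp_ratio (\<beta> + L\<^sub>b + L\<^sub>\<sigma>\<^sup>2 / 2) t)\<^sup>2"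

end

theory Submission
  imports Defs
begin

text \<open>
  The coefficients depend on the law only, so the equation is linear with deterministic coefficients:
  \<open>exp (\<beta> t) X\<^sub>t\<close> is distributed as \<open>x + D + sqrt V g\<close>, where \<open>x\<close> has the initial law, \<open>g\<close> is an independent
  standard normal variable, \<open>D\<close> is the integral of \<open>exp (\<beta> s) (\<gamma> + b)\<close> and \<open>V\<close> that of \<open>exp (2 \<beta> s) \<sigma>\<^sup>2\<close> along the flow
  of laws. Coupling two solutions through the same \<open>g\<close> and a coupling of the initial laws gives, by
  Gronwall, \<open>\<W>\<^sub>2 \<le> exp ((L\<^sub>b + L\<^sub>\<sigma>\<^sup>2 / 2 - \<beta>) s) \<W>\<^sub>2(0)\<close> at time \<open>s\<close>. This bounds the differences of \<open>D\<close> and \<open>V\<close>,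
  and hence the relative entropy between the Gaussian laws started at two coupled points. The
  log-Harnack inequality is the variational bound \<open>\<mu>(ln f) \<le> ln \<nu>(f) + Ent(\<mu> | \<nu>)\<close>, integrated over the coupling.
\<close>

section \<open>Riemann sums and a Gronwall inequality\<close>

text \<open>The two solutions live on unrelated probability spaces with unrelated Brownian motions,
  so a coupling by a common Brownian motion is replaced by Gaussian mixtures with a common normal
  variable. The estimate stays the same: \<open>sqrt V1 - sqrt V2\<close> is at most the L2 distance
  of the two integrands, which is what the Ito isometry would give for a common noise. The main
  obstacle is to identify the laws. The definition of the integral provides, separately for each
  time, approximations with random weights, whereas characteristic functions are computed for
  deterministic steps. Passing to the means of the weights bridges this gap. In
  \<open>harnack_Sigma\<close> the first two terms come from the difference of the Gaussian means
  (initial distance and drift) and the third from the difference of the variances. The rate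
  \<open>L\<^sub>b + L\<^sub>\<sigma>\<^sup>2 / 2\<close> is the Gronwall rate after multiplication
  by \<open>exp (\<beta> s)\<close>; the extra \<beta> in the third term is the weight left over in
  a difference of squares.\<close>

lemma integral_sum_pieces:
  fixes g :: "real \<Rightarrow> real" and p :: "nat \<Rightarrow> real"
  assumes "mono p" "g integrable_on {p 0..p n}"
  shows "(\<Sum>i<n. integral {p i..p (Suc i)} g) = integral {p 0..p n} g"
  using assms(2)
proof (induction n)
  case (Suc n)
  have le: "p 0 \<le> p n" "p n \<le> p (Suc n)" using assms(1) by (auto simp: mono_def)
  have "g integrable_on {p 0..p n}"
    by (rule integrable_on_subinterval[OF Suc.prems]) (use le in auto)
  with Suc.IH Suc.prems le show ?case
    using Henstock_Kurzweil_Integration.integral_combine[of "p 0" "p n" "p (Suc n)" g] by simp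
qed simp

lemma abs_integrable_continuous_mult:
  fixes k g :: "real \<Rightarrow> real"
  assumes "continuous_on {a..b} k" "g absolutely_integrable_on {a..b}"
  shows "(\<lambda>s. k s * g s) absolutely_integrable_on {a..b}"
proof (rule absolutely_integrable_bounded_measurable_product_real)
  show "k \<in> borel_measurable (lebesgue_on {a..b})"
    using assms(1) by (intro continuous_imp_measurable_on_sets_lebesgue) auto
  show "bounded (k ` {a..b})"
    using assms(1) by (intro compact_imp_bounded compact_continuous_image) auto
qed (use assms in auto)

text \<open>Uniform continuity of \<open>k\<close> makes its oscillation on each cell of a fine grid
  smaller than \<epsilon>, so moving the tag costs at most \<epsilon> times the integral of
  \<open>\<bar>g\<bar>\<close> over the cell. The tags stay free because left end points occur in
  the stochastic sums and right end points after summation by parts.\<close>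

lemma Riemann_Stieltjes_sum_tendsto:
  fixes k g :: "real \<Rightarrow> real" and t :: real and c :: "nat \<Rightarrow> nat \<Rightarrow> real"
  defines "p \<equiv> \<lambda>n i. t * real i / real (Suc n)"
  assumes t: "0 \<le> t" and k: "continuous_on {0..t} k" and g: "g absolutely_integrable_on {0..t}"
    and c: "\<And>n i. i \<le> n \<Longrightarrow> c n i \<in> {p n i..p n (Suc i)}"
  shows "(\<lambda>n. \<Sum>i<Suc n. k (c n i) * integral {p n i..p n (Suc i)} g)
           \<longlonglongrightarrow> integral {0..t} (\<lambda>s. k s * g s)"
proof (rule LIMSEQ_I)
  fix e :: real assume e: "0 < e"
  define B where "B = integral {0..t} (\<lambda>s. \<bar>g s\<bar>)"
  have gi: "g integrable_on {0..t}" "(\<lambda>s. \<bar>g s\<bar>) integrable_on {0..t}"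
    using g by (auto simp: absolutely_integrable_on_def)
  have B: "B \<ge> 0" unfolding B_def by (rule integral_nonneg) (use gi in auto)
  \<comment> \<open>The \<open>+ 1\<close> covers \<open>B = 0\<close> and makes the final
    inequality strict.\<close>
  define \<epsilon> where "\<epsilon> = e / (B + 1)"
  have eps: "\<epsilon> > 0" using e B by (simp add: \<epsilon>_def)
  have "uniformly_continuous_on {0..t} k" using k by (intro compact_uniformly_continuous) auto
  then obtain d where d: "d > 0"
    "\<And>x y. x \<in> {0..t} \<Longrightarrow> y \<in> {0..t} \<Longrightarrow> \<bar>x - y\<bar> < d \<Longrightarrow> \<bar>k x - k y\<bar> < \<epsilon>"
    using eps unfolding uniformly_continuous_on_def dist_real_def by metis
  obtain N where N: "t / d < real N" using reals_Archimedean2 by blast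
  have kg: "(\<lambda>s. k s * g s) integrable_on {0..t}"
    using abs_integrable_continuous_mult[OF k g] by (simp add: absolutely_integrable_on_def)
  show "\<exists>N. \<forall>n\<ge>N. norm ((\<Sum>i<Suc n. k (c n i) * integral {p n i..p n (Suc i)} g)
            - integral {0..t} (\<lambda>s. k s * g s)) < e"
  proof (intro exI[of _ N] allI impI)
    fix n assume n: "N \<le> n"
    have mono: "mono (p n)" using t by (auto simp: p_def mono_def intro!: divide_right_mono mult_left_mono)
    have p0: "p n 0 = 0" "p n (Suc n) = t"
      unfolding p_def by simp (rule nonzero_mult_div_cancel_right, simp)
    have sub: "{p n i..p n (Suc i)} \<subseteq> {0..t}" if "i < Suc n" for i
      using monoD[OF mono, of 0 i] monoD[OF mono, of "Suc i" "Suc n"] that p0 by auto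
    have mesh: "p n (Suc i) - p n i < d" for i
    proof -
      have "p n (Suc i) - p n i = t / real (Suc n)"
        by (simp add: p_def diff_divide_distrib[symmetric] right_diff_distrib[symmetric])
      also have "\<dots> < d"
      proof -
        have "t < d * real N" using N d(1) by (simp add: field_simps)
        also have "\<dots> \<le> d * real (Suc n)" using d(1) n by (intro mult_left_mono) auto
        finally show ?thesis by (simp add: field_simps)
      qed
      finally show ?thesis .
    qed
    have int: "h integrable_on {p n i..p n (Suc i)}"
      if "h integrable_on {0..t}" "i < Suc n" for h :: "real \<Rightarrow> real" and i
      using that sub by (meson integrable_on_subinterval)
    have pieces: "(\<Sum>i<Suc n. integral {p n i..p n (Suc i)} h) = integral {0..t} h"
      if "h integrable_on {0..t}" for h :: "real \<Rightarrow> real"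
      using integral_sum_pieces[OF mono, of h "Suc n"] that p0 by simp
    have step: "\<bar>k (c n i) * integral {p n i..p n (Suc i)} g - integral {p n i..p n (Suc i)} (\<lambda>s. k s * g s)\<bar>
       \<le> \<epsilon> * integral {p n i..p n (Suc i)} (\<lambda>s. \<bar>g s\<bar>)" if i: "i < Suc n" for i
    proof -
      let ?I = "{p n i..p n (Suc i)}"
      have kgi: "(\<lambda>s. k (c n i) * g s) integrable_on ?I" "(\<lambda>s. k s * g s) integrable_on ?I"
        using int[OF gi(1) i] int[OF kg i] by (auto intro: integrable_on_mult_right)
      have "\<bar>k (c n i) * integral ?I g - integral ?I (\<lambda>s. k s * g s)\<bar>
          = norm (integral ?I (\<lambda>s. k (c n i) * g s - k s * g s))"
        using kgi by (simp add: Henstock_Kurzweil_Integration.integral_diff)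
      also have "\<dots> \<le> integral ?I (\<lambda>s. \<epsilon> * \<bar>g s\<bar>)"
      proof (rule integral_norm_bound_integral)
        show "(\<lambda>s. k (c n i) * g s - k s * g s) integrable_on ?I"
          using kgi by (rule integrable_diff)
        show "(\<lambda>s. \<epsilon> * \<bar>g s\<bar>) integrable_on ?I"
          using int[OF gi(2) i] by (rule integrable_on_mult_right)
        fix s assume s: "s \<in> ?I"
        have ci: "c n i \<in> ?I" using c i by auto
        have "\<bar>c n i - s\<bar> < d" using mesh[of i] s ci by auto
        then have "\<bar>k (c n i) - k s\<bar> < \<epsilon>" using d(2) s ci sub[OF i] by blast
        then show "norm (k (c n i) * g s - k s * g s) \<le> \<epsilon> * \<bar>g s\<bar>"
          by (simp add: left_diff_distrib[symmetric] abs_mult mult_right_mono)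
      qed
      finally show ?thesis by simp
    qed
    have "norm ((\<Sum>i<Suc n. k (c n i) * integral {p n i..p n (Suc i)} g) - integral {0..t} (\<lambda>s. k s * g s))
       = \<bar>\<Sum>i<Suc n. k (c n i) * integral {p n i..p n (Suc i)} g - integral {p n i..p n (Suc i)} (\<lambda>s. k s * g s)\<bar>"
      using pieces[OF kg] by (simp add: sum_subtractf)
    also have "\<dots> \<le> (\<Sum>i<Suc n. \<epsilon> * integral {p n i..p n (Suc i)} (\<lambda>s. \<bar>g s\<bar>))"
      by (rule order_trans[OF sum_abs sum_mono]) (use step in auto)
    also have "\<dots> = \<epsilon> * B" unfolding sum_distrib_left[symmetric] pieces[OF gi(2)] B_def ..
    also have "\<dots> < e" using e B by (simp add: \<epsilon>_def field_simps)
    finally show "norm ((\<Sum>i<Suc n. k (c n i) * integral {p n i..p n (Suc i)} g)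
            - integral {0..t} (\<lambda>s. k s * g s)) < e" .
  qed
qed

text \<open>Let \<open>Q\<close> be the right-hand side of the assumption. Both
  \<open>(A s)\<^sup>2\<close> and \<open>(\<rho> s)\<^sup>2\<close> are at most \<open>Q s\<close>,
  so the derivative of \<open>Q\<close> is at most \<open>(2 * L + M\<^sup>2) * Q s\<close>. Keeping
  the drift part inside a square is what gives it the rate \<open>L\<close> after the square root is
  taken, next to \<open>M\<^sup>2 / 2\<close> from the noise part.\<close>

lemma Gronwall_square:
  fixes \<rho> :: "real \<Rightarrow> real" and w L M t :: real
  assumes cont: "continuous_on {0..t} \<rho>" and w: "0 \<le> w" and L: "0 \<le> L"
    and le: "\<And>s. s \<in> {0..t} \<Longrightarrow>
      (\<rho> s)\<^sup>2 \<le> (w + L * integral {0..s} \<rho>)\<^sup>2 + M\<^sup>2 * integral {0..s} (\<lambda>r. (\<rho> r)\<^sup>2)"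
    and s: "s \<in> {0..t}"
  shows "\<rho> s \<le> w * exp ((L + M\<^sup>2 / 2) * s)"
proof -
  define A where "A s = w + L * integral {0..s} \<rho>" for s
  define B where "B s = M\<^sup>2 * integral {0..s} (\<lambda>r. (\<rho> r)\<^sup>2)" for s
  define Q where "Q s = (A s)\<^sup>2 + B s" for s
  define c where "c = 2 * L + M\<^sup>2"
  have c2: "continuous_on {0..t} (\<lambda>r. (\<rho> r)\<^sup>2)" using cont by (intro continuous_intros)
  have dA: "(A has_real_derivative L * \<rho> s) (at s within {0..t})" if "s \<in> {0..t}" for s
    unfolding A_def using integral_has_real_derivative[OF cont that]
    by (auto intro!: derivative_eq_intros)
  have dB: "(B has_real_derivative M\<^sup>2 * (\<rho> s)\<^sup>2) (at s within {0..t})" if "s \<in> {0..t}" for s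
    unfolding B_def using integral_has_real_derivative[OF c2 that]
    by (auto intro!: derivative_eq_intros)
  have B0: "0 \<le> B s" if "s \<in> {0..t}" for s
  proof -
    have "0 \<le> integral {0..s} (\<lambda>r. (\<rho> r)\<^sup>2)"
      using that by (intro integral_nonneg integrable_continuous_real continuous_on_subset[OF c2]) auto
    then show ?thesis unfolding B_def by simp
  qed
  \<comment> \<open>Integrating factor: the differential inequality for \<open>Q\<close> says that
    \<open>H\<close> does not increase.\<close>
  define H where "H s = Q s * exp (- c * s)" for s
  define H' where "H' s = (2 * A s * (L * \<rho> s) + M\<^sup>2 * (\<rho> s)\<^sup>2 - c * Q s) * exp (- c * s)" for s
  have dH: "(H has_real_derivative H' s) (at s within {0..t})" if "s \<in> {0..t}" for s
    unfolding H_def Q_def H'_def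
    using dA[OF that] dB[OF that]
    by (auto intro!: derivative_eq_intros simp: algebra_simps)
  have H'0: "H' s \<le> 0" if "s \<in> {0..t}" for s
  proof -
    have q: "(\<rho> s)\<^sup>2 \<le> Q s" using le[OF that] by (simp add: Q_def A_def B_def)
    have "2 * (A s * \<rho> s) \<le> (A s)\<^sup>2 + (\<rho> s)\<^sup>2" using sum_squares_bound[of "A s" "\<rho> s"] by simp
    also have "\<dots> \<le> 2 * Q s" using q B0[OF that] by (simp add: Q_def)
    finally have "L * (2 * (A s * \<rho> s)) \<le> L * (2 * Q s)" using L by (rule mult_left_mono)
    moreover have "M\<^sup>2 * (\<rho> s)\<^sup>2 \<le> M\<^sup>2 * Q s" using q by (intro mult_left_mono) auto
    ultimately have "2 * A s * (L * \<rho> s) + M\<^sup>2 * (\<rho> s)\<^sup>2 - c * Q s \<le> 0"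
      by (simp add: c_def algebra_simps)
    then show ?thesis unfolding H'_def by (intro mult_nonpos_nonneg) auto
  qed
  have "H s \<le> H 0"
  proof -
    have "\<exists>x\<in>{0..s}. H s - H 0 = H' x * (s - 0)" if "0 < s"
    proof -
      have "(H has_derivative (\<lambda>y. H' x * y)) (at x within {0..s})" if "0 \<le> x" "x \<le> s" for x
        using has_field_derivative_subset[OF dH[of x], of "{0..s}"] that s
        by (simp add: has_field_derivative_def)
      from mvt_very_simple[OF _ this] that show ?thesis by auto
    qed
    moreover have "H' x * (s - 0) \<le> 0" if "x \<in> {0..s}" for x
      using that s H'0[of x] by (intro mult_nonpos_nonneg) auto
    ultimately show ?thesis using s by (cases "s = 0") fastforce+
  qed
  then have "Q s \<le> w\<^sup>2 * exp (c * s)"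
    by (simp add: H_def Q_def A_def B_def exp_minus field_simps)
  moreover have "(\<rho> s)\<^sup>2 \<le> Q s" using le[OF s] by (simp add: Q_def A_def B_def)
  moreover have "w\<^sup>2 * exp (c * s) = (w * exp ((L + M\<^sup>2 / 2) * s))\<^sup>2"
    by (simp add: power_mult_distrib c_def exp_double[symmetric] algebra_simps)
  ultimately have "(\<rho> s)\<^sup>2 \<le> (w * exp ((L + M\<^sup>2 / 2) * s))\<^sup>2" by simp
  then show ?thesis by (rule power2_le_imp_le) (use w in auto)
qed

section \<open>An elementary bound for the relative entropy of centred normal laws\<close>

lemma diff_one_ln_le:
  fixes r :: real
  assumes "0 < r"
  shows "1 \<le> r \<Longrightarrow> r - 1 - ln r \<le> (r - 1)\<^sup>2 / 2"
    and "r \<le> 1 \<Longrightarrow> r - 1 - ln r \<le> (1 / r - 1)\<^sup>2 / 2"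
proof -
  assume r: "1 \<le> r"
  have "((\<lambda>x. (x - 1)\<^sup>2 / 2 - (x - 1 - ln x)) 1) \<le> ((\<lambda>x. (x - 1)\<^sup>2 / 2 - (x - 1 - ln x)) r)"
  proof (rule DERIV_nonneg_imp_nondecreasing[OF r])
    fix x :: real assume x: "1 \<le> x" "x \<le> r"
    have "((\<lambda>x. (x - 1)\<^sup>2 / 2 - (x - 1 - ln x)) has_real_derivative (x - 1) - (1 - 1 / x)) (at x)"
      using x by (auto intro!: derivative_eq_intros simp: field_simps)
    moreover have "(x - 1) - (1 - 1 / x) = (x - 1)\<^sup>2 / x" using x by (simp add: field_simps power2_eq_square)
    ultimately show "\<exists>y. ((\<lambda>x. (x - 1)\<^sup>2 / 2 - (x - 1 - ln x)) has_real_derivative y) (at x) \<and> 0 \<le> y"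
      using x by (intro exI[of _ "(x - 1)\<^sup>2 / x"]) auto
  qed
  then show "r - 1 - ln r \<le> (r - 1)\<^sup>2 / 2" by simp
next
  assume r: "r \<le> 1"
  \<comment> \<open>Below 1 the bound by \<open>(r - 1)\<^sup>2 / 2\<close> fails, since the
    left-hand side blows up at 0. In the variable \<open>1 / r\<close> the comparison function is
    again nondecreasing from 1 on.\<close>
  define u where "u = 1 / r"
  have u: "1 \<le> u" using r assms by (simp add: u_def)
  have "((\<lambda>x. (x - 1)\<^sup>2 / 2 - (1 / x - 1 + ln x)) 1) \<le> ((\<lambda>x. (x - 1)\<^sup>2 / 2 - (1 / x - 1 + ln x)) u)"
  proof (rule DERIV_nonneg_imp_nondecreasing[OF u])
    fix x :: real assume x: "1 \<le> x" "x \<le> u"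
    have "((\<lambda>x. (x - 1)\<^sup>2 / 2 - (1 / x - 1 + ln x)) has_real_derivative (x - 1) * (1 - 1 / x\<^sup>2)) (at x)"
      using x by (auto intro!: derivative_eq_intros simp: field_simps power2_eq_square)
    moreover have "0 \<le> (x - 1) * (1 - 1 / x\<^sup>2)"
      using x by (intro mult_nonneg_nonneg) (auto simp: field_simps)
    ultimately show "\<exists>y. ((\<lambda>x. (x - 1)\<^sup>2 / 2 - (1 / x - 1 + ln x)) has_real_derivative y) (at x) \<and> 0 \<le> y"
      by blast
  qed
  then show "r - 1 - ln r \<le> (1 / r - 1)\<^sup>2 / 2" using assms by (simp add: u_def ln_div)
qed

text \<open>The left-hand side is twice the relative entropy of \<open>N(0, v1)\<close> with respect to \<open>N(0, v2)\<close>.\<close>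

lemma ratio_entropy_le:
  fixes v1 v2 m :: real
  assumes m: "0 < m" "m \<le> v1" "m \<le> v2"
  shows "v1 / v2 - 1 - ln (v1 / v2) \<le> (v1 - v2)\<^sup>2 / (2 * m\<^sup>2)"
proof -
  have pos: "0 < v1" "0 < v2" using m by auto
  \<comment> \<open>Both bounds of \<open>diff_one_ln_le\<close> divide by the smaller variance,
    which is at least \<open>m\<close>; hence one estimate serves both orders of \<open>v1\<close>
    and \<open>v2\<close>.\<close>
  have key: "(x / y - 1)\<^sup>2 / 2 \<le> (x - y)\<^sup>2 / (2 * m\<^sup>2)" if "m \<le> y" for x y
  proof -
    have "(x / y - 1)\<^sup>2 / 2 = (x - y)\<^sup>2 / (2 * y\<^sup>2)"
      using that m by (simp add: field_simps power2_eq_square)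
    also have "\<dots> \<le> (x - y)\<^sup>2 / (2 * m\<^sup>2)"
      using that m by (intro divide_left_mono mult_left_mono power_mono) auto
    finally show ?thesis .
  qed
  show ?thesis
  proof (cases "v2 \<le> v1")
    case True
    then show ?thesis
      using order_trans[OF diff_one_ln_le(1)[of "v1 / v2"] key[of v2 v1]] m pos by simp
  next
    case False
    then show ?thesis
      using order_trans[OF diff_one_ln_le(2)[of "v1 / v2"], of "(v1 - v2)\<^sup>2 / (2 * m\<^sup>2)"]
        key[of v1 v2] m pos
      by (simp add: power2_commute)
  qed
qed

section \<open>Square-integrable functions\<close>

lemma integral_Cauchy_Schwarz:
  fixes f g :: "'a \<Rightarrow> real"
  assumes [measurable]: "f \<in> borel_measurable M" "g \<in> borel_measurable M"
    and f2: "integrable M (\<lambda>x. (f x)\<^sup>2)" and g2: "integrable M (\<lambda>x. (g x)\<^sup>2)"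
  shows "integrable M (\<lambda>x. f x * g x)"
    and "(\<integral>x. f x * g x \<partial>M)\<^sup>2 \<le> (\<integral>x. (f x)\<^sup>2 \<partial>M) * (\<integral>x. (g x)\<^sup>2 \<partial>M)"
proof -
  show fg: "integrable M (\<lambda>x. f x * g x)"
  proof (rule Bochner_Integration.integrable_bound[OF Bochner_Integration.integrable_add[OF f2 g2]])
    show "AE x in M. norm (f x * g x) \<le> norm ((f x)\<^sup>2 + (g x)\<^sup>2)"
    proof (rule AE_I2)
      fix x
      have "2 * (\<bar>f x\<bar> * \<bar>g x\<bar>) \<le> (f x)\<^sup>2 + (g x)\<^sup>2"
        using sum_squares_bound[of "\<bar>f x\<bar>" "\<bar>g x\<bar>"] by (simp add: mult.assoc)
      moreover have "0 \<le> \<bar>f x\<bar> * \<bar>g x\<bar>" by simp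
      ultimately have "\<bar>f x\<bar> * \<bar>g x\<bar> \<le> (f x)\<^sup>2 + (g x)\<^sup>2" by linarith
      then show "norm (f x * g x) \<le> norm ((f x)\<^sup>2 + (g x)\<^sup>2)" by (simp add: abs_mult)
    qed
  qed simp
  define p where "p = (\<integral>x. (f x)\<^sup>2 \<partial>M)"
  define q where "q = (\<integral>x. (g x)\<^sup>2 \<partial>M)"
  define c where "c = (\<integral>x. f x * g x \<partial>M)"
  have q0: "0 \<le> q" unfolding q_def by simp
  show "c\<^sup>2 \<le> p * q"
  proof (cases "q = 0")
    case True
    then have "AE x in M. (g x)\<^sup>2 = 0"
      using integral_nonneg_eq_0_iff_AE[OF g2] by (simp add: q_def)
    then have "c = 0" unfolding c_def by (intro integral_eq_zero_AE) auto
    then show ?thesis using True by simp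
  next
    case False
    \<comment> \<open>The usual minimising multiplier \<open>c / q\<close>, cleared of its
      denominator; the integral then equals \<open>q * (p * q - c\<^sup>2)\<close>.\<close>
    have "0 \<le> (\<integral>x. (q * f x - c * g x)\<^sup>2 \<partial>M)" by simp
    also have "(\<lambda>x. (q * f x - c * g x)\<^sup>2) = (\<lambda>x. q\<^sup>2 * (f x)\<^sup>2 - 2 * q * c * (f x * g x) + c\<^sup>2 * (g x)\<^sup>2)"
      by (simp add: fun_eq_iff power2_eq_square algebra_simps)
    also have "(\<integral>x. q\<^sup>2 * (f x)\<^sup>2 - 2 * q * c * (f x * g x) + c\<^sup>2 * (g x)\<^sup>2 \<partial>M)
        = q\<^sup>2 * p - 2 * q * c * c + c\<^sup>2 * q"
      using f2 g2 fg by (simp add: p_def q_def c_def)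
    also have "\<dots> = q * (p * q - c\<^sup>2)" by (simp add: power2_eq_square algebra_simps)
    finally show ?thesis using False q0 by (simp add: zero_le_mult_iff)
  qed
qed

lemma integrable_power2_diff:
  fixes f g :: "'a \<Rightarrow> real"
  assumes [measurable]: "f \<in> borel_measurable M" "g \<in> borel_measurable M"
    and f2: "integrable M (\<lambda>x. (f x)\<^sup>2)" and g2: "integrable M (\<lambda>x. (g x)\<^sup>2)"
  shows "integrable M (\<lambda>x. (f x - g x)\<^sup>2)"
  using integral_Cauchy_Schwarz(1)[OF assms] f2 g2 by (simp add: power2_diff mult.assoc)

text \<open>Expand the square around \<open>g\<close>; the mixed term tends to zero by
  Cauchy-Schwarz. This carries the variances of step integrals to the limit.\<close>

lemma L2_tendsto_integral_power2:
  fixes f :: "nat \<Rightarrow> 'a \<Rightarrow> real" and g :: "'a \<Rightarrow> real"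
  assumes [measurable]: "\<And>k. f k \<in> borel_measurable M" "g \<in> borel_measurable M"
    and f2: "\<And>k. integrable M (\<lambda>x. (f k x)\<^sup>2)" and g2: "integrable M (\<lambda>x. (g x)\<^sup>2)"
    and lim: "(\<lambda>k. \<integral>\<^sup>+x. ennreal ((f k x - g x)\<^sup>2) \<partial>M) \<longlonglongrightarrow> 0"
  shows "(\<lambda>k. \<integral>x. (f k x)\<^sup>2 \<partial>M) \<longlonglongrightarrow> (\<integral>x. (g x)\<^sup>2 \<partial>M)"
proof -
  define d where "d k = (\<integral>x. (f k x - g x)\<^sup>2 \<partial>M)" for k
  define c where "c k = (\<integral>x. g x * (f k x - g x) \<partial>M)" for k
  have d2: "integrable M (\<lambda>x. (f k x - g x)\<^sup>2)" for k
    by (intro integrable_power2_diff f2 g2) auto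
  have "(\<integral>\<^sup>+x. ennreal ((f k x - g x)\<^sup>2) \<partial>M) = ennreal (d k)" for k
    unfolding d_def using d2 by (intro nn_integral_eq_integral) auto
  with lim have "(\<lambda>k. ennreal (d k)) \<longlonglongrightarrow> ennreal 0" by simp
  then have d: "d \<longlonglongrightarrow> 0" by (subst (asm) tendsto_ennreal_iff) (auto simp: d_def)
  have cbound: "(c k)\<^sup>2 \<le> (\<integral>x. (g x)\<^sup>2 \<partial>M) * d k" for k
    unfolding c_def d_def by (intro integral_Cauchy_Schwarz g2 d2) auto
  have "(\<lambda>k. (c k)\<^sup>2) \<longlonglongrightarrow> 0"
  proof (rule tendsto_sandwich[where f="\<lambda>_. 0"])
    show "(\<lambda>k. (\<integral>x. (g x)\<^sup>2 \<partial>M) * d k) \<longlonglongrightarrow> 0"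
      using tendsto_mult_right_zero[OF d] .
  qed (use cbound in auto)
  then have c: "c \<longlonglongrightarrow> 0" by simp
  have cint: "integrable M (\<lambda>x. g x * (f k x - g x))" for k
    by (intro integral_Cauchy_Schwarz(1) g2 d2) auto
  have "(\<integral>x. (f k x)\<^sup>2 \<partial>M) = d k + 2 * c k + (\<integral>x. (g x)\<^sup>2 \<partial>M)" for k
  proof -
    have "(\<integral>x. (f k x)\<^sup>2 \<partial>M) = (\<integral>x. (f k x - g x)\<^sup>2 + 2 * (g x * (f k x - g x)) + (g x)\<^sup>2 \<partial>M)"
      by (simp add: power2_eq_square algebra_simps)
    also have "\<dots> = d k + 2 * c k + (\<integral>x. (g x)\<^sup>2 \<partial>M)"
      using d2 cint g2 by (simp add: d_def c_def)
    finally show ?thesis .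
  qed
  moreover have "(\<lambda>k. d k + 2 * c k + (\<integral>x. (g x)\<^sup>2 \<partial>M)) \<longlonglongrightarrow> 0 + 2 * 0 + (\<integral>x. (g x)\<^sup>2 \<partial>M)"
    by (intro tendsto_intros d c)
  ultimately show ?thesis by simp
qed

text \<open>The function \<open>iexp (v * x)\<close> of \<open>x\<close> is Lipschitz with constant
  \<open>\<bar>v\<bar>\<close>, so the common summand \<open>R\<close> drops out of the difference
  whatever its moments are. On a probability space the remaining mean distance is at most the L2
  distance.\<close>

lemma (in prob_space) L2_tendsto_char:
  fixes Y :: "nat \<Rightarrow> 'a \<Rightarrow> real"
  assumes [measurable]: "\<And>k. Y k \<in> borel_measurable M" "Z \<in> borel_measurable M" "R \<in> borel_measurable M"
    and lim: "(\<lambda>k. \<integral>\<^sup>+x. ennreal ((Y k x - Z x)\<^sup>2) \<partial>M) \<longlonglongrightarrow> 0"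
  shows "(\<lambda>k. char (distr M borel (\<lambda>x. R x + Y k x)) v) \<longlonglongrightarrow> char (distr M borel (\<lambda>x. R x + Z x)) v"
proof -
  let ?c = "\<lambda>k. char (distr M borel (\<lambda>x. R x + Y k x)) v" and ?d = "char (distr M borel (\<lambda>x. R x + Z x)) v"
  have bound: "ennreal ((norm (?c k - ?d))\<^sup>2) \<le> ennreal (v\<^sup>2) * (\<integral>\<^sup>+x. ennreal ((Y k x - Z x)\<^sup>2) \<partial>M)" for k
  proof -
    have "?c k - ?d = (CLINT x|M. iexp (v * (R x + Y k x)) - iexp (v * (R x + Z x)))"
      by (simp add: char_def integral_distr integrable_iexp)
    then have "ennreal (norm (?c k - ?d)) \<le> (\<integral>\<^sup>+x. norm (iexp (v * (R x + Y k x)) - iexp (v * (R x + Z x))) \<partial>M)"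
      by (auto intro!: integral_norm_bound_ennreal integrable_iexp)
    also have "\<dots> \<le> (\<integral>\<^sup>+x. ennreal \<bar>v\<bar> * ennreal \<bar>Y k x - Z x\<bar> \<partial>M)"
    proof (rule nn_integral_mono)
      fix x
      have "norm (iexp (v * (R x + Y k x)) - iexp (v * (R x + Z x)))
          = norm (iexp (v * (R x + Z x)) * (iexp (v * (Y k x - Z x)) - 1))"
        by (simp add: algebra_simps exp_add[symmetric])
      also have "\<dots> = norm (iexp (v * (Y k x - Z x)) - 1)" by (simp add: norm_mult)
      also have "\<dots> \<le> \<bar>v * (Y k x - Z x)\<bar>"
        using iexp_approx1[of "v * (Y k x - Z x)" 0] by simp
      finally show "ennreal (norm (iexp (v * (R x + Y k x)) - iexp (v * (R x + Z x))))
          \<le> ennreal \<bar>v\<bar> * ennreal \<bar>Y k x - Z x\<bar>"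
        by (simp add: ennreal_mult[symmetric] abs_mult)
    qed
    finally have "(ennreal (norm (?c k - ?d)))\<^sup>2 \<le> (\<integral>\<^sup>+x. ennreal \<bar>v\<bar> * ennreal \<bar>Y k x - Z x\<bar> \<partial>M)\<^sup>2"
      by (rule power_mono) simp
    also have "\<dots> \<le> (\<integral>\<^sup>+x. (ennreal \<bar>v\<bar>)\<^sup>2 \<partial>M) * (\<integral>\<^sup>+x. (ennreal \<bar>Y k x - Z x\<bar>)\<^sup>2 \<partial>M)"
      by (rule Cauchy_Schwarz_nn_integral) auto
    finally show ?thesis by (simp add: ennreal_power emeasure_space_1)
  qed
  have "(\<lambda>k. ennreal ((norm (?c k - ?d))\<^sup>2)) \<longlonglongrightarrow> ennreal 0"
  proof (rule tendsto_sandwich[where f="\<lambda>_. 0"])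
    show "(\<lambda>k. ennreal (v\<^sup>2) * (\<integral>\<^sup>+x. ennreal ((Y k x - Z x)\<^sup>2) \<partial>M)) \<longlonglongrightarrow> ennreal 0"
      using ennreal_tendsto_cmult[OF _ lim, of "ennreal (v\<^sup>2)"] by simp
  qed (use bound in auto)
  then have "(\<lambda>k. (norm (?c k - ?d))\<^sup>2) \<longlonglongrightarrow> 0" by (subst (asm) tendsto_ennreal_iff) auto
  then have "(\<lambda>k. norm (?c k - ?d)) \<longlonglongrightarrow> 0" by simp
  then show ?thesis by (simp add: tendsto_norm_zero_iff LIM_zero_iff)
qed

section \<open>Wiener and Ito integrals\<close>

locale brownian_filtration =
  fixes M :: "'a measure" and F :: "real \<Rightarrow> 'a measure" and W :: "real \<Rightarrow> 'a \<Rightarrow> real"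
  assumes filtered: "filtered_prob_space M F" and brownian: "brownian_motion M F W"

sublocale brownian_filtration \<subseteq> prob_space M
  using filtered by (simp add: filtered_prob_space_def)

context brownian_filtration
begin

lemma space_F: "0 \<le> t \<Longrightarrow> space (F t) = space M"
  using filtered by (auto simp: filtered_prob_space_def subalgebra_def)

lemma sets_F: "0 \<le> t \<Longrightarrow> sets (F t) \<subseteq> sets M"
  using filtered by (auto simp: filtered_prob_space_def subalgebra_def)

lemma measurable_F_mono:
  "g \<in> borel_measurable (F s) \<Longrightarrow> 0 \<le> s \<Longrightarrow> s \<le> t \<Longrightarrow> g \<in> borel_measurable (F t)"
proof -
  assume *: "g \<in> borel_measurable (F s)" "0 \<le> s" "s \<le> t"
  have "sets (F s) \<subseteq> sets (F t)" using * filtered by (auto simp: filtered_prob_space_def)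
  then have "subalgebra (F t) (F s)" using * space_F by (simp add: subalgebra_def)
  then show ?thesis using *(1) by (rule measurable_from_subalg)
qed

lemma measurable_F_M: "g \<in> borel_measurable (F s) \<Longrightarrow> 0 \<le> s \<Longrightarrow> g \<in> borel_measurable M"
  using filtered by (auto simp: filtered_prob_space_def intro: measurable_from_subalg)

lemma W_F: "0 \<le> s \<Longrightarrow> s \<le> t \<Longrightarrow> W s \<in> borel_measurable (F t)"
  using brownian measurable_F_mono[of "W s" s t] by (auto simp: brownian_motion_def adapted_def)

lemma W_M: "0 \<le> s \<Longrightarrow> W s \<in> borel_measurable M"
  using W_F[of s s] measurable_F_M by blast

lemma indep_increment:
  assumes "0 \<le> s" "s < t" "g \<in> borel_measurable (F s)"
  shows "indep_var borel g borel (\<lambda>\<omega>. W t \<omega> - W s \<omega>)"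
proof -
  let ?D = "\<lambda>\<omega>. W t \<omega> - W s \<omega>"
  let ?S = "{?D -` A \<inter> space M | A. A \<in> sets borel}"
  have g: "g \<in> borel_measurable M" using assms measurable_F_M by blast
  have D: "?D \<in> borel_measurable M" using assms by (intro borel_measurable_diff W_M) auto
  have indep: "indep_set (sets (F s)) ?S"
    using brownian assms by (auto simp: brownian_motion_def)
  \<comment> \<open>\<open>indep_var_eq\<close> speaks of generated sigma-algebras; the preimages of
    Borel sets already form one.\<close>
  have S: "sigma_sets (space M) ?S = ?S"
  proof -
    have eq: "sigma_sets UNIV (sets borel) = sets (borel :: real measure)"
      using sets.sigma_sets_eq[of "borel :: real measure"] by (simp only: space_borel)
    have "{?D -` A \<inter> space M | A. A \<in> sigma_sets UNIV (sets borel)} = sigma_sets (space M) ?S"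
      by (rule sigma_sets_vimage_commute) simp
    then show ?thesis unfolding eq by (rule sym)
  qed
  have "sigma_sets (space M) {g -` A \<inter> space M | A. A \<in> sets borel} \<subseteq> sets (F s)"
  proof -
    have "g -` A \<inter> space M \<in> sets (F s)" if "A \<in> sets borel" for A
      using measurable_sets[OF assms(3) that] by (simp add: space_F[OF assms(1)])
    then have "{g -` A \<inter> space M | A. A \<in> sets borel} \<subseteq> sets (F s)" by auto
    from sets.sigma_sets_subset[OF this] show ?thesis by (simp only: space_F[OF assms(1)])
  qed
  with indep show ?thesis
    unfolding indep_var_eq S using g D sets_F[OF assms(1)] by (simp only: indep_sets2_eq) blast
qed

lemma increment_moments:
  assumes "0 \<le> s" "s < t"
  shows "integrable M (\<lambda>\<omega>. W t \<omega> - W s \<omega>)" "(\<integral>\<omega>. W t \<omega> - W s \<omega> \<partial>M) = 0"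
    "integrable M (\<lambda>\<omega>. (W t \<omega> - W s \<omega>)\<^sup>2)" "(\<integral>\<omega>. (W t \<omega> - W s \<omega>)\<^sup>2 \<partial>M) = t - s"
proof -
  have d: "distributed M lborel (\<lambda>\<omega>. W t \<omega> - W s \<omega>) (normal_density 0 (sqrt (t - s)))"
    using brownian assms by (auto simp: brownian_motion_def)
  have pos: "0 < sqrt (t - s)" using assms by simp
  show "integrable M (\<lambda>\<omega>. W t \<omega> - W s \<omega>)"
    using distributed_integrable[OF d, of "\<lambda>x. x"] integrable_normal_moment_nz_1[OF pos, of 0]
    by (simp add: normal_density_nonneg)
  show "integrable M (\<lambda>\<omega>. (W t \<omega> - W s \<omega>)\<^sup>2)"
    using distributed_integrable[OF d, of "\<lambda>x. x\<^sup>2"] integrable_normal_moment[OF pos, of 0 2]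
    by (simp add: normal_density_nonneg)
  show "(\<integral>\<omega>. W t \<omega> - W s \<omega> \<partial>M) = 0"
    using distributed_integral[OF d, of "\<lambda>x. x"] integral_normal_moment_nz_1[OF pos, of 0]
    by (simp add: normal_density_nonneg)
  show "(\<integral>\<omega>. (W t \<omega> - W s \<omega>)\<^sup>2 \<partial>M) = t - s"
    using distributed_integral[OF d, of "\<lambda>x. x\<^sup>2"] integral_normal_moment_even[OF pos, of 0 1] assms
    by (simp add: normal_density_nonneg)
qed

lemma char_add_increment:
  assumes "0 \<le> s" "s \<le> t" "R \<in> borel_measurable (F s)"
  shows "char (distr M borel (\<lambda>\<omega>. R \<omega> + c * (W t \<omega> - W s \<omega>))) v
    = char (distr M borel R) v * exp (- (v\<^sup>2 * (c\<^sup>2 * (t - s))) / 2)"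
proof (cases "s = t")
  case True
  then show ?thesis by simp
next
  case False
  with assms have st: "s < t" by simp
  have d: "distributed M lborel (\<lambda>\<omega>. W t \<omega> - W s \<omega>) (normal_density 0 (sqrt (t - s)))"
    using brownian assms st by (auto simp: brownian_motion_def)
  have D: "(\<lambda>\<omega>. W t \<omega> - W s \<omega>) \<in> borel_measurable M" using assms by (intro borel_measurable_diff W_M) auto
  have n: "distributed M lborel (\<lambda>\<omega>. (W t \<omega> - W s \<omega>) / sqrt (t - s)) std_normal_density"
    using normal_standard_normal_convert[of "sqrt (t - s)" "\<lambda>\<omega>. W t \<omega> - W s \<omega>" 0] d st by simp
  have "indep_var borel ((\<lambda>x. x) \<circ> R) borel ((\<lambda>x. c * x) \<circ> (\<lambda>\<omega>. W t \<omega> - W s \<omega>))"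
    by (rule indep_var_compose[OF indep_increment[OF assms(1) st assms(3)]]) auto
  then have "indep_var borel R borel (\<lambda>\<omega>. c * (W t \<omega> - W s \<omega>))" by (simp add: comp_def)
  then have "char (distr M borel (\<lambda>\<omega>. R \<omega> + c * (W t \<omega> - W s \<omega>))) v
    = char (distr M borel R) v * char (distr M borel (\<lambda>\<omega>. c * (W t \<omega> - W s \<omega>))) v"
    by (rule char_distr_add)
  \<comment> \<open>The frequency is rescaled so that the standardised increment appears, whose
    characteristic function is known.\<close>
  also have "char (distr M borel (\<lambda>\<omega>. c * (W t \<omega> - W s \<omega>))) v
     = char (distr M lborel (\<lambda>\<omega>. (W t \<omega> - W s \<omega>) / sqrt (t - s))) (v * c * sqrt (t - s))"
  proof -
    have "char (distr M borel (\<lambda>\<omega>. c * (W t \<omega> - W s \<omega>))) v = (CLINT \<omega>|M. iexp (v * (c * (W t \<omega> - W s \<omega>))))"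
      unfolding char_def by (rule integral_distr) (use D in auto)
    moreover have "char (distr M lborel (\<lambda>\<omega>. (W t \<omega> - W s \<omega>) / sqrt (t - s))) (v * c * sqrt (t - s))
        = (CLINT \<omega>|M. iexp ((v * c * sqrt (t - s)) * ((W t \<omega> - W s \<omega>) / sqrt (t - s))))"
      unfolding char_def by (rule integral_distr) (use D in auto)
    moreover have "(v * c * sqrt (t - s)) * (x / sqrt (t - s)) = v * (c * x)" for x
      using st by simp
    ultimately show ?thesis by (simp only:)
  qed
  also have "\<dots> = exp (- (v\<^sup>2 * (c\<^sup>2 * (t - s))) / 2)"
    using st by (simp add: distributed_distr_eq_density[OF n] char_std_normal_distribution power_mult_distrib mult_ac)
  finally show ?thesis .
qed

end

text \<open>\<open>wiener_step W h Z\<close> says that \<open>Z = \<integral> h dW\<close> for a step function \<open>h\<close> in the span of the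
  \<open>1\<^bsub>(0, r]\<^esub>\<close>. The difference \<open>W r - W 0\<close> is used because \<open>W 0 = 0\<close> holds only almost surely.\<close>

definition wiener_step ::
    "(real \<Rightarrow> 'a \<Rightarrow> real) \<Rightarrow> (real \<Rightarrow> real) \<Rightarrow> ('a \<Rightarrow> real) \<Rightarrow> bool" where
  "wiener_step W h Z \<longleftrightarrow> (\<exists>A c. finite A \<and> A \<subseteq> {0<..} \<and>
     h = (\<lambda>s. \<Sum>r\<in>A. c r * indicator {0<..r} s) \<and> Z = (\<lambda>\<omega>. \<Sum>r\<in>A. c r * (W r \<omega> - W 0 \<omega>)))"

lemma wiener_step_basic:
  assumes "0 \<le> r"
  shows "wiener_step W (indicator {0<..r}) (\<lambda>\<omega>. W r \<omega> - W 0 \<omega>)"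
proof (cases "r = 0")
  case True
  then show ?thesis unfolding wiener_step_def
    by (intro exI[of _ "{}"] exI[of _ "\<lambda>_. 0"]) (auto simp: fun_eq_iff)
next
  case False
  then show ?thesis using assms unfolding wiener_step_def
    by (intro exI[of _ "{r}"] exI[of _ "\<lambda>_. 1"]) (auto simp: fun_eq_iff)
qed

lemma wiener_step_lincomb:
  assumes "wiener_step W h Z" "wiener_step W h' Z'"
  shows "wiener_step W (\<lambda>s. a * h s + b * h' s) (\<lambda>\<omega>. a * Z \<omega> + b * Z' \<omega>)"
proof -
  obtain A c where A: "finite A" "A \<subseteq> {0<..}"
    and h: "h = (\<lambda>s. \<Sum>r\<in>A. c r * indicator {0<..r} s)" "Z = (\<lambda>\<omega>. \<Sum>r\<in>A. c r * (W r \<omega> - W 0 \<omega>))"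
    using assms(1) unfolding wiener_step_def by blast
  obtain B d where B: "finite B" "B \<subseteq> {0<..}"
    and h': "h' = (\<lambda>s. \<Sum>r\<in>B. d r * indicator {0<..r} s)" "Z' = (\<lambda>\<omega>. \<Sum>r\<in>B. d r * (W r \<omega> - W 0 \<omega>))"
    using assms(2) unfolding wiener_step_def by blast
  define e where "e r = (if r \<in> A then a * c r else 0) + (if r \<in> B then b * d r else 0)" for r
  \<comment> \<open>An arbitrary \<open>g\<close> lets one identity treat both the step function
    (\<open>g r\<close> an indicator) and its integral (\<open>g r\<close> equal to
    \<open>W r - W 0\<close>).\<close>
  have eq: "a * (\<Sum>r\<in>A. c r * g r) + b * (\<Sum>r\<in>B. d r * g r) = (\<Sum>r\<in>A \<union> B. e r * g r)" for g :: "real \<Rightarrow> real"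
  proof -
    have "(\<Sum>r\<in>A \<union> B. e r * g r)
      = (\<Sum>r\<in>A \<union> B. if r \<in> A then a * c r * g r else 0) + (\<Sum>r\<in>A \<union> B. if r \<in> B then b * d r * g r else 0)"
      unfolding sum.distrib[symmetric] by (rule sum.cong) (auto simp: e_def distrib_right)
    also have "(\<Sum>r\<in>A \<union> B. if r \<in> A then a * c r * g r else 0) = (\<Sum>r\<in>A. a * c r * g r)"
      using A B by (intro sum.mono_neutral_cong_right) auto
    also have "(\<Sum>r\<in>A \<union> B. if r \<in> B then b * d r * g r else 0) = (\<Sum>r\<in>B. b * d r * g r)"
      using A B by (intro sum.mono_neutral_cong_right) auto
    finally show ?thesis by (simp add: sum_distrib_left mult.assoc)
  qed
  show ?thesis unfolding wiener_step_def h h' eq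
    using A B by (intro exI[of _ "A \<union> B"] exI[of _ e]) auto
qed

lemma wiener_step_sum:
  assumes "finite I" "\<And>i. i \<in> I \<Longrightarrow> wiener_step W (h i) (Z i)"
  shows "wiener_step W (\<lambda>s. \<Sum>i\<in>I. a i * h i s) (\<lambda>\<omega>. \<Sum>i\<in>I. a i * Z i \<omega>)"
  using assms
proof (induction I rule: finite_induct)
  case empty
  then show ?case unfolding wiener_step_def
    by (intro exI[of _ "{}"] exI[of _ "\<lambda>_. 0"]) (auto simp: fun_eq_iff)
next
  case (insert i I)
  then show ?case using wiener_step_lincomb[of W "h i" "Z i" _ _ "a i" 1] by simp
qed

lemma wiener_step_L2:
  assumes "wiener_step W h Z"
  shows "h \<in> borel_measurable borel" "integrable lborel (\<lambda>s. (h s)\<^sup>2)"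
proof -
  obtain A c where h: "h = (\<lambda>s. \<Sum>r\<in>A. c r * indicator {0<..r} s)"
    using assms unfolding wiener_step_def by blast
  show "h \<in> borel_measurable borel" unfolding h by measurable
  have "integrable lborel (\<lambda>s. \<Sum>r\<in>A. \<Sum>q\<in>A. c r * c q * indicator ({0<..r} \<inter> {0<..q}) s :: real)"
    by (intro Bochner_Integration.integrable_sum integrable_mult_right integrable_real_indicator
          emeasure_bounded_finite bounded_subset[OF bounded_closed_interval[of 0 _]]) auto
  also have "(\<lambda>s. \<Sum>r\<in>A. \<Sum>q\<in>A. c r * c q * indicator ({0<..r} \<inter> {0<..q}) s) = (\<lambda>s. (h s)\<^sup>2)"
    by (intro ext, unfold h power2_eq_square sum_product indicator_inter_arith)
      (simp only: mult_ac)
  finally show "integrable lborel (\<lambda>s. (h s)\<^sup>2)" .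
qed

text \<open>Used with \<open>p\<close> the time preceding a removed one, whose weight
  \<open>d\<close> is handed over to \<open>p\<close>. The alternative \<open>g p = 0\<close> covers
  \<open>p = 0\<close>, which is not an index: there both \<open>W p - W 0\<close> and the indicator
  of \<open>(0, p]\<close> vanish.\<close>

lemma sum_fun_upd_add:
  fixes c g :: "'b \<Rightarrow> real"
  assumes "finite A" "p \<in> A \<or> g p = 0"
  shows "(\<Sum>r\<in>A. (c(p := c p + d)) r * g r) = (\<Sum>r\<in>A. c r * g r) + d * g p"
proof (cases "p \<in> A")
  case True
  then show ?thesis using assms(1)
    by (subst (1 2) sum.remove[of _ p]) (auto simp: algebra_simps intro!: sum.cong)
next
  case False
  with assms have "g p = 0" by simp
  moreover have "(\<Sum>r\<in>A. (c(p := c p + d)) r * g r) = (\<Sum>r\<in>A. c r * g r)"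
    using False by (intro sum.cong) auto
  ultimately show ?thesis by simp
qed

lemma L2_tendsto_lincomb:
  fixes f f' :: "nat \<Rightarrow> 'b \<Rightarrow> real"
  assumes [measurable]: "\<And>k. f k \<in> borel_measurable N" "\<And>k. f' k \<in> borel_measurable N"
     "g \<in> borel_measurable N" "g' \<in> borel_measurable N"
    and lim: "(\<lambda>k. \<integral>\<^sup>+x. ennreal ((f k x - g x)\<^sup>2) \<partial>N) \<longlonglongrightarrow> 0" "(\<lambda>k. \<integral>\<^sup>+x. ennreal ((f' k x - g' x)\<^sup>2) \<partial>N) \<longlonglongrightarrow> 0"
  shows "(\<lambda>k. \<integral>\<^sup>+x. ennreal (((a * f k x + b * f' k x) - (a * g x + b * g' x))\<^sup>2) \<partial>N) \<longlonglongrightarrow> 0"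
proof (rule tendsto_sandwich[where f="\<lambda>_. 0"])
  let ?u = "\<lambda>k. ennreal (2 * a\<^sup>2) * (\<integral>\<^sup>+x. ennreal ((f k x - g x)\<^sup>2) \<partial>N)
    + ennreal (2 * b\<^sup>2) * (\<integral>\<^sup>+x. ennreal ((f' k x - g' x)\<^sup>2) \<partial>N)"
  have "?u \<longlonglongrightarrow> ennreal (2 * a\<^sup>2) * 0 + ennreal (2 * b\<^sup>2) * 0"
    by (intro tendsto_add ennreal_tendsto_cmult lim) auto
  then show "?u \<longlonglongrightarrow> 0" by simp
  have "(\<integral>\<^sup>+x. ennreal (((a * f k x + b * f' k x) - (a * g x + b * g' x))\<^sup>2) \<partial>N) \<le> ?u k" for k
  proof -
    have "(\<integral>\<^sup>+x. ennreal (((a * f k x + b * f' k x) - (a * g x + b * g' x))\<^sup>2) \<partial>N)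
      \<le> (\<integral>\<^sup>+x. ennreal (2 * a\<^sup>2) * ennreal ((f k x - g x)\<^sup>2) + ennreal (2 * b\<^sup>2) * ennreal ((f' k x - g' x)\<^sup>2) \<partial>N)"
    proof (rule nn_integral_mono)
      fix x
      have "(p + q)\<^sup>2 \<le> 2 * p\<^sup>2 + 2 * q\<^sup>2" for p q :: real
        using sum_squares_bound[of p q] by (simp add: power2_sum)
      from this[of "a * (f k x - g x)" "b * (f' k x - g' x)"]
      have "(a * (f k x - g x) + b * (f' k x - g' x))\<^sup>2
          \<le> 2 * a\<^sup>2 * (f k x - g x)\<^sup>2 + 2 * b\<^sup>2 * (f' k x - g' x)\<^sup>2"
        by (simp only: power_mult_distrib mult.assoc)
      moreover have "a * (f k x - g x) + b * (f' k x - g' x) = (a * f k x + b * f' k x) - (a * g x + b * g' x)"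
        by (simp add: algebra_simps)
      ultimately have "((a * f k x + b * f' k x) - (a * g x + b * g' x))\<^sup>2
          \<le> 2 * a\<^sup>2 * (f k x - g x)\<^sup>2 + 2 * b\<^sup>2 * (f' k x - g' x)\<^sup>2"
        by simp
      then show "ennreal (((a * f k x + b * f' k x) - (a * g x + b * g' x))\<^sup>2)
          \<le> ennreal (2 * a\<^sup>2) * ennreal ((f k x - g x)\<^sup>2) + ennreal (2 * b\<^sup>2) * ennreal ((f' k x - g' x)\<^sup>2)"
        by (simp add: ennreal_mult[symmetric] ennreal_plus[symmetric] del: ennreal_plus)
    qed
    also have "\<dots> = ?u k" by (simp add: nn_integral_add nn_integral_cmult)
    finally show ?thesis .
  qed
  then show "\<forall>\<^sub>F k in sequentially. (\<integral>\<^sup>+x. ennreal (((a * f k x + b * f' k x) - (a * g x + b * g' x))\<^sup>2) \<partial>N) \<le> ?u k"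
    by simp
qed auto

context brownian_filtration
begin

lemma wiener_step_measurable: "wiener_step W h Z \<Longrightarrow> Z \<in> borel_measurable M"
  unfolding wiener_step_def
  by (auto intro!: borel_measurable_sum borel_measurable_times borel_measurable_diff W_M less_imp_le)

text \<open>Induction on the largest time \<open>m\<close>. With \<open>p\<close> the time before
  it, \<open>W m - W 0\<close> splits into \<open>W p - W 0\<close>, absorbed into the coefficient
  at \<open>p\<close>, and the increment after \<open>p\<close>, which is independent of all that is
  known at \<open>p\<close>. As the coefficient changes, the induction hypothesis has to hold for
  all \<open>c\<close>.\<close>

lemma char_wiener_sum:
  assumes "finite A" "A \<subseteq> {0<..}" "R \<in> borel_measurable (F 0)"
  shows "char (distr M borel (\<lambda>\<omega>. R \<omega> + (\<Sum>r\<in>A. c r * (W r \<omega> - W 0 \<omega>)))) v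
    = char (distr M borel R) v * exp (- (v\<^sup>2 * (\<integral>s. (\<Sum>r\<in>A. c r * indicator {0<..r} s)\<^sup>2 \<partial>lborel)) / 2)"
  using assms(1,2)
proof (induction A arbitrary: c rule: finite_linorder_max_induct)
  case empty
  then show ?case by simp
next
  case (insert m A)
  \<comment> \<open>Inserting 0 gives \<open>p = 0\<close> when no time precedes
    \<open>m\<close>.\<close>
  define p where "p = Max (insert 0 A)"
  have p: "0 \<le> p" "p < m" "p \<in> A \<or> p = 0" "\<And>r. r \<in> A \<Longrightarrow> r \<le> p"
    using insert Max_in[of "insert 0 A"] by (auto simp: p_def)
  have m: "m \<notin> A" using insert by auto
  define c' where "c' = c(p := c p + c m)"
  let ?Z = "\<lambda>\<omega>. \<Sum>r\<in>A. c' r * (W r \<omega> - W 0 \<omega>)"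
  let ?h = "\<lambda>s. \<Sum>r\<in>A. c' r * indicator {0<..r} s :: real"
  have Z: "(\<Sum>r\<in>insert m A. c r * (W r \<omega> - W 0 \<omega>)) = ?Z \<omega> + c m * (W m \<omega> - W p \<omega>)" for \<omega>
    using sum_fun_upd_add[of A p "\<lambda>r. W r \<omega> - W 0 \<omega>" c "c m"] insert p m
    by (auto simp: c'_def algebra_simps)
  have h: "(\<Sum>r\<in>insert m A. c r * indicator {0<..r} s :: real) = ?h s + c m * indicator {p<..m} s" for s
  proof -
    have "?h s = (\<Sum>r\<in>A. c r * indicator {0<..r} s) + c m * indicator {0<..p} s"
      unfolding c'_def using insert p by (intro sum_fun_upd_add) auto
    moreover have "indicator {0<..m} s = indicator {0<..p} s + (indicator {p<..m} s :: real)"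
      using p by (auto split: split_indicator)
    ultimately show ?thesis using insert.hyps(1) m by (simp only: sum.insert not_False_eq_True distrib_left add_ac)
  qed
  \<comment> \<open>The modified step function lives on \<open>(0, p]\<close>, so squaring produces
    no mixed term and the variances add up.\<close>
  have prod: "?h s * indicator {p<..m} s = 0" for s
    using p by (auto simp: sum_distrib_right intro!: sum.neutral split: split_indicator)
      (meson not_less order_trans)
  have "(\<Sum>r\<in>insert m A. c r * indicator {0<..r} s :: real)\<^sup>2 = (?h s)\<^sup>2 + (c m)\<^sup>2 * indicator {p<..m} s" for s
  proof -
    have "(?h s + c m * indicator {p<..m} s)\<^sup>2
      = (?h s)\<^sup>2 + (c m)\<^sup>2 * indicator {p<..m} s + 2 * c m * (?h s * indicator {p<..m} s)"
      by (simp add: power2_eq_square algebra_simps split: split_indicator)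
    then show ?thesis unfolding h prod by simp
  qed
  moreover have step: "wiener_step W ?h ?Z"
    unfolding wiener_step_def using insert by (intro exI[of _ A] exI[of _ c']) auto
  ultimately have int: "(\<integral>s. (\<Sum>r\<in>insert m A. c r * indicator {0<..r} s)\<^sup>2 \<partial>lborel)
      = (\<integral>s. (?h s)\<^sup>2 \<partial>lborel) + (c m)\<^sup>2 * (m - p)"
    using p wiener_step_L2(2)[OF step] by simp
  have RF: "R \<in> borel_measurable (F p)" using assms(3) p by (intro measurable_F_mono[of R 0 p]) auto
  have "?Z \<in> borel_measurable (F p)"
    using p insert by (intro borel_measurable_sum borel_measurable_times borel_measurable_diff W_F) auto
  with RF have "(\<lambda>\<omega>. R \<omega> + ?Z \<omega>) \<in> borel_measurable (F p)" by (rule borel_measurable_add)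
  from char_add_increment[OF p(1) less_imp_le[OF p(2)] this, of "c m" v]
  have "char (distr M borel (\<lambda>\<omega>. R \<omega> + (\<Sum>r\<in>insert m A. c r * (W r \<omega> - W 0 \<omega>)))) v
    = char (distr M borel (\<lambda>\<omega>. R \<omega> + ?Z \<omega>)) v * exp (- (v\<^sup>2 * ((c m)\<^sup>2 * (m - p))) / 2)"
    unfolding Z by (simp add: add.assoc)
  also have "\<dots> = char (distr M borel R) v *
     (exp (- (v\<^sup>2 * (\<integral>s. (?h s)\<^sup>2 \<partial>lborel)) / 2) * exp (- (v\<^sup>2 * ((c m)\<^sup>2 * (m - p))) / 2))"
    using insert.IH[of c'] insert.prems by (simp add: mult.assoc)
  also have "exp (- (v\<^sup>2 * (\<integral>s. (?h s)\<^sup>2 \<partial>lborel)) / 2) * exp (- (v\<^sup>2 * ((c m)\<^sup>2 * (m - p))) / 2)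
     = exp (- (v\<^sup>2 * ((\<integral>s. (?h s)\<^sup>2 \<partial>lborel) + (c m)\<^sup>2 * (m - p))) / 2)"
    unfolding exp_add[symmetric] by (simp add: field_simps)
  finally show ?case unfolding int of_real_mult[symmetric] .
qed

text \<open>The \<open>L\<^sup>2\<close>-closure of the step pairs is a linear space by construction. So finite sums of
  increments of Ito integrals defined through unrelated approximating sequences can be treated at
  once, without any uniqueness statement for the integral.\<close>

definition wiener_pair :: "(real \<Rightarrow> real) \<Rightarrow> ('a \<Rightarrow> real) \<Rightarrow> bool" where
  "wiener_pair h Z \<longleftrightarrow> h \<in> borel_measurable borel \<and> Z \<in> borel_measurable M \<and>
     integrable lborel (\<lambda>s. (h s)\<^sup>2) \<and>
     (\<exists>H Y. (\<forall>k. wiener_step W (H k) (Y k)) \<and>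
       (\<lambda>k. \<integral>\<^sup>+s. ennreal ((H k s - h s)\<^sup>2) \<partial>lborel) \<longlonglongrightarrow> 0 \<and>
       (\<lambda>k. \<integral>\<^sup>+\<omega>. ennreal ((Y k \<omega> - Z \<omega>)\<^sup>2) \<partial>M) \<longlonglongrightarrow> 0)"

text \<open>Both sides of the identity for steps pass to the L2 limit: the variances by convergence
  of the step functions, the characteristic functions by convergence of the integrals. Carrying
  \<open>R\<close> along brings in the independence of the initial value in product form, so it need
  not be established separately for limits.\<close>

lemma wiener_pair_char:
  assumes "wiener_pair h Z" "R \<in> borel_measurable (F 0)"
  shows "char (distr M borel (\<lambda>\<omega>. R \<omega> + Z \<omega>)) v
    = char (distr M borel R) v * exp (- (v\<^sup>2 * (\<integral>s. (h s)\<^sup>2 \<partial>lborel)) / 2)"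
proof -
  obtain H Y where HY: "\<And>k. wiener_step W (H k) (Y k)"
    and H: "(\<lambda>k. \<integral>\<^sup>+s. ennreal ((H k s - h s)\<^sup>2) \<partial>lborel) \<longlonglongrightarrow> 0"
    and Y: "(\<lambda>k. \<integral>\<^sup>+\<omega>. ennreal ((Y k \<omega> - Z \<omega>)\<^sup>2) \<partial>M) \<longlonglongrightarrow> 0"
    using assms(1) unfolding wiener_pair_def by blast
  have R: "R \<in> borel_measurable M" using assms(2) measurable_F_M by blast
  have "(\<lambda>k. \<integral>s. (H k s)\<^sup>2 \<partial>lborel) \<longlonglongrightarrow> (\<integral>s. (h s)\<^sup>2 \<partial>lborel)"
    using assms(1) by (intro L2_tendsto_integral_power2 H) (auto simp: wiener_pair_def wiener_step_L2[OF HY])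
  then have "(\<lambda>k. char (distr M borel R) v * exp (- (v\<^sup>2 * (\<integral>s. (H k s)\<^sup>2 \<partial>lborel)) / 2))
      \<longlonglongrightarrow> char (distr M borel R) v * exp (- (v\<^sup>2 * (\<integral>s. (h s)\<^sup>2 \<partial>lborel)) / 2)"
    by (intro tendsto_intros) auto
  moreover have "char (distr M borel (\<lambda>\<omega>. R \<omega> + Y k \<omega>)) v
      = char (distr M borel R) v * exp (- (v\<^sup>2 * (\<integral>s. (H k s)\<^sup>2 \<partial>lborel)) / 2)" for k
    using HY[of k] char_wiener_sum[OF _ _ assms(2)] unfolding wiener_step_def by auto
  moreover have "(\<lambda>k. char (distr M borel (\<lambda>\<omega>. R \<omega> + Y k \<omega>)) v) \<longlonglongrightarrow> char (distr M borel (\<lambda>\<omega>. R \<omega> + Z \<omega>)) v"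
    using assms(1) by (intro L2_tendsto_char R Y wiener_step_measurable[OF HY]) (auto simp: wiener_pair_def)
  ultimately show ?thesis using LIMSEQ_unique by auto
qed

lemma wiener_pair_lincomb:
  assumes "wiener_pair h Z" "wiener_pair h' Z'"
  shows "wiener_pair (\<lambda>s. a * h s + b * h' s) (\<lambda>\<omega>. a * Z \<omega> + b * Z' \<omega>)"
proof -
  obtain H Y where HY: "\<And>k. wiener_step W (H k) (Y k)"
    and H: "(\<lambda>k. \<integral>\<^sup>+s. ennreal ((H k s - h s)\<^sup>2) \<partial>lborel) \<longlonglongrightarrow> 0"
    and Y: "(\<lambda>k. \<integral>\<^sup>+\<omega>. ennreal ((Y k \<omega> - Z \<omega>)\<^sup>2) \<partial>M) \<longlonglongrightarrow> 0"
    using assms(1) unfolding wiener_pair_def by blast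
  obtain H' Y' where HY': "\<And>k. wiener_step W (H' k) (Y' k)"
    and H': "(\<lambda>k. \<integral>\<^sup>+s. ennreal ((H' k s - h' s)\<^sup>2) \<partial>lborel) \<longlonglongrightarrow> 0"
    and Y': "(\<lambda>k. \<integral>\<^sup>+\<omega>. ennreal ((Y' k \<omega> - Z' \<omega>)\<^sup>2) \<partial>M) \<longlonglongrightarrow> 0"
    using assms(2) unfolding wiener_pair_def by blast
  have meas: "h \<in> borel_measurable lborel" "h' \<in> borel_measurable lborel"
    "Z \<in> borel_measurable M" "Z' \<in> borel_measurable M"
    and int: "integrable lborel (\<lambda>s. (h s)\<^sup>2)" "integrable lborel (\<lambda>s. (h' s)\<^sup>2)"
    using assms by (auto simp: wiener_pair_def)
  have "integrable lborel (\<lambda>s. a\<^sup>2 * (h s)\<^sup>2 + 2 * a * b * (h s * h' s) + b\<^sup>2 * (h' s)\<^sup>2)"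
    using int integral_Cauchy_Schwarz(1)[OF meas(1,2) int] by simp
  also have "(\<lambda>s. a\<^sup>2 * (h s)\<^sup>2 + 2 * a * b * (h s * h' s) + b\<^sup>2 * (h' s)\<^sup>2) = (\<lambda>s. (a * h s + b * h' s)\<^sup>2)"
    by (simp add: fun_eq_iff power2_eq_square algebra_simps)
  finally have int': "integrable lborel (\<lambda>s. (a * h s + b * h' s)\<^sup>2)" .
  have mH: "H k \<in> borel_measurable lborel" "H' k \<in> borel_measurable lborel" for k
    using wiener_step_L2(1)[OF HY] wiener_step_L2(1)[OF HY'] by auto
  show ?thesis unfolding wiener_pair_def
  proof (intro conjI exI allI)
    show "wiener_step W (\<lambda>s. a * H k s + b * H' k s) (\<lambda>\<omega>. a * Y k \<omega> + b * Y' k \<omega>)" for k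
      by (rule wiener_step_lincomb[OF HY HY'])
    show "(\<lambda>k. \<integral>\<^sup>+s. ennreal ((a * H k s + b * H' k s - (a * h s + b * h' s))\<^sup>2) \<partial>lborel) \<longlonglongrightarrow> 0"
      by (rule L2_tendsto_lincomb[OF mH meas(1,2) H H'])
    show "(\<lambda>k. \<integral>\<^sup>+\<omega>. ennreal ((a * Y k \<omega> + b * Y' k \<omega> - (a * Z \<omega> + b * Z' \<omega>))\<^sup>2) \<partial>M) \<longlonglongrightarrow> 0"
      by (rule L2_tendsto_lincomb[OF wiener_step_measurable[OF HY] wiener_step_measurable[OF HY'] meas(3,4) Y Y'])
  qed (use meas int' in auto)
qed

lemma wiener_step_pair: "wiener_step W h Z \<Longrightarrow> wiener_pair h Z"
  unfolding wiener_pair_def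
  by (intro conjI exI[of _ "\<lambda>_. h"] exI[of _ "\<lambda>_. Z"] allI wiener_step_L2 wiener_step_measurable) auto

lemma wiener_pair_sum:
  assumes "finite I" "\<And>i. i \<in> I \<Longrightarrow> wiener_pair (h i) (Z i)"
  shows "wiener_pair (\<lambda>s. \<Sum>i\<in>I. a i * h i s) (\<lambda>\<omega>. \<Sum>i\<in>I. a i * Z i \<omega>)"
  using assms
proof (induction I rule: finite_induct)
  case empty
  have "wiener_step W (\<lambda>s. \<Sum>i\<in>{}. a i * h i s) (\<lambda>\<omega>. \<Sum>i\<in>{}. a i * Z i \<omega>)"
    by (rule wiener_step_sum) auto
  then show ?case by (rule wiener_step_pair)
next
  case (insert i I)
  then show ?case using wiener_pair_lincomb[of "h i" "Z i" _ _ "a i" 1] by simp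
qed

end

section \<open>Ito integrals with deterministic integrands\<close>

lemma simple_process_square:
  assumes "\<And>i. i < n \<Longrightarrow> \<tau> i \<le> \<tau> (Suc i)"
  shows "(simple_process n \<tau> \<zeta> s \<omega>)\<^sup>2 = (\<Sum>i<n. (\<zeta> i \<omega>)\<^sup>2 * indicator {\<tau> i<..\<tau> (Suc i)} s)"
proof -
  have mono: "\<tau> i \<le> \<tau> j" if "i \<le> j" "j \<le> n" for i j
    using that(1,2) by (induction rule: dec_induct) (auto intro: order_trans[OF _ assms])
  have "(simple_process m \<tau> \<zeta> s \<omega>)\<^sup>2 = (\<Sum>i<m. (\<zeta> i \<omega>)\<^sup>2 * indicator {\<tau> i<..\<tau> (Suc i)} s)" if "m \<le> n" for m
    using that
  proof (induction m)
    case (Suc m)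
    \<comment> \<open>All earlier intervals end at or before \<open>\<tau> m\<close>, so the new one
      is disjoint from them and the mixed term of the square vanishes.\<close>
    have z: "simple_process m \<tau> \<zeta> s \<omega> * indicator {\<tau> m<..\<tau> (Suc m)} s = 0"
    proof (cases "s \<in> {\<tau> m<..\<tau> (Suc m)}")
      case True
      have "simple_process m \<tau> \<zeta> s \<omega> = 0"
        unfolding simple_process_def
      proof (rule sum.neutral, intro ballI)
        fix i assume i: "i \<in> {..<m}"
        with mono[of "Suc i" m] Suc.prems True have "s \<notin> {\<tau> i<..\<tau> (Suc i)}" by auto
        then show "\<zeta> i \<omega> * indicator {\<tau> i<..\<tau> (Suc i)} s = 0" by simp
      qed
      then show ?thesis by simp
    qed simp
    have "simple_process (Suc m) \<tau> \<zeta> s \<omega> = simple_process m \<tau> \<zeta> s \<omega> + \<zeta> m \<omega> * indicator {\<tau> m<..\<tau> (Suc m)} s"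
      by (simp add: simple_process_def)
    then have "(simple_process (Suc m) \<tau> \<zeta> s \<omega>)\<^sup>2 = (simple_process m \<tau> \<zeta> s \<omega>)\<^sup>2
       + (\<zeta> m \<omega>)\<^sup>2 * indicator {\<tau> m<..\<tau> (Suc m)} s
       + 2 * \<zeta> m \<omega> * (simple_process m \<tau> \<zeta> s \<omega> * indicator {\<tau> m<..\<tau> (Suc m)} s)"
      by (simp add: power2_eq_square algebra_simps split: split_indicator)
    with Suc z show ?case by simp
  qed (simp add: simple_process_def)
  then show ?thesis by simp
qed

context brownian_filtration
begin

text \<open>Induction over the intervals. The partial sum and the new weight are known at
  \<open>\<tau> m\<close>, so their product is independent of the centred increment and the mixed
  term has mean zero. The square of the weight is likewise independent of the squared
  increment.\<close>

lemma simple_integral_isometry: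
  assumes data: "simple_data M F n \<tau> \<zeta>" and t: "0 \<le> t"
  shows "integrable M (\<lambda>\<omega>. (simple_integral_W W n \<tau> \<zeta> t \<omega>)\<^sup>2)"
    and "(\<integral>\<omega>. (simple_integral_W W n \<tau> \<zeta> t \<omega>)\<^sup>2 \<partial>M)
      = (\<Sum>i<n. (\<integral>\<omega>. (\<zeta> i \<omega>)\<^sup>2 \<partial>M) * (min t (\<tau> (Suc i)) - min t (\<tau> i)))"
proof -
  define S where "S m \<omega> = simple_integral_W W m \<tau> \<zeta> t \<omega>" for m \<omega>
  have tau0: "0 \<le> \<tau> i" if "i \<le> n" for i
    using that
  proof (induction i)
    case 0 then show ?case using data by (simp add: simple_data_def)
  next
    case (Suc i)
    then show ?case using data unfolding simple_data_def by (meson Suc_le_lessD less_imp_le_nat order_trans)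
  qed
  obtain C where C: "\<And>i \<omega>. i < n \<Longrightarrow> \<omega> \<in> space M \<Longrightarrow> \<bar>\<zeta> i \<omega>\<bar> \<le> C"
    using data unfolding simple_data_def by blast
  have "S m \<in> borel_measurable (F (\<tau> m)) \<and> integrable M (\<lambda>\<omega>. (S m \<omega>)\<^sup>2) \<and>
     (\<integral>\<omega>. (S m \<omega>)\<^sup>2 \<partial>M) = (\<Sum>i<m. (\<integral>\<omega>. (\<zeta> i \<omega>)\<^sup>2 \<partial>M) * (min t (\<tau> (Suc i)) - min t (\<tau> i)))"
    if "m \<le> n" for m
    using that
  proof (induction m)
    case 0
    then show ?case by (simp add: S_def[abs_def] simple_integral_W_def)
  next
    case (Suc m)
    then have m: "m < n" by simp
    define D where "D \<omega> = W (min t (\<tau> (Suc m))) \<omega> - W (min t (\<tau> m)) \<omega>" for \<omega>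
    have SF: "S m \<in> borel_measurable (F (\<tau> m))" and S2: "integrable M (\<lambda>\<omega>. (S m \<omega>)\<^sup>2)"
      and SE: "(\<integral>\<omega>. (S m \<omega>)\<^sup>2 \<partial>M) = (\<Sum>i<m. (\<integral>\<omega>. (\<zeta> i \<omega>)\<^sup>2 \<partial>M) * (min t (\<tau> (Suc i)) - min t (\<tau> i)))"
      using Suc by auto
    have le: "0 \<le> \<tau> m" "0 \<le> \<tau> (Suc m)" "\<tau> m \<le> \<tau> (Suc m)"
      using tau0 m data by (auto simp: simple_data_def)
    have zF: "\<zeta> m \<in> borel_measurable (F (\<tau> m))" using data m by (simp add: simple_data_def)
    have Seq: "S (Suc m) = (\<lambda>\<omega>. S m \<omega> + \<zeta> m \<omega> * D \<omega>)"
      by (simp add: fun_eq_iff S_def simple_integral_W_def D_def)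
    have DF: "D \<in> borel_measurable (F (\<tau> (Suc m)))"
      unfolding D_def[abs_def] using le t by (intro borel_measurable_diff W_F) auto
    have meas: "S (Suc m) \<in> borel_measurable (F (\<tau> (Suc m)))"
      unfolding Seq using le DF measurable_F_mono[OF SF] measurable_F_mono[OF zF] by auto
    have SM: "S m \<in> borel_measurable M" and zM: "\<zeta> m \<in> borel_measurable M"
      using SF zF le measurable_F_M by blast+
    have z2: "integrable M (\<lambda>\<omega>. (\<zeta> m \<omega>)\<^sup>2)"
      using C[OF m] by (intro integrable_const_bound[of _ "C\<^sup>2"] borel_measurable_power zM AE_I2)
        (auto simp: abs_le_square_iff[symmetric] intro: order_trans[OF _ abs_ge_self])
    show ?case
    \<comment> \<open>If \<open>t \<le> \<tau> m\<close> or the interval is empty, the increment is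
      zero; in the former case the weight need not be known at time \<open>t\<close>. Otherwise the
      increment starts exactly at \<open>\<tau> m\<close>, where the weight is known.\<close>
    proof (cases "min t (\<tau> m) = min t (\<tau> (Suc m))")
      case True
      then have "D = (\<lambda>_. 0)" by (simp add: D_def fun_eq_iff)
      then have "S (Suc m) = S m" using Seq by simp
      then show ?thesis using meas S2 SE True by simp
    next
      case False
      with le have lt: "\<tau> m < t" "\<tau> m < min t (\<tau> (Suc m))" by auto
      then have min: "min t (\<tau> m) = \<tau> m" by simp
      have Sz: "integrable M (\<lambda>\<omega>. S m \<omega> * \<zeta> m \<omega>)"
        by (rule integral_Cauchy_Schwarz(1)[OF SM zM S2 z2])
      note D = increment_moments[OF le(1) lt(2)]
      have D': "D = (\<lambda>\<omega>. W (min t (\<tau> (Suc m))) \<omega> - W (\<tau> m) \<omega>)" by (simp add: D_def[abs_def] min)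
      have "indep_var borel (\<lambda>\<omega>. S m \<omega> * \<zeta> m \<omega>) borel D"
        unfolding D' using SF zF by (intro indep_increment le lt) auto
      note cross = indep_var_lebesgue_integral[OF this Sz] indep_var_integrable[OF this Sz]
      have "indep_var borel ((\<lambda>x. x\<^sup>2) \<circ> \<zeta> m) borel ((\<lambda>x. x\<^sup>2) \<circ> D)"
        unfolding D' by (rule indep_var_compose[OF indep_increment[OF le(1) lt(2) zF]]) auto
      then have "indep_var borel (\<lambda>\<omega>. (\<zeta> m \<omega>)\<^sup>2) borel (\<lambda>\<omega>. (D \<omega>)\<^sup>2)" by (simp add: comp_def)
      note diag = indep_var_lebesgue_integral[OF this z2] indep_var_integrable[OF this z2]
      have sq: "(S (Suc m) \<omega>)\<^sup>2 = (S m \<omega>)\<^sup>2 + 2 * (S m \<omega> * \<zeta> m \<omega> * D \<omega>) + (\<zeta> m \<omega>)\<^sup>2 * (D \<omega>)\<^sup>2" for \<omega>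
        by (simp add: Seq power2_eq_square algebra_simps)
      have "(\<integral>\<omega>. S m \<omega> * \<zeta> m \<omega> * D \<omega> \<partial>M) = 0" "integrable M (\<lambda>\<omega>. S m \<omega> * \<zeta> m \<omega> * D \<omega>)"
        "(\<integral>\<omega>. (\<zeta> m \<omega>)\<^sup>2 * (D \<omega>)\<^sup>2 \<partial>M) = (\<integral>\<omega>. (\<zeta> m \<omega>)\<^sup>2 \<partial>M) * (min t (\<tau> (Suc m)) - \<tau> m)"
        "integrable M (\<lambda>\<omega>. (\<zeta> m \<omega>)\<^sup>2 * (D \<omega>)\<^sup>2)"
        using cross diag D by (simp_all add: D')
      then show ?thesis using meas S2 SE unfolding sq by (simp add: min)
    qed
  qed
  from this[of n] show "integrable M (\<lambda>\<omega>. (simple_integral_W W n \<tau> \<zeta> t \<omega>)\<^sup>2)"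
    and "(\<integral>\<omega>. (simple_integral_W W n \<tau> \<zeta> t \<omega>)\<^sup>2 \<partial>M)
      = (\<Sum>i<n. (\<integral>\<omega>. (\<zeta> i \<omega>)\<^sup>2 \<partial>M) * (min t (\<tau> (Suc i)) - min t (\<tau> i)))"
    by (simp_all add: S_def)
qed

text \<open>The random weights \<open>\<xi>\<close> are split into their means \<open>a\<close> and
  centred parts \<open>\<zeta>\<close>. The error \<open>e\<close> is then the squared norm of the
  centred process plus the squared error of the deterministic step \<open>H'\<close>. By the
  isometry the first summand also equals the squared distance between the simple integral and
  \<open>Y'\<close>, so the deterministic steps and their integrals converge together.\<close>

lemma ito_integral_wiener_pair:
  assumes ito: "ito_integral M F W (\<lambda>s \<omega>. S s) t I" and t: "0 \<le> t"
    and S: "(\<lambda>s. indicator {0<..t} s * S s) \<in> borel_measurable borel"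
      "integrable lborel (\<lambda>s. (indicator {0<..t} s * S s)\<^sup>2)"
  shows "wiener_pair (\<lambda>s. indicator {0<..t} s * S s) I"
proof -
  let ?h = "\<lambda>s. indicator {0<..t} s * S s"
  obtain n \<tau> \<xi> where data: "\<And>k. simple_data M F (n k) (\<tau> k) (\<xi> k)"
    and H: "(\<lambda>k. \<integral>\<^sup>+\<omega>. (\<integral>\<^sup>+s\<in>{0..t}. ennreal ((simple_process (n k) (\<tau> k) (\<xi> k) s \<omega> - S s)\<^sup>2) \<partial>lborel) \<partial>M) \<longlonglongrightarrow> 0"
    and Y: "(\<lambda>k. \<integral>\<^sup>+\<omega>. ennreal ((simple_integral_W W (n k) (\<tau> k) (\<xi> k) t \<omega> - I \<omega>)\<^sup>2) \<partial>M) \<longlonglongrightarrow> 0"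
    using ito unfolding ito_integral_def by blast
  have I: "I \<in> borel_measurable M" using ito by (simp add: ito_integral_def)
  define e where "e k = (\<integral>\<^sup>+\<omega>. (\<integral>\<^sup>+s\<in>{0..t}. ennreal ((simple_process (n k) (\<tau> k) (\<xi> k) s \<omega> - S s)\<^sup>2) \<partial>lborel) \<partial>M)" for k
  define a where "a k i = expectation (\<xi> k i)" for k i
  define \<zeta> where "\<zeta> k i \<omega> = \<xi> k i \<omega> - a k i" for k i \<omega>
  define H' where "H' k s = (\<Sum>i<n k. a k i * (indicator {0<..min t (\<tau> k (Suc i))} s - indicator {0<..min t (\<tau> k i)} s))" for k s
  define Y' where "Y' k \<omega> = (\<Sum>i<n k. a k i * (W (min t (\<tau> k (Suc i))) \<omega> - W (min t (\<tau> k i)) \<omega>))" for k \<omega>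
  have tau0: "0 \<le> \<tau> k i" if "i \<le> n k" for k i
    using that
  proof (induction i)
    case 0 then show ?case using data[of k] by (simp add: simple_data_def)
  next
    case (Suc i)
    then show ?case using data[of k] unfolding simple_data_def by (meson Suc_le_lessD less_imp_le_nat order_trans)
  qed
  have tau_le: "\<tau> k i \<le> \<tau> k (Suc i)" if "i < n k" for k i using data[of k] that by (simp add: simple_data_def)
  have xi_F: "\<xi> k i \<in> borel_measurable (F (\<tau> k i))" if "i < n k" for k i
    using data[of k] that by (simp add: simple_data_def)
  have xi_M: "\<xi> k i \<in> borel_measurable M" if "i < n k" for k i
    using measurable_F_M[OF xi_F[OF that] tau0] that by simp
  have xi_bound: "\<exists>C. \<forall>i<n k. \<forall>\<omega>\<in>space M. \<bar>\<xi> k i \<omega>\<bar> \<le> C" for k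
    using data[of k] by (simp add: simple_data_def)
  have xi_int: "integrable M (\<xi> k i)" if i: "i < n k" for k i
  proof -
    obtain C where "\<forall>i<n k. \<forall>\<omega>\<in>space M. \<bar>\<xi> k i \<omega>\<bar> \<le> C" using xi_bound by blast
    with i show ?thesis by (intro integrable_const_bound[of _ C] xi_M AE_I2) auto
  qed
  have zdata: "simple_data M F (n k) (\<tau> k) (\<zeta> k)" for k
  proof -
    obtain C where C: "\<forall>i<n k. \<forall>\<omega>\<in>space M. \<bar>\<xi> k i \<omega>\<bar> \<le> C" using xi_bound by blast
    have "\<bar>\<zeta> k i \<omega>\<bar> \<le> C + (\<Sum>i<n k. \<bar>a k i\<bar>)" if "i < n k" "\<omega> \<in> space M" for i \<omega>
    proof -
      have "\<bar>a k i\<bar> \<le> (\<Sum>i<n k. \<bar>a k i\<bar>)" using that by (intro member_le_sum) auto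
      moreover have "\<bar>\<xi> k i \<omega>\<bar> \<le> C" using C that by auto
      ultimately show ?thesis unfolding \<zeta>_def by linarith
    qed
    then show ?thesis using data[of k] xi_F[of _ k] unfolding simple_data_def \<zeta>_def by auto
  qed
  have z_M: "\<zeta> k i \<in> borel_measurable M" if "i < n k" for k i
    using xi_M[OF that] unfolding \<zeta>_def by measurable
  have z2: "integrable M (\<lambda>\<omega>. (\<zeta> k i \<omega>)\<^sup>2)" if i: "i < n k" for k i
  proof -
    obtain C where C: "\<forall>i<n k. \<forall>\<omega>\<in>space M. \<bar>\<zeta> k i \<omega>\<bar> \<le> C" using zdata[of k] by (auto simp: simple_data_def)
    with i show ?thesis
      by (intro integrable_const_bound[of _ "C\<^sup>2"] borel_measurable_power z_M AE_I2)
        (auto simp: abs_le_square_iff[symmetric] intro: order_trans[OF _ abs_ge_self])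
  qed
  have sq: "(simple_process (n k) (\<tau> k) (\<zeta> k) s \<omega>)\<^sup>2
      = (\<Sum>i<n k. (\<zeta> k i \<omega>)\<^sup>2 * indicator {\<tau> k i<..\<tau> k (Suc i)} s)" for k s \<omega>
    by (rule simple_process_square) (rule tau_le)
  \<comment> \<open>The cut-off at \<open>t\<close> is moved into the end points, because step
    functions are spanned by indicators of \<open>(0, r]\<close>. At \<open>s = 0\<close> both sides
    vanish.\<close>
  have ind_eq: "indicator {0<..min t (\<tau> k (Suc i))} s - indicator {0<..min t (\<tau> k i)} s
      = (indicator {\<tau> k i<..\<tau> k (Suc i)} s * indicator {0..t} s :: real)" if "i < n k" for k i s
    using tau_le[OF that] tau0[of i k] that t by (auto split: split_indicator)
  have H'_eq: "H' k s = (\<Sum>i<n k. a k i * indicator {\<tau> k i<..\<tau> k (Suc i)} s) * indicator {0..t} s" for k s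
    unfolding H'_def sum_distrib_right using ind_eq by (intro sum.cong) (auto simp: mult.assoc)
  text \<open>Bias-variance decomposition, since \<open>S\<close> is deterministic: replacing the random weights by their
    means does not increase the error.\<close>
  have decomp: "e k = (\<integral>\<^sup>+s\<in>{0..t}. ennreal (\<integral>\<omega>. (simple_process (n k) (\<tau> k) (\<zeta> k) s \<omega>)\<^sup>2 \<partial>M) \<partial>lborel)
      + (\<integral>\<^sup>+s. ennreal ((H' k s - ?h s)\<^sup>2) \<partial>lborel)" for k
  proof -
    interpret pair_sigma_finite M lborel ..
    let ?P = "\<lambda>s \<omega>. simple_process (n k) (\<tau> k) (\<xi> k) s \<omega>"
    let ?Q = "\<lambda>s \<omega>. simple_process (n k) (\<tau> k) (\<zeta> k) s \<omega>"
    let ?m = "\<lambda>s. \<Sum>i<n k. a k i * indicator {\<tau> k i<..\<tau> k (Suc i)} s :: real"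
    have PQ: "?P s \<omega> = ?Q s \<omega> + ?m s" for s \<omega>
      by (simp only: simple_process_def \<zeta>_def left_diff_distrib sum_subtractf diff_add_cancel)
    have Qint: "integrable M (?Q s)" "expectation (?Q s) = 0" for s
    proof -
      have zi: "integrable M (\<zeta> k i)" "expectation (\<zeta> k i) = 0" if "i < n k" for i
        using xi_int[OF that] by (auto simp: \<zeta>_def[abs_def] a_def prob_space)
      show "integrable M (?Q s)" "expectation (?Q s) = 0"
        unfolding simple_process_def using zi by (subst Bochner_Integration.integral_sum | auto)+
    qed
    have Q2: "integrable M (\<lambda>\<omega>. (?Q s \<omega>)\<^sup>2)" for s
      using z2 by (subst sq) auto
    have inner: "(\<integral>\<^sup>+\<omega>. ennreal ((?P s \<omega> - S s)\<^sup>2) \<partial>M)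
        = ennreal (\<integral>\<omega>. (?Q s \<omega>)\<^sup>2 \<partial>M) + ennreal ((?m s - S s)\<^sup>2)" for s
    proof -
      have eq: "(?P s \<omega> - S s)\<^sup>2 = (?Q s \<omega>)\<^sup>2 + 2 * (?m s - S s) * ?Q s \<omega> + (?m s - S s)\<^sup>2" for \<omega>
        unfolding PQ by (simp add: power2_eq_square algebra_simps)
      have int: "integrable M (\<lambda>\<omega>. (?P s \<omega> - S s)\<^sup>2)" unfolding eq using Qint Q2 by auto
      have "(\<integral>\<^sup>+\<omega>. ennreal ((?P s \<omega> - S s)\<^sup>2) \<partial>M) = ennreal (\<integral>\<omega>. (?P s \<omega> - S s)\<^sup>2 \<partial>M)"
        by (rule nn_integral_eq_integral[OF int]) auto
      also have "(\<integral>\<omega>. (?P s \<omega> - S s)\<^sup>2 \<partial>M) = (\<integral>\<omega>. (?Q s \<omega>)\<^sup>2 \<partial>M) + (?m s - S s)\<^sup>2"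
        unfolding eq using Qint Q2 by (simp add: prob_space)
      finally show ?thesis by simp
    qed
    \<comment> \<open>\<open>S\<close> is assumed Borel only after truncation to
      \<open>(0, t]\<close>, whereas the error is integrated over \<open>[0, t]\<close>. The two
      integrands can differ only at the null point \<open>s = 0\<close>.\<close>
    let ?G = "\<lambda>\<omega> s. ennreal ((?P s \<omega> * indicator {0<..t} s - ?h s)\<^sup>2)"
    have Gmeas: "(\<lambda>(\<omega>, s). ?G \<omega> s) \<in> borel_measurable (M \<Otimes>\<^sub>M lborel)"
      unfolding simple_process_def using xi_M S(1) by measurable
    have AE0: "AE s in lborel. s \<noteq> (0::real)" by (rule AE_lborel_singleton)
    have inside: "s \<in> {0<..t} \<and> s \<in> {0..t} \<or> s \<notin> {0<..t} \<and> s \<notin> {0..t}" if "s \<noteq> 0" for s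
      using that t by auto
    have "ennreal ((?P s \<omega> - S s)\<^sup>2) * indicator {0..t} s = ?G \<omega> s" if "s \<noteq> 0" for s \<omega>
      using inside[OF that] by (elim disjE conjE) simp_all
    then have "e k = (\<integral>\<^sup>+\<omega>. (\<integral>\<^sup>+s. ?G \<omega> s \<partial>lborel) \<partial>M)"
      unfolding e_def using AE0 by (intro nn_integral_cong nn_integral_cong_AE) (rule eventually_mono)
    also have "\<dots> = (\<integral>\<^sup>+s. (\<integral>\<^sup>+\<omega>. ?G \<omega> s \<partial>M) \<partial>lborel)"
      using Fubini'[OF Gmeas] by simp
    also have "\<dots> = (\<integral>\<^sup>+s. ennreal (\<integral>\<omega>. (?Q s \<omega>)\<^sup>2 \<partial>M) * indicator {0..t} s
        + ennreal ((H' k s - ?h s)\<^sup>2) \<partial>lborel)"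
    proof (rule nn_integral_cong_AE, rule eventually_mono[OF AE0])
      fix s :: real assume s0: "s \<noteq> 0"
      show "(\<integral>\<^sup>+\<omega>. ?G \<omega> s \<partial>M) = ennreal (\<integral>\<omega>. (?Q s \<omega>)\<^sup>2 \<partial>M) * indicator {0..t} s
          + ennreal ((H' k s - ?h s)\<^sup>2)"
        using inside[OF s0] by (elim disjE conjE) (simp_all add: H'_eq inner)
    qed
    also have "\<dots> = (\<integral>\<^sup>+s\<in>{0..t}. ennreal (\<integral>\<omega>. (?Q s \<omega>)\<^sup>2 \<partial>M) \<partial>lborel)
        + (\<integral>\<^sup>+s. ennreal ((H' k s - ?h s)\<^sup>2) \<partial>lborel)"
    proof (rule nn_integral_add)
      have "(\<integral>\<omega>. (?Q s \<omega>)\<^sup>2 \<partial>M) = (\<Sum>i<n k. (\<integral>\<omega>. (\<zeta> k i \<omega>)\<^sup>2 \<partial>M) * indicator {\<tau> k i<..\<tau> k (Suc i)} s)" for s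
        using z2 by (subst sq) auto
      note eq = this
      show "(\<lambda>s. ennreal (\<integral>\<omega>. (?Q s \<omega>)\<^sup>2 \<partial>M) * indicator {0..t} s) \<in> borel_measurable lborel"
        unfolding eq by measurable
      show "(\<lambda>s. ennreal ((H' k s - ?h s)\<^sup>2)) \<in> borel_measurable lborel"
        unfolding H'_def using S(1) by measurable
    qed
    finally show ?thesis .
  qed
  have var: "(\<integral>\<^sup>+s\<in>{0..t}. ennreal (\<integral>\<omega>. (simple_process (n k) (\<tau> k) (\<zeta> k) s \<omega>)\<^sup>2 \<partial>M) \<partial>lborel)
     = (\<integral>\<^sup>+\<omega>. ennreal ((simple_integral_W W (n k) (\<tau> k) (\<zeta> k) t \<omega>)\<^sup>2) \<partial>M)" for k
  proof -
    let ?v = "\<lambda>i. \<integral>\<omega>. (\<zeta> k i \<omega>)\<^sup>2 \<partial>M"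
    let ?J = "\<lambda>i. {min t (\<tau> k i)<..min t (\<tau> k (Suc i))}"
    have "ennreal (\<integral>\<omega>. (simple_process (n k) (\<tau> k) (\<zeta> k) s \<omega>)\<^sup>2 \<partial>M) * indicator {0..t} s
        = ennreal (\<Sum>i<n k. ?v i * indicator (?J i) s)" for s
    proof -
      have "(\<integral>\<omega>. (simple_process (n k) (\<tau> k) (\<zeta> k) s \<omega>)\<^sup>2 \<partial>M) * indicator {0..t} s
        = (\<Sum>i<n k. ?v i * indicator {\<tau> k i<..\<tau> k (Suc i)} s) * indicator {0..t} s"
        using z2 by (subst sq) auto
      also have "\<dots> = (\<Sum>i<n k. ?v i * indicator (?J i) s)"
        unfolding sum_distrib_right
      proof (rule sum.cong[OF refl])
        fix i assume "i \<in> {..<n k}"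
        then show "?v i * indicator {\<tau> k i<..\<tau> k (Suc i)} s * indicator {0..t} s = ?v i * indicator (?J i) s"
          using tau0[of i k] t by (auto split: split_indicator)
      qed
      finally show ?thesis by (auto split: split_indicator)
    qed
    note eq = this
    have J: "integrable lborel (\<lambda>s. ?v i * indicator (?J i) s)"
      "(\<integral>s. ?v i * indicator (?J i) s \<partial>lborel) = ?v i * (min t (\<tau> k (Suc i)) - min t (\<tau> k i))" if "i < n k" for i
    proof -
      have "min t (\<tau> k i) \<le> min t (\<tau> k (Suc i))" using tau_le[OF that] by auto
      then show "integrable lborel (\<lambda>s. ?v i * indicator (?J i) s)"
        "(\<integral>s. ?v i * indicator (?J i) s \<partial>lborel) = ?v i * (min t (\<tau> k (Suc i)) - min t (\<tau> k i))"
        by (simp_all del: min_less_iff_conj)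
    qed
    from eq have "(\<integral>\<^sup>+s\<in>{0..t}. ennreal (\<integral>\<omega>. (simple_process (n k) (\<tau> k) (\<zeta> k) s \<omega>)\<^sup>2 \<partial>M) \<partial>lborel)
        = (\<integral>\<^sup>+s. ennreal (\<Sum>i<n k. ?v i * indicator (?J i) s) \<partial>lborel)" by simp
    also have "\<dots> = ennreal (\<integral>s. (\<Sum>i<n k. ?v i * indicator (?J i) s) \<partial>lborel)"
    proof (rule nn_integral_eq_integral)
      show "integrable lborel (\<lambda>s. \<Sum>i<n k. ?v i * indicator (?J i) s)"
        by (rule Bochner_Integration.integrable_sum) (use J in auto)
    qed (auto intro!: sum_nonneg mult_nonneg_nonneg)
    also have "(\<integral>s. (\<Sum>i<n k. ?v i * indicator (?J i) s) \<partial>lborel) = (\<Sum>i<n k. \<integral>s. ?v i * indicator (?J i) s \<partial>lborel)"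
      by (rule Bochner_Integration.integral_sum) (use J in auto)
    also have "\<dots> = (\<Sum>i<n k. ?v i * (min t (\<tau> k (Suc i)) - min t (\<tau> k i)))"
      by (intro sum.cong refl J(2)) auto
    also have "\<dots> = (\<integral>\<omega>. (simple_integral_W W (n k) (\<tau> k) (\<zeta> k) t \<omega>)\<^sup>2 \<partial>M)"
      by (rule simple_integral_isometry(2)[OF zdata t, symmetric])
    also have "ennreal \<dots> = (\<integral>\<^sup>+\<omega>. ennreal ((simple_integral_W W (n k) (\<tau> k) (\<zeta> k) t \<omega>)\<^sup>2) \<partial>M)"
      by (rule nn_integral_eq_integral[symmetric, OF simple_integral_isometry(1)[OF zdata t]]) auto
    finally show ?thesis .
  qed
  have diff: "simple_integral_W W (n k) (\<tau> k) (\<zeta> k) t \<omega> = simple_integral_W W (n k) (\<tau> k) (\<xi> k) t \<omega> - Y' k \<omega>" for k \<omega>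
    unfolding simple_integral_W_def Y'_def \<zeta>_def by (simp add: sum_subtractf[symmetric] algebra_simps)
  have step: "wiener_step W (H' k) (Y' k)" for k
  proof -
    let ?u = "\<lambda>i s. indicator {0<..min t (\<tau> k (Suc i))} s - indicator {0<..min t (\<tau> k i)} s :: real"
    let ?v = "\<lambda>i \<omega>. W (min t (\<tau> k (Suc i))) \<omega> - W (min t (\<tau> k i)) \<omega>"
    have "wiener_step W (?u i) (?v i)" if "i \<in> {..<n k}" for i
      using wiener_step_lincomb[OF wiener_step_basic[of "min t (\<tau> k (Suc i))" W] wiener_step_basic[of "min t (\<tau> k i)" W], of 1 "-1"]
        tau0[of i k] tau0[of "Suc i" k] that t by simp
    from wiener_step_sum[where I="{..<n k}" and a="a k", OF _ this] show ?thesis unfolding H'_def Y'_def by simp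
  qed
  have SI_M: "simple_integral_W W (n k) (\<tau> k) (\<xi> k) t \<in> borel_measurable M" for k
    unfolding simple_integral_W_def[abs_def] using xi_M tau0[of _ k] t
    by (intro borel_measurable_sum borel_measurable_times borel_measurable_diff W_M) auto
  have Y'_M: "Y' k \<in> borel_measurable M" for k by (rule wiener_step_measurable[OF step])
  have e0: "e \<longlonglongrightarrow> 0" using H unfolding e_def .
  have H'0: "(\<lambda>k. \<integral>\<^sup>+s. ennreal ((H' k s - ?h s)\<^sup>2) \<partial>lborel) \<longlonglongrightarrow> 0"
    by (rule tendsto_sandwich[OF _ _ tendsto_const e0]) (auto simp: decomp)
  \<comment> \<open>By \<open>diff\<close> and \<open>var\<close> this second moment is the first
    summand of \<open>decomp\<close>, so \<open>e\<close> dominates it as well.\<close>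
  have YY: "(\<lambda>k. \<integral>\<^sup>+\<omega>. ennreal ((Y' k \<omega> - simple_integral_W W (n k) (\<tau> k) (\<xi> k) t \<omega>)\<^sup>2) \<partial>M) \<longlonglongrightarrow> 0"
  proof (rule tendsto_sandwich[OF _ _ tendsto_const e0])
    show "\<forall>\<^sub>F k in sequentially. (\<integral>\<^sup>+\<omega>. ennreal ((Y' k \<omega> - simple_integral_W W (n k) (\<tau> k) (\<xi> k) t \<omega>)\<^sup>2) \<partial>M) \<le> e k"
      unfolding decomp var diff by (simp add: power2_commute)
  qed auto
  \<comment> \<open>The triangle inequality in L2, obtained as a linear combination of two sequences
    that both tend to 0.\<close>
  have "(\<lambda>k. \<integral>\<^sup>+\<omega>. ennreal ((1 * (Y' k \<omega> - simple_integral_W W (n k) (\<tau> k) (\<xi> k) t \<omega>)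
       + 1 * (simple_integral_W W (n k) (\<tau> k) (\<xi> k) t \<omega> - I \<omega>) - (1 * 0 + 1 * 0))\<^sup>2) \<partial>M) \<longlonglongrightarrow> 0"
    by (rule L2_tendsto_lincomb) (use YY Y Y'_M SI_M I in auto)
  then have Y'0: "(\<lambda>k. \<integral>\<^sup>+\<omega>. ennreal ((Y' k \<omega> - I \<omega>)\<^sup>2) \<partial>M) \<longlonglongrightarrow> 0" by simp
  show ?thesis unfolding wiener_pair_def using S I step H'0 Y'0 by blast
qed

end

section \<open>The law of the solution\<close>

lemma absolutely_integrable_on_lborel:
  fixes f :: "real \<Rightarrow> real"
  assumes "set_integrable lborel A f"
  shows "f absolutely_integrable_on A"
  using assms unfolding set_integrable_def
  by (subst integrable_completion) (auto dest: borel_measurable_integrable)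

lemma integral_indicator_Ioc:
  fixes f :: "real \<Rightarrow> real"
  assumes "set_integrable lborel {a..b} f"
  shows "integrable lborel (\<lambda>s. indicator {a<..b} s * f s)"
    and "(\<integral>s. indicator {a<..b} s * f s \<partial>lborel) = integral {a..b} f"
proof -
  have "set_integrable lborel {a<..b} f"
    by (rule set_integrable_subset[OF assms]) auto
  then show "integrable lborel (\<lambda>s. indicator {a<..b} s * f s)" by (simp add: set_integrable_def)
  have "(\<integral>s. indicator {a<..b} s * f s \<partial>lborel) = (LINT s:{a..b}|lborel. f s)"
    unfolding set_lebesgue_integral_def
  proof (rule integral_cong_AE)
    show "(\<lambda>s. indicator {a<..b} s * f s) \<in> borel_measurable lborel"
      using \<open>integrable lborel (\<lambda>s. indicator {a<..b} s * f s)\<close> by blast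
    show "(\<lambda>s. indicator {a..b} s *\<^sub>R f s) \<in> borel_measurable lborel"
      using assms unfolding set_integrable_def by blast
    show "AE s in lborel. indicator {a<..b} s * f s = indicator {a..b} s *\<^sub>R f s"
      using AE_lborel_singleton[of a] by eventually_elim (auto split: split_indicator)
  qed
  then show "(\<integral>s. indicator {a<..b} s * f s \<partial>lborel) = integral {a..b} f"
    using set_borel_integral_eq_integral(2)[OF assms] by simp
qed

lemma sum_by_parts:
  fixes e x :: "nat \<Rightarrow> real"
  shows "(\<Sum>i<n. e i * (x (Suc i) - x i)) = e n * x n - e 0 * x 0 - (\<Sum>i<n. x (Suc i) * (e (Suc i) - e i))"
  by (induction n) (auto simp: algebra_simps)

lemma char_pair_std_normal:
  assumes "prob_space \<mu>" "sets \<mu> = sets borel"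
  shows "char (distr (\<mu> \<Otimes>\<^sub>M std_normal_distribution) borel (\<lambda>(x, g). x + c * g)) v
    = char \<mu> v * exp (- (v\<^sup>2 * c\<^sup>2) / 2)"
proof -
  interpret \<mu>: prob_space \<mu> by fact
  interpret N: real_distribution std_normal_distribution by (rule real_dist_normal_dist)
  interpret P: pair_prob_space \<mu> std_normal_distribution ..
  note [measurable_cong] = assms(2)
  have "char (distr (\<mu> \<Otimes>\<^sub>M std_normal_distribution) borel (\<lambda>(x, g). x + c * g)) v
     = (\<integral>p. iexp (v * (fst p + c * snd p)) \<partial>(\<mu> \<Otimes>\<^sub>M std_normal_distribution))"
    unfolding char_def by (subst integral_distr) (auto simp: split_beta')
  also have "\<dots> = (\<integral>x. (\<integral>g. iexp (v * (x + c * g)) \<partial>std_normal_distribution) \<partial>\<mu>)"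
    by (subst P.integral_fst'[symmetric]) (auto intro!: P.integrable_iexp)
  also have "\<dots> = (\<integral>x. iexp (v * x) * char std_normal_distribution (v * c) \<partial>\<mu>)"
  proof (rule Bochner_Integration.integral_cong)
    fix x
    have "iexp (v * (x + c * g)) = iexp (v * x) * iexp (v * c * g)" for g
      by (simp add: exp_add[symmetric] algebra_simps)
    then show "(\<integral>g. iexp (v * (x + c * g)) \<partial>std_normal_distribution) = iexp (v * x) * char std_normal_distribution (v * c)"
      by (simp add: char_def)
  qed simp
  also have "\<dots> = char \<mu> v * char std_normal_distribution (v * c)" by (simp add: char_def)
  finally show ?thesis by (simp add: char_std_normal_distribution power_mult_distrib)
qed

text \<open>Variation of constants is done pathwise: summation by parts turns the sums
  \<open>\<Sum>\<^sub>i exp (\<beta> p\<^sub>i) (I\<^bsub>p\<^sub>i\<^sub>+\<^sub>1\<^esub> - I\<^bsub>p\<^sub>i\<^esub>)\<close> into Riemann sums of the continuous path \<open>X\<close>, so no Ito formula is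
  needed, and the law of these sums is known from their characteristic functions.\<close>

lemma sde_law:
  fixes X :: "real \<Rightarrow> 'a \<Rightarrow> real"
  assumes sol: "solves_sde \<gamma> \<beta> b \<sigma> \<mu>\<^sub>0 M F W X"
    and bound: "\<And>\<mu>. \<mu> \<in> \<P>\<^sub>2 \<Longrightarrow> (\<sigma> \<mu>)\<^sup>2 \<le> K" and t: "0 \<le> t"
  defines "B \<equiv> \<lambda>s. b (law M (X s))" and "S \<equiv> \<lambda>s. \<sigma> (law M (X s))"
  shows "B absolutely_integrable_on {0..t}"
    and "(\<lambda>s. indicator {0..t} s * S s) \<in> borel_measurable borel"
    and "law M (X t) = distr (\<mu>\<^sub>0 \<Otimes>\<^sub>M std_normal_distribution) borel
      (\<lambda>(x, g). exp (- \<beta> * t) * (x + integral {0..t} (\<lambda>s. exp (\<beta> * s) * (\<gamma> + B s))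
         + sqrt (integral {0..t} (\<lambda>s. (exp (\<beta> * s) * S s)\<^sup>2)) * g))"
proof -
  interpret brownian_filtration M F W
    by unfold_locales (use sol in \<open>auto simp: solves_sde_def\<close>)
  have adapt: "X s \<in> borel_measurable (F s)" if "0 \<le> s" for s
    using sol that by (auto simp: solves_sde_def adapted_def)
  have XM: "X s \<in> borel_measurable M" if "0 \<le> s" for s
    using measurable_F_M[OF adapt] that by blast
  have laws: "law M (X s) \<in> \<P>\<^sub>2" if "0 \<le> s" for s using sol that by (simp add: solves_sde_def)
  define G where "G \<omega> s = (\<gamma> - \<beta> * X s \<omega>) + B s" for \<omega> s
  \<comment> \<open>One version of the integral is chosen per time, with no regularity in time;
    below, these versions are evaluated on the countable set of grid points only.\<close>
  have "\<forall>r. \<exists>J. 0 \<le> r \<longrightarrow> ito_integral M F W (\<lambda>s \<omega>. S s) r J \<and>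
      (AE \<omega> in M. set_integrable lborel {0..r} (G \<omega>) \<and> X r \<omega> = X 0 \<omega> + (LINT s:{0..r}|lborel. G \<omega> s) + J \<omega>)"
    using sol unfolding solves_sde_def S_def B_def G_def by blast
  from choice[OF this] obtain I where ito: "\<And>r. 0 \<le> r \<Longrightarrow> ito_integral M F W (\<lambda>s \<omega>. S s) r (I r)"
    and eqn: "\<And>r. 0 \<le> r \<Longrightarrow> AE \<omega> in M. set_integrable lborel {0..r} (G \<omega>) \<and>
        X r \<omega> = X 0 \<omega> + (LINT s:{0..r}|lborel. G \<omega> s) + I r \<omega>"
    by blast
  have cont: "AE \<omega> in M. continuous_on {0..} (\<lambda>s. X s \<omega>)" using sol by (simp add: solves_sde_def)
  have Sm: "(\<lambda>s. indicator {0..r} s * S s) \<in> borel_measurable borel" if r: "0 \<le> r" for r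
  proof -
    \<comment> \<open>Progressive measurability is joint in time and sample point, so a section at
      any sample point makes the deterministic integrand Borel on \<open>[0, r]\<close>.\<close>
    obtain \<omega> where \<omega>: "\<omega> \<in> space (F r)" using not_empty space_F[OF r] by auto
    have "(\<lambda>(s, \<omega>). S s) \<in> borel_measurable (restrict_space borel {0..r} \<Otimes>\<^sub>M F r)"
      using ito[OF r] r by (auto simp: ito_integral_def progressive_def)
    from measurable_compose[OF measurable_Pair2'[OF \<omega>] this]
    have "S \<in> borel_measurable (restrict_space borel {0..r})" by simp
    then show ?thesis by (simp add: borel_measurable_restrict_space_iff)
  qed
  then show "(\<lambda>s. indicator {0..t} s * S s) \<in> borel_measurable borel" using t .
  have Sb: "(S s)\<^sup>2 \<le> K" if "0 \<le> s" for s using bound[OF laws[OF that]] by (simp add: S_def)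
  have S2int: "set_integrable lborel {0..r} (\<lambda>s. (S s)\<^sup>2)" if r: "0 \<le> r" for r
    unfolding set_integrable_def
  proof (rule Bochner_Integration.integrable_bound)
    show "integrable lborel (\<lambda>s. K * indicator {0..r} s)" using r by simp
    have "(\<lambda>s. (indicator {0..r} s * S s)\<^sup>2) \<in> borel_measurable borel"
      using Sm[OF r] by (rule borel_measurable_power)
    also have "(\<lambda>s. (indicator {0..r} s * S s)\<^sup>2) = (\<lambda>s. indicator {0..r} s *\<^sub>R (S s)\<^sup>2)"
      by (auto simp: fun_eq_iff split: split_indicator)
    finally show "(\<lambda>s. indicator {0..r} s *\<^sub>R (S s)\<^sup>2) \<in> borel_measurable lborel" by simp
    show "AE s in lborel. norm (indicator {0..r} s *\<^sub>R (S s)\<^sup>2) \<le> norm (K * indicator {0..r} s)"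
      using Sb by (intro AE_I2) (auto split: split_indicator intro: order_trans[OF _ abs_ge_self])
  qed
  have S2abs: "(\<lambda>s. (S s)\<^sup>2) absolutely_integrable_on {0..t}"
    by (rule absolutely_integrable_on_lborel[OF S2int[OF t]])
  have pair: "wiener_pair (\<lambda>s. indicator {0<..r} s * S s) (I r)" if r: "0 \<le> r" for r
  proof (rule ito_integral_wiener_pair[OF ito[OF r] r])
    have "(\<lambda>s. indicator {0<..r} s * (indicator {0..r} s * S s)) \<in> borel_measurable borel"
      using Sm[OF r] by measurable
    also have "(\<lambda>s. indicator {0<..r} s * (indicator {0..r} s * S s)) = (\<lambda>s. indicator {0<..r} s * S s)"
      by (auto simp: fun_eq_iff split: split_indicator)
    finally show "(\<lambda>s. indicator {0<..r} s * S s) \<in> borel_measurable borel" .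
    show "integrable lborel (\<lambda>s. (indicator {0<..r} s * S s)\<^sup>2)"
    proof (rule Bochner_Integration.integrable_cong[THEN iffD1, OF refl _ integral_indicator_Ioc(1)[OF S2int[OF r]]])
      show "indicator {0<..r} s * (S s)\<^sup>2 = (indicator {0<..r} s * S s)\<^sup>2" for s
        by (auto split: split_indicator)
    qed
  qed
  define p where "p n i = t * real i / real (Suc n)" for n i
  have p0: "p n 0 = 0" "0 \<le> p n i" "p n i \<le> p n (Suc i)" for n i
    using t by (auto simp: p_def intro!: divide_right_mono mult_left_mono)
  have pt: "p n (Suc n) = t" for n
    unfolding p_def by (rule nonzero_mult_div_cancel_right) simp
  have pmono: "mono (p n)" for n using p0 by (intro incseq_SucI)
  have p_le: "p n i \<le> t" if "i \<le> Suc n" for n i using monoD[OF pmono[of n] that] pt by simp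
  define Z where "Z n \<omega> = (\<Sum>i<Suc n. exp (\<beta> * p n i) * (I (p n (Suc i)) \<omega> - I (p n i) \<omega>))" for n \<omega>
  define h where "h n s = (\<Sum>i<Suc n. exp (\<beta> * p n i) *
       (indicator {0<..p n (Suc i)} s * S s - indicator {0<..p n i} s * S s))" for n s
  define D where "D = integral {0..t} (\<lambda>s. exp (\<beta> * s) * (\<gamma> + B s))"
  define V where "V = integral {0..t} (\<lambda>s. (exp (\<beta> * s) * S s)\<^sup>2)"
  \<comment> \<open>Without integrability the integral has the default value 0, so the sign is right
    in either case.\<close>
  have V0: "0 \<le> V" unfolding V_def by (cases "(\<lambda>s. (exp (\<beta> * s) * S s)\<^sup>2) integrable_on {0..t}")
      (auto intro: integral_nonneg simp: not_integrable_integral)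
  have Zpair: "wiener_pair (h n) (Z n)" for n
  proof -
    have "wiener_pair (\<lambda>s. 1 * (indicator {0<..p n (Suc i)} s * S s) + (- 1) * (indicator {0<..p n i} s * S s))
        (\<lambda>\<omega>. 1 * I (p n (Suc i)) \<omega> + (- 1) * I (p n i) \<omega>)" for i
      by (intro wiener_pair_lincomb pair p0)
    from wiener_pair_sum[where I="{..<Suc n}" and a="\<lambda>i. exp (\<beta> * p n i)", OF _ this] show ?thesis
      unfolding h_def[abs_def] Z_def[abs_def] by simp
  qed
  have hint: "(\<integral>s. (h n s)\<^sup>2 \<partial>lborel) = (\<Sum>i<Suc n. exp (\<beta> * p n i) ^ 2 * integral {p n i..p n (Suc i)} (\<lambda>s. (S s)\<^sup>2))" for n
  proof -
    \<comment> \<open>The differences of indicators are indicators of the cells. A one-point sample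
      space turns the weights into a simple process, whose square is already known.\<close>
    have "h n s = simple_process (Suc n) (p n) (\<lambda>i _. exp (\<beta> * p n i)) s () * S s" for s
      unfolding h_def simple_process_def sum_distrib_right using p0
      by (intro sum.cong refl) (auto split: split_indicator intro: order_trans dest: le_less_trans)
    then have "(h n s)\<^sup>2 = (\<Sum>i<Suc n. exp (\<beta> * p n i) ^ 2 * (indicator {p n i<..p n (Suc i)} s * (S s)\<^sup>2))" for s
      using simple_process_square[of "Suc n" "p n" "\<lambda>i _. exp (\<beta> * p n i)" s "()"] p0
      by (simp add: power_mult_distrib sum_distrib_right mult.assoc del: sum.lessThan_Suc sum_mult_indicator)
    moreover have "set_integrable lborel {p n i..p n (Suc i)} (\<lambda>s. (S s)\<^sup>2)" for i
      by (rule set_integrable_subset[OF S2int[OF p0(2)[of n "Suc i"]]]) (use p0 in auto)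
    note integral_indicator_Ioc[OF this]
    ultimately show ?thesis by (simp del: sum.lessThan_Suc)
  qed
  have "(\<lambda>n. \<integral>s. (h n s)\<^sup>2 \<partial>lborel) \<longlonglongrightarrow> integral {0..t} (\<lambda>s. exp (\<beta> * s) ^ 2 * (S s)\<^sup>2)"
    unfolding hint p_def
    by (rule Riemann_Stieltjes_sum_tendsto[OF t _ S2abs, where k="\<lambda>s. exp (\<beta> * s) ^ 2" and c="\<lambda>n i. t * real i / real (Suc n)"])
      (use t in \<open>auto intro!: continuous_intros divide_right_mono mult_left_mono\<close>)
  then have hV: "(\<lambda>n. \<integral>s. (h n s)\<^sup>2 \<partial>lborel) \<longlonglongrightarrow> V" by (simp add: V_def power_mult_distrib)
  \<comment> \<open>The equation holds almost surely at each fixed time. The grid points of all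
    levels are countable, so one null set serves for all of them.\<close>
  have good: "AE \<omega> in M. continuous_on {0..} (\<lambda>s. X s \<omega>) \<and> (\<forall>n i. set_integrable lborel {0..p n i} (G \<omega>) \<and>
        X (p n i) \<omega> = X 0 \<omega> + (LINT s:{0..p n i}|lborel. G \<omega> s) + I (p n i) \<omega>)"
    using cont eqn[OF p0(2)] by (simp add: AE_conj_iff AE_all_countable)
  have absint: "G \<omega> absolutely_integrable_on {0..t}" "B absolutely_integrable_on {0..t}"
    if c: "continuous_on {0..} (\<lambda>s. X s \<omega>)" and i: "set_integrable lborel {0..t} (G \<omega>)" for \<omega>
  proof -
    show G: "G \<omega> absolutely_integrable_on {0..t}" by (rule absolutely_integrable_on_lborel[OF i])
    have "(\<lambda>s. \<beta> * X s \<omega> - \<gamma>) absolutely_integrable_on {0..t}"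
      using continuous_on_subset[OF c, of "{0..t}"]
      by (intro absolutely_integrable_continuous_real continuous_intros) auto
    from set_integral_add(1)[OF G this] show "B absolutely_integrable_on {0..t}"
      by (simp add: G_def algebra_simps)
  qed
  show Babs: "B absolutely_integrable_on {0..t}"
  proof -
    \<comment> \<open>\<open>B\<close> is deterministic and equals \<open>G \<omega>\<close> plus a
      continuous function along any good path, so one such path suffices. The point
      \<open>p 0 (Suc 0)\<close> is \<open>t\<close>.\<close>
    obtain \<omega> where c: "continuous_on {0..} (\<lambda>s. X s \<omega>)" and i: "set_integrable lborel {0..p 0 (Suc 0)} (G \<omega>)"
      using eventually_happens'[OF ae_filter_bot good] by blast
    then show ?thesis using absint(2)[OF c] unfolding pt by blast
  qed
  have limZ: "(\<lambda>n. Z n \<omega>) \<longlonglongrightarrow> exp (\<beta> * t) * X t \<omega> - X 0 \<omega> - D"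
    if c: "continuous_on {0..} (\<lambda>s. X s \<omega>)"
      and e: "\<And>n i. set_integrable lborel {0..p n i} (G \<omega>) \<and>
        X (p n i) \<omega> = X 0 \<omega> + (LINT s:{0..p n i}|lborel. G \<omega> s) + I (p n i) \<omega>" for \<omega>
  proof -
    have Gi: "set_integrable lborel {0..t} (G \<omega>)" using e pt by metis
    have Gabs: "G \<omega> absolutely_integrable_on {0..t}" by (rule absint(1)[OF c Gi])
    then have Gint: "G \<omega> integrable_on {0..t}" by (simp add: absolutely_integrable_on_def)
    have ct: "continuous_on {0..t} (\<lambda>s. X s \<omega>)" by (rule continuous_on_subset[OF c]) auto
    have ce: "continuous_on {0..t} (\<lambda>s. \<beta> * exp (\<beta> * s))" by (intro continuous_intros)
    have inc: "I (p n (Suc i)) \<omega> - I (p n i) \<omega>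
       = (X (p n (Suc i)) \<omega> - X (p n i) \<omega>) - integral {p n i..p n (Suc i)} (G \<omega>)" if "i < Suc n" for n i
    proof -
      have "G \<omega> integrable_on {0..p n (Suc i)}"
        by (rule integrable_on_subinterval[OF Gint]) (use p_le[of "Suc i" n] that in auto)
      from Henstock_Kurzweil_Integration.integral_combine[OF p0(2) p0(3) this]
      have "integral {p n i..p n (Suc i)} (G \<omega>) = integral {0..p n (Suc i)} (G \<omega>) - integral {0..p n i} (G \<omega>)"
        by simp
      then show ?thesis using e[of n i] e[of n "Suc i"] by (simp add: set_borel_integral_eq_integral(2))
    qed
    have fund: "integral {p n i..p n (Suc i)} (\<lambda>s. \<beta> * exp (\<beta> * s)) = exp (\<beta> * p n (Suc i)) - exp (\<beta> * p n i)" for n i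
      by (rule integral_unique, rule fundamental_theorem_of_calculus[OF p0(3)])
        (auto intro!: derivative_eq_intros simp: has_real_derivative_iff_has_vector_derivative[symmetric])
    have Zn: "Z n \<omega> = exp (\<beta> * t) * X t \<omega> - X 0 \<omega>
       - (\<Sum>i<Suc n. X (p n (Suc i)) \<omega> * integral {p n i..p n (Suc i)} (\<lambda>s. \<beta> * exp (\<beta> * s)))
       - (\<Sum>i<Suc n. exp (\<beta> * p n i) * integral {p n i..p n (Suc i)} (G \<omega>))" for n
    proof -
      have "Z n \<omega> = (\<Sum>i<Suc n. exp (\<beta> * p n i) * (X (p n (Suc i)) \<omega> - X (p n i) \<omega>)
          - exp (\<beta> * p n i) * integral {p n i..p n (Suc i)} (G \<omega>))"
        unfolding Z_def by (intro sum.cong refl) (simp add: inc right_diff_distrib)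
      also have "\<dots> = (\<Sum>i<Suc n. exp (\<beta> * p n i) * (X (p n (Suc i)) \<omega> - X (p n i) \<omega>))
          - (\<Sum>i<Suc n. exp (\<beta> * p n i) * integral {p n i..p n (Suc i)} (G \<omega>))"
        by (rule sum_subtractf)
      also have "(\<Sum>i<Suc n. exp (\<beta> * p n i) * (X (p n (Suc i)) \<omega> - X (p n i) \<omega>))
          = exp (\<beta> * t) * X t \<omega> - X 0 \<omega> - (\<Sum>i<Suc n. X (p n (Suc i)) \<omega> * (exp (\<beta> * p n (Suc i)) - exp (\<beta> * p n i)))"
        using sum_by_parts[of "\<lambda>i. exp (\<beta> * p n i)" "\<lambda>i. X (p n i) \<omega>" "Suc n"] pt p0(1) by simp
      finally show ?thesis by (simp only: fund)
    qed
    \<comment> \<open>The tags are right end points here, since summation by parts leaves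
      \<open>X\<close> at \<open>p n (Suc i)\<close>.\<close>
    have lim1: "(\<lambda>n. \<Sum>i<Suc n. X (p n (Suc i)) \<omega> * integral {p n i..p n (Suc i)} (\<lambda>s. \<beta> * exp (\<beta> * s)))
        \<longlonglongrightarrow> integral {0..t} (\<lambda>s. X s \<omega> * (\<beta> * exp (\<beta> * s)))"
      unfolding p_def
      by (rule Riemann_Stieltjes_sum_tendsto[OF t ct absolutely_integrable_continuous_real[OF ce], where c="\<lambda>n i. t * real (Suc i) / real (Suc n)"])
        (use t in \<open>auto intro!: divide_right_mono mult_left_mono\<close>)
    have cexp: "continuous_on {0..t} (\<lambda>s. exp (\<beta> * s))" by (intro continuous_intros)
    have lim2: "(\<lambda>n. \<Sum>i<Suc n. exp (\<beta> * p n i) * integral {p n i..p n (Suc i)} (G \<omega>))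
        \<longlonglongrightarrow> integral {0..t} (\<lambda>s. exp (\<beta> * s) * G \<omega> s)"
      unfolding p_def
      by (rule Riemann_Stieltjes_sum_tendsto[OF t cexp Gabs, where c="\<lambda>n i. t * real i / real (Suc n)"])
        (use t in \<open>auto intro!: divide_right_mono mult_left_mono\<close>)
    have "integral {0..t} (\<lambda>s. X s \<omega> * (\<beta> * exp (\<beta> * s))) + integral {0..t} (\<lambda>s. exp (\<beta> * s) * G \<omega> s)
        = integral {0..t} (\<lambda>s. X s \<omega> * (\<beta> * exp (\<beta> * s)) + exp (\<beta> * s) * G \<omega> s)"
    proof (rule Henstock_Kurzweil_Integration.integral_add[symmetric])
      show "(\<lambda>s. X s \<omega> * (\<beta> * exp (\<beta> * s))) integrable_on {0..t}"
        by (intro integrable_continuous_real continuous_intros ct)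
      show "(\<lambda>s. exp (\<beta> * s) * G \<omega> s) integrable_on {0..t}"
        using abs_integrable_continuous_mult[OF cexp Gabs] by (simp add: absolutely_integrable_on_def)
    qed
    \<comment> \<open>The terms containing \<open>X\<close> cancel; this is why the weight is
      \<open>exp (\<beta> * s)\<close>, and it leaves a deterministic shift.\<close>
    also have "\<dots> = D" unfolding D_def G_def by (simp add: algebra_simps)
    finally have D: "D = integral {0..t} (\<lambda>s. X s \<omega> * (\<beta> * exp (\<beta> * s))) + integral {0..t} (\<lambda>s. exp (\<beta> * s) * G \<omega> s)"
      by simp
    show ?thesis unfolding Zn D diff_diff_eq[symmetric] by (intro tendsto_diff tendsto_const lim1 lim2)
  qed
  have Zlim: "AE \<omega> in M. (\<lambda>n. Z n \<omega>) \<longlonglongrightarrow> exp (\<beta> * t) * X t \<omega> - X 0 \<omega> - D"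
    using good by eventually_elim (rule limZ, auto)
  have ZM: "Z n \<in> borel_measurable M" for n using Zpair by (simp add: wiener_pair_def)
  have init: "distr M borel (X 0) = \<mu>\<^sub>0" using sol by (simp add: solves_sde_def)
  have mu: "prob_space \<mu>\<^sub>0" "sets \<mu>\<^sub>0 = sets borel"
    using init[symmetric] by (auto intro!: prob_space_distr XM)
  let ?Y = "\<lambda>\<omega>. exp (\<beta> * t) * X t \<omega> - D"
  have YM: "?Y \<in> borel_measurable M" using XM[OF t] by measurable
  \<comment> \<open>Both sides are compared through \<open>X 0 + Z n\<close>: its characteristic
    functions converge to that of the left side by the pathwise limit of \<open>Z n\<close>, and to
    that of the right side by the limit \<open>hV\<close> of the variances.\<close>
  have "distr M borel ?Y = distr (\<mu>\<^sub>0 \<Otimes>\<^sub>M std_normal_distribution) borel (\<lambda>(x, g). x + sqrt V * g)" (is "?L = ?R")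
  proof (rule Levy_uniqueness)
    show "real_distribution ?L" using YM by (rule real_distribution_distr)
    interpret \<mu>: prob_space \<mu>\<^sub>0 by fact
    interpret N: real_distribution std_normal_distribution by (rule real_dist_normal_dist)
    interpret P: pair_prob_space \<mu>\<^sub>0 std_normal_distribution ..
    note [measurable_cong] = mu(2)
    show "real_distribution ?R" by (rule P.real_distribution_distr) measurable
    show "char ?L = char ?R"
    proof
      fix v
      have "(\<lambda>n. char (distr M borel (\<lambda>\<omega>. X 0 \<omega> + Z n \<omega>)) v) \<longlonglongrightarrow> char ?L v"
      proof -
        have X0: "X 0 \<in> borel_measurable M" using XM by simp
        have "(\<lambda>n. CLINT \<omega>|M. iexp (v * (X 0 \<omega> + Z n \<omega>))) \<longlonglongrightarrow> (CLINT \<omega>|M. iexp (v * ?Y \<omega>))"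
        proof (rule integral_dominated_convergence[where w="\<lambda>_. 1"])
          show "AE \<omega> in M. (\<lambda>n. iexp (v * (X 0 \<omega> + Z n \<omega>))) \<longlonglongrightarrow> iexp (v * ?Y \<omega>)"
            using Zlim
          proof eventually_elim
            case (elim \<omega>)
            then have "(\<lambda>n. iexp (v * (X 0 \<omega> + Z n \<omega>))) \<longlonglongrightarrow> iexp (v * (X 0 \<omega> + (exp (\<beta> * t) * X t \<omega> - X 0 \<omega> - D)))"
              by (intro tendsto_intros)
            then show ?case by (simp add: algebra_simps)
          qed
        qed (use X0 ZM XM[OF t] in auto)
        moreover have "char (distr M borel (\<lambda>\<omega>. X 0 \<omega> + Z n \<omega>)) v = (CLINT \<omega>|M. iexp (v * (X 0 \<omega> + Z n \<omega>)))" for n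
          unfolding char_def by (rule integral_distr) (use X0 ZM in auto)
        moreover have "char ?L v = (CLINT \<omega>|M. iexp (v * ?Y \<omega>))"
          unfolding char_def by (rule integral_distr[OF YM]) auto
        ultimately show ?thesis by simp
      qed
      moreover have "char (distr M borel (\<lambda>\<omega>. X 0 \<omega> + Z n \<omega>)) v
          = char \<mu>\<^sub>0 v * exp (- (v\<^sup>2 * (\<integral>s. (h n s)\<^sup>2 \<partial>lborel)) / 2)" for n
        using wiener_pair_char[OF Zpair adapt[of 0], of n v] init by simp
      moreover have "(\<lambda>n. char \<mu>\<^sub>0 v * exp (- (v\<^sup>2 * (\<integral>s. (h n s)\<^sup>2 \<partial>lborel)) / 2))
          \<longlonglongrightarrow> char \<mu>\<^sub>0 v * exp (- (v\<^sup>2 * V) / 2)"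
        by (intro tendsto_intros hV) auto
      moreover have "char ?R v = char \<mu>\<^sub>0 v * exp (- (v\<^sup>2 * V) / 2)"
        using char_pair_std_normal[OF mu, of "sqrt V" v] V0 by simp
      ultimately show "char ?L v = char ?R v" using LIMSEQ_unique by auto
    qed
  qed
  then have "distr ?L borel (\<lambda>z. exp (- \<beta> * t) * (z + D)) = distr ?R borel (\<lambda>z. exp (- \<beta> * t) * (z + D))"
    by simp
  moreover have "distr ?L borel (\<lambda>z. exp (- \<beta> * t) * (z + D)) = law M (X t)"
  proof -
    have eq: "exp (- \<beta> * t) * (exp (\<beta> * t) * x - D + D) = x" for x
      by (simp add: mult.assoc[symmetric] exp_add[symmetric])
    have "distr ?L borel (\<lambda>z. exp (- \<beta> * t) * (z + D)) = distr M borel ((\<lambda>z. exp (- \<beta> * t) * (z + D)) \<circ> ?Y)"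
      by (rule distr_distr) (use YM in auto)
    also have "(\<lambda>z. exp (- \<beta> * t) * (z + D)) \<circ> ?Y = X t" by (simp only: comp_def eq)
    finally show ?thesis .
  qed
  moreover have "distr ?R borel (\<lambda>z. exp (- \<beta> * t) * (z + D)) = distr (\<mu>\<^sub>0 \<Otimes>\<^sub>M std_normal_distribution) borel
      (\<lambda>(x, g). exp (- \<beta> * t) * (x + D + sqrt V * g))"
  proof -
    note [measurable_cong] = mu(2)
    show ?thesis by (subst distr_distr) (auto simp: comp_def split_beta' add_ac)
  qed
  ultimately show "law M (X t) = distr (\<mu>\<^sub>0 \<Otimes>\<^sub>M std_normal_distribution) borel
      (\<lambda>(x, g). exp (- \<beta> * t) * (x + integral {0..t} (\<lambda>s. exp (\<beta> * s) * (\<gamma> + B s))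
         + sqrt (integral {0..t} (\<lambda>s. (exp (\<beta> * s) * S s)\<^sup>2)) * g))"
    unfolding D_def V_def by simp
qed

section \<open>Wasserstein stability\<close>

lemma prob_measures2D:
  assumes "\<mu> \<in> \<P>\<^sub>2"
  shows "prob_space \<mu>" "sets \<mu> = sets borel" "integrable \<mu> (\<lambda>x. x\<^sup>2)"
  using assms by (auto simp: prob_measures2_def prob_measures_def)

lemma couplingD:
  assumes "\<pi> \<in> couplings \<mu> \<nu>" "\<mu> \<in> \<P>\<^sub>2" "\<nu> \<in> \<P>\<^sub>2"
  shows "prob_space \<pi>" "sets \<pi> = sets (borel \<Otimes>\<^sub>M borel)" "distr \<pi> borel fst = \<mu>" "distr \<pi> borel snd = \<nu>"
    "integrable \<pi> (\<lambda>p. (fst p - snd p)\<^sup>2)"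
proof -
  show s: "sets \<pi> = sets (borel \<Otimes>\<^sub>M borel)" and d: "distr \<pi> borel fst = \<mu>" "distr \<pi> borel snd = \<nu>"
    using assms(1) by (auto simp: couplings_def)
  note [measurable_cong] = s
  have m: "fst \<in> measurable \<pi> borel" "snd \<in> measurable \<pi> borel" by measurable
  show "prob_space \<pi>"
    using prob_measures2D(1)[OF assms(2)] m(1) unfolding d(1)[symmetric] by (rule prob_space_distrD[rotated])
  have "integrable \<pi> (\<lambda>p. (fst p)\<^sup>2)" "integrable \<pi> (\<lambda>p. (snd p)\<^sup>2)"
    using prob_measures2D(3)[OF assms(2)] prob_measures2D(3)[OF assms(3)] m
    unfolding d[symmetric] by (simp_all add: integrable_distr_eq)
  then show "integrable \<pi> (\<lambda>p. (fst p - snd p)\<^sup>2)"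
    using integrable_power2_diff[OF m] by simp
qed

lemma W2_le:
  assumes "\<pi> \<in> couplings \<mu> \<nu>"
  shows "\<W>\<^sub>2 \<mu> \<nu> \<le> sqrt (\<integral>p. (fst p - snd p)\<^sup>2 \<partial>\<pi>)"
proof -
  have "\<W>\<^sub>2 \<mu> \<nu> \<le> sqrt (\<integral>(x, y). \<bar>x - y\<bar>\<^sup>2 \<partial>\<pi>)"
    unfolding W2_def by (rule cINF_lower[OF bdd_belowI2[where m=0] assms]) (auto simp: split_beta')
  then show ?thesis by (simp add: split_beta')
qed

text \<open>Minkowski's inequality for a constant shift; the mixed term is controlled because the
  mean of \<open>Z\<close> is at most its L2 norm in absolute value.\<close>

lemma (in prob_space) integral_power2_shift_le:
  fixes Z :: "'a \<Rightarrow> real"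
  assumes Z: "Z \<in> borel_measurable M" and Z2: "integrable M (\<lambda>x. (Z x)\<^sup>2)"
  shows "(\<integral>x. (Z x + d)\<^sup>2 \<partial>M) \<le> (sqrt (\<integral>x. (Z x)\<^sup>2 \<partial>M) + \<bar>d\<bar>)\<^sup>2"
proof -
  let ?w = "sqrt (\<integral>x. (Z x)\<^sup>2 \<partial>M)"
  have Z1: "integrable M Z" using integral_Cauchy_Schwarz(1)[OF Z _ Z2, of "\<lambda>_. 1"] by simp
  have "(\<integral>x. Z x \<partial>M)\<^sup>2 \<le> (\<integral>x. (Z x)\<^sup>2 \<partial>M)"
    using integral_Cauchy_Schwarz(2)[OF Z _ Z2, of "\<lambda>_. 1"] by (simp add: prob_space)
  then have "\<bar>\<integral>x. Z x \<partial>M\<bar> \<le> ?w" by (intro real_le_rsqrt) simp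
  then have "d * (\<integral>x. Z x \<partial>M) \<le> \<bar>d\<bar> * ?w"
    using mult_left_mono[of "\<bar>\<integral>x. Z x \<partial>M\<bar>" ?w "\<bar>d\<bar>"] by (simp add: abs_mult[symmetric])
  moreover have "(\<integral>x. (Z x + d)\<^sup>2 \<partial>M) = (\<integral>x. (Z x)\<^sup>2 + 2 * d * Z x + d\<^sup>2 \<partial>M)"
    by (simp add: power2_eq_square algebra_simps)
  then have "(\<integral>x. (Z x + d)\<^sup>2 \<partial>M) = (\<integral>x. (Z x)\<^sup>2 \<partial>M) + 2 * d * (\<integral>x. Z x \<partial>M) + d\<^sup>2"
    using Z1 Z2 by (simp add: prob_space)
  ultimately show ?thesis by (simp add: power2_sum mult_ac)
qed

lemma std_normal_quadratic:
  "(\<integral>\<^sup>+g. ennreal ((m + c * g)\<^sup>2) \<partial>std_normal_distribution) = ennreal (m\<^sup>2 + c\<^sup>2)"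
proof -
  interpret N: real_distribution std_normal_distribution by (rule real_dist_normal_dist)
  have i: "integrable std_normal_distribution (\<lambda>g. g)" "integrable std_normal_distribution (\<lambda>g. g\<^sup>2)"
    using integrable_std_normal_distribution_moment[of 1] integrable_std_normal_distribution_moment[of 2] by auto
  have e: "(\<integral>g. g \<partial>std_normal_distribution) = 0" "(\<integral>g. g\<^sup>2 \<partial>std_normal_distribution) = 1"
    using integral_std_normal_distribution_moment_odd[of 1] std_normal_distribution_even_moments(1)[of 1] by auto
  have "has_bochner_integral std_normal_distribution (\<lambda>g. m\<^sup>2 + 2 * m * c * g + c\<^sup>2 * g\<^sup>2)
      (m\<^sup>2 + 2 * m * c * 0 + c\<^sup>2 * 1)"
    by (intro has_bochner_integral_add has_bochner_integral_mult_right)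
      (use i e N.prob_space in \<open>auto simp: has_bochner_integral_iff\<close>)
  also have "(\<lambda>g. m\<^sup>2 + 2 * m * c * g + c\<^sup>2 * g\<^sup>2) = (\<lambda>g. (m + c * g)\<^sup>2)"
    by (simp add: fun_eq_iff power2_eq_square algebra_simps)
  finally have hb: "has_bochner_integral std_normal_distribution (\<lambda>g. (m + c * g)\<^sup>2) (m\<^sup>2 + c\<^sup>2)" by simp
  have "(\<integral>\<^sup>+g. ennreal ((m + c * g)\<^sup>2) \<partial>std_normal_distribution)
     = ennreal (\<integral>g. (m + c * g)\<^sup>2 \<partial>std_normal_distribution)"
    by (rule nn_integral_eq_integral[OF integrable.intros[OF hb]]) simp
  then show ?thesis unfolding has_bochner_integral_integral_eq[OF hb] .
qed

text \<open>One normal variable, independent of the coupled starting points, drives both components.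
  Its zero mean removes the mixed term, so the distance of the shifted starting points and the
  difference of the standard deviations add up as squares.\<close>

lemma W2_gaussian_shift_le:
  assumes \<pi>: "\<pi> \<in> couplings \<mu>\<^sub>0 \<nu>\<^sub>0" and P2: "\<mu>\<^sub>0 \<in> \<P>\<^sub>2" "\<nu>\<^sub>0 \<in> \<P>\<^sub>2" and a: "0 \<le> a"
  shows "\<W>\<^sub>2 (distr (\<mu>\<^sub>0 \<Otimes>\<^sub>M std_normal_distribution) borel (\<lambda>(x, g). a * (x + D1 + s1 * g)))
            (distr (\<nu>\<^sub>0 \<Otimes>\<^sub>M std_normal_distribution) borel (\<lambda>(x, g). a * (x + D2 + s2 * g)))
    \<le> a * sqrt ((sqrt (\<integral>p. (fst p - snd p)\<^sup>2 \<partial>\<pi>) + \<bar>D1 - D2\<bar>)\<^sup>2 + (s1 - s2)\<^sup>2)"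
proof -
  let ?N = std_normal_distribution
  note c = couplingD[OF \<pi> P2]
  interpret \<pi>: prob_space \<pi> by (rule c(1))
  interpret N: real_distribution ?N by (rule real_dist_normal_dist)
  interpret P: pair_prob_space \<pi> ?N ..
  note [measurable_cong] = c(2)
  let ?T = "\<lambda>p. (a * (fst (fst p) + D1 + s1 * snd p), a * (snd (fst p) + D2 + s2 * snd p))"
  define \<pi>' where "\<pi>' = distr (\<pi> \<Otimes>\<^sub>M ?N) (borel \<Otimes>\<^sub>M borel) ?T"
  have T[measurable]: "?T \<in> measurable (\<pi> \<Otimes>\<^sub>M ?N) (borel \<Otimes>\<^sub>M borel)" by measurable
  \<comment> \<open>An arbitrary \<open>h\<close> serves both projections of the coupling.\<close>
  have marg: "distr (distr \<pi> borel h \<Otimes>\<^sub>M ?N) borel (\<lambda>(x, g). a * (x + D + s * g))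
      = distr (\<pi> \<Otimes>\<^sub>M ?N) borel (\<lambda>p. a * (h (fst p) + D + s * snd p))"
    if h[measurable]: "h \<in> borel_measurable \<pi>" for h D s
  proof -
    have id: "distr ?N ?N (\<lambda>x. x) = ?N" by (rule distr_id)
    have "distr \<pi> borel h \<Otimes>\<^sub>M distr ?N ?N (\<lambda>x. x) = distr (\<pi> \<Otimes>\<^sub>M ?N) (borel \<Otimes>\<^sub>M ?N) (\<lambda>(x, y). (h x, y))"
      by (rule pair_measure_distr) (simp_all add: id N.sigma_finite_measure_axioms)
    then have eq: "distr \<pi> borel h \<Otimes>\<^sub>M ?N = distr (\<pi> \<Otimes>\<^sub>M ?N) (borel \<Otimes>\<^sub>M ?N) (\<lambda>(x, y). (h x, y))"
      unfolding id .
    have "distr (distr (\<pi> \<Otimes>\<^sub>M ?N) (borel \<Otimes>\<^sub>M ?N) (\<lambda>(x, y). (h x, y))) borel (\<lambda>(x, g). a * (x + D + s * g))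
        = distr (\<pi> \<Otimes>\<^sub>M ?N) borel ((\<lambda>(x, g). a * (x + D + s * g)) \<circ> (\<lambda>(x, y). (h x, y)))"
      by (rule distr_distr) measurable
    also have "(\<lambda>(x, g). a * (x + D + s * g)) \<circ> (\<lambda>(x, y). (h x, y)) = (\<lambda>p. a * (h (fst p) + D + s * snd p))"
      by (simp add: fun_eq_iff)
    finally show ?thesis unfolding eq .
  qed
  have m1: "distr \<pi>' borel fst = distr (\<mu>\<^sub>0 \<Otimes>\<^sub>M ?N) borel (\<lambda>(x, g). a * (x + D1 + s1 * g))"
  proof -
    have "distr \<pi>' borel fst = distr (\<pi> \<Otimes>\<^sub>M ?N) borel (fst \<circ> ?T)"
      unfolding \<pi>'_def by (rule distr_distr) measurable
    also have "\<dots> = distr (distr \<pi> borel fst \<Otimes>\<^sub>M ?N) borel (\<lambda>(x, g). a * (x + D1 + s1 * g))"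
      by (subst marg) (simp_all add: comp_def)
    finally show ?thesis unfolding c(3) .
  qed
  have m2: "distr \<pi>' borel snd = distr (\<nu>\<^sub>0 \<Otimes>\<^sub>M ?N) borel (\<lambda>(x, g). a * (x + D2 + s2 * g))"
  proof -
    have "distr \<pi>' borel snd = distr (\<pi> \<Otimes>\<^sub>M ?N) borel (snd \<circ> ?T)"
      unfolding \<pi>'_def by (rule distr_distr) measurable
    also have "\<dots> = distr (distr \<pi> borel snd \<Otimes>\<^sub>M ?N) borel (\<lambda>(x, g). a * (x + D2 + s2 * g))"
      by (subst marg) (simp_all add: comp_def)
    finally show ?thesis unfolding c(4) .
  qed
  have coup: "\<pi>' \<in> couplings (distr (\<mu>\<^sub>0 \<Otimes>\<^sub>M ?N) borel (\<lambda>(x, g). a * (x + D1 + s1 * g)))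
            (distr (\<nu>\<^sub>0 \<Otimes>\<^sub>M ?N) borel (\<lambda>(x, g). a * (x + D2 + s2 * g)))"
    unfolding couplings_def using m1 m2 by (simp add: \<pi>'_def)
  let ?q = "\<lambda>p. (fst p - snd p) + (D1 - D2)"
  have q2: "integrable \<pi> (\<lambda>p. (?q p)\<^sup>2)"
    using integrable_power2_diff[of "\<lambda>p. fst p - snd p" \<pi> "\<lambda>_. D2 - D1"] c(5) by (simp add: algebra_simps)
  have "(\<integral>\<^sup>+p. ennreal ((fst p - snd p)\<^sup>2) \<partial>\<pi>')
      = (\<integral>\<^sup>+p. ennreal ((fst (?T p) - snd (?T p))\<^sup>2) \<partial>(\<pi> \<Otimes>\<^sub>M ?N))"
    unfolding \<pi>'_def by (rule nn_integral_distr) measurable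
  also have "\<dots> = (\<integral>\<^sup>+p. \<integral>\<^sup>+g. ennreal ((a * ?q p + a * (s1 - s2) * g)\<^sup>2) \<partial>?N \<partial>\<pi>)"
    by (subst N.nn_integral_fst[symmetric]) (auto simp: algebra_simps)
  also have "\<dots> = (\<integral>\<^sup>+p. ennreal (a\<^sup>2 * ((?q p)\<^sup>2 + (s1 - s2)\<^sup>2)) \<partial>\<pi>)"
    unfolding std_normal_quadratic by (simp only: power_mult_distrib distrib_left[of "a\<^sup>2", symmetric])
  also have "\<dots> = ennreal (\<integral>p. a\<^sup>2 * ((?q p)\<^sup>2 + (s1 - s2)\<^sup>2) \<partial>\<pi>)"
    using q2 by (intro nn_integral_eq_integral) auto
  also have "(\<integral>p. a\<^sup>2 * ((?q p)\<^sup>2 + (s1 - s2)\<^sup>2) \<partial>\<pi>) = a\<^sup>2 * ((\<integral>p. (?q p)\<^sup>2 \<partial>\<pi>) + (s1 - s2)\<^sup>2)"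
    using q2 by (simp add: \<pi>.prob_space)
  finally have nn: "(\<integral>\<^sup>+p. ennreal ((fst p - snd p)\<^sup>2) \<partial>\<pi>') = ennreal (a\<^sup>2 * ((\<integral>p. (?q p)\<^sup>2 \<partial>\<pi>) + (s1 - s2)\<^sup>2))" .
  have "(\<integral>p. (fst p - snd p)\<^sup>2 \<partial>\<pi>') = a\<^sup>2 * ((\<integral>p. (?q p)\<^sup>2 \<partial>\<pi>) + (s1 - s2)\<^sup>2)"
  proof -
    have "(\<integral>p. (fst p - snd p)\<^sup>2 \<partial>\<pi>') = enn2real (\<integral>\<^sup>+p. ennreal ((fst p - snd p)\<^sup>2) \<partial>\<pi>')"
      by (rule integral_eq_nn_integral) (simp_all add: \<pi>'_def)
    also have "\<dots> = a\<^sup>2 * ((\<integral>p. (?q p)\<^sup>2 \<partial>\<pi>) + (s1 - s2)\<^sup>2)"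
      unfolding nn by (rule enn2real_ennreal) simp
    finally show ?thesis .
  qed
  also have "\<dots> \<le> a\<^sup>2 * ((sqrt (\<integral>p. (fst p - snd p)\<^sup>2 \<partial>\<pi>) + \<bar>D1 - D2\<bar>)\<^sup>2 + (s1 - s2)\<^sup>2)"
    by (intro mult_left_mono add_right_mono \<pi>.integral_power2_shift_le c(5)) auto
  finally have "sqrt (\<integral>p. (fst p - snd p)\<^sup>2 \<partial>\<pi>') \<le> sqrt (a\<^sup>2 * ((sqrt (\<integral>p. (fst p - snd p)\<^sup>2 \<partial>\<pi>) + \<bar>D1 - D2\<bar>)\<^sup>2 + (s1 - s2)\<^sup>2))"
    by (rule real_sqrt_le_mono)
  also have "\<dots> = a * sqrt ((sqrt (\<integral>p. (fst p - snd p)\<^sup>2 \<partial>\<pi>) + \<bar>D1 - D2\<bar>)\<^sup>2 + (s1 - s2)\<^sup>2)"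
    using a by (simp add: real_sqrt_mult)
  finally show ?thesis using W2_le[OF coup] by linarith
qed

text \<open>The reverse triangle inequality in L2. Applied to the two diffusion coefficients it
  bounds \<open>(sqrt V1 - sqrt V2)\<^sup>2\<close> by the integral that the Ito isometry would
  produce for solutions with a common Brownian motion.\<close>

lemma L2_norm_diff_le:
  fixes f g :: "'a \<Rightarrow> real"
  assumes [measurable]: "f \<in> borel_measurable M" "g \<in> borel_measurable M"
    and f2: "integrable M (\<lambda>x. (f x)\<^sup>2)" and g2: "integrable M (\<lambda>x. (g x)\<^sup>2)"
  shows "(sqrt (\<integral>x. (f x)\<^sup>2 \<partial>M) - sqrt (\<integral>x. (g x)\<^sup>2 \<partial>M))\<^sup>2 \<le> (\<integral>x. (f x - g x)\<^sup>2 \<partial>M)"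
proof -
  note cs = integral_Cauchy_Schwarz[OF assms]
  have "(\<integral>x. f x * g x \<partial>M) \<le> sqrt ((\<integral>x. (f x)\<^sup>2 \<partial>M) * (\<integral>x. (g x)\<^sup>2 \<partial>M))"
    using cs(2) by (rule real_le_rsqrt)
  moreover have "(\<integral>x. (f x - g x)\<^sup>2 \<partial>M) = (\<integral>x. (f x)\<^sup>2 + (g x)\<^sup>2 - 2 * (f x * g x) \<partial>M)"
    by (simp add: power2_diff mult.assoc)
  then have "(\<integral>x. (f x - g x)\<^sup>2 \<partial>M) = (\<integral>x. (f x)\<^sup>2 \<partial>M) + (\<integral>x. (g x)\<^sup>2 \<partial>M) - 2 * (\<integral>x. f x * g x \<partial>M)"
    using cs(1) f2 g2 by simp
  ultimately show ?thesis by (simp add: power2_diff real_sqrt_mult)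
qed

text \<open>Here \<open>db\<close> and \<open>ds\<close> are the differences of the coefficients along two solutions, and \<open>R s\<close> is the
  bound on \<open>exp (2 \<beta> s) \<W>\<^sub>2\<^sup>2\<close> of the laws at time \<open>s\<close> that the synchronous coupling provides. Stating the
  bound for \<open>R\<close> avoids measurability of \<open>s \<mapsto> \<W>\<^sub>2 (law of X\<^sub>s) (law of Y\<^sub>s)\<close>.\<close>

lemma coefficient_stability:
  fixes db ds :: "real \<Rightarrow> real" and \<beta> L\<^sub>b L\<^sub>\<sigma> w T :: real
  defines "R \<equiv> \<lambda>s. (w + \<bar>integral {0..s} (\<lambda>r. exp (\<beta> * r) * db r)\<bar>)\<^sup>2 + integral {0..s} (\<lambda>r. (exp (\<beta> * r) * ds r)\<^sup>2)"
  assumes db: "(\<lambda>r. exp (\<beta> * r) * db r) integrable_on {0..T}"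
    and ds: "(\<lambda>r. (exp (\<beta> * r) * ds r)\<^sup>2) integrable_on {0..T}"
    and nn: "0 \<le> w" "0 \<le> L\<^sub>b" "0 \<le> L\<^sub>\<sigma>"
    and db_le: "\<And>s. s \<in> {0..T} \<Longrightarrow> exp (\<beta> * s) * \<bar>db s\<bar> \<le> L\<^sub>b * sqrt (R s)"
    and ds_le: "\<And>s. s \<in> {0..T} \<Longrightarrow> exp (\<beta> * s) * \<bar>ds s\<bar> \<le> L\<^sub>\<sigma> * sqrt (R s)"
    and s: "s \<in> {0..T}"
  shows "exp (\<beta> * s) * \<bar>db s\<bar> \<le> L\<^sub>b * (w * exp ((L\<^sub>b + L\<^sub>\<sigma>\<^sup>2 / 2) * s))"
    and "exp (\<beta> * s) * \<bar>ds s\<bar> \<le> L\<^sub>\<sigma> * (w * exp ((L\<^sub>b + L\<^sub>\<sigma>\<^sup>2 / 2) * s))"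
proof -
  define \<rho> where "\<rho> s = sqrt (R s)" for s
  have sub: "{0..s} \<subseteq> {0..T}" if "s \<in> {0..T}" for s using that by auto
  have dbi: "(\<lambda>r. exp (\<beta> * r) * db r) integrable_on {0..s}" if "s \<in> {0..T}" for s
    using integrable_on_subinterval[OF db sub[OF that]] .
  have dsi: "(\<lambda>r. (exp (\<beta> * r) * ds r)\<^sup>2) integrable_on {0..s}" if "s \<in> {0..T}" for s
    using integrable_on_subinterval[OF ds sub[OF that]] .
  have ds0: "0 \<le> integral {0..s} (\<lambda>r. (exp (\<beta> * r) * ds r)\<^sup>2)" if "s \<in> {0..T}" for s
    by (rule integral_nonneg[OF dsi[OF that]]) auto
  have R0: "0 \<le> R s" if "s \<in> {0..T}" for s using ds0[OF that] by (simp add: R_def)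
  have cont: "continuous_on {0..T} \<rho>"
    unfolding \<rho>_def R_def using indefinite_integral_continuous_1[OF db] indefinite_integral_continuous_1[OF ds]
    by (intro continuous_intros)
  have ci: "\<rho> integrable_on {0..s}" "(\<lambda>r. (\<rho> r)\<^sup>2) integrable_on {0..s}" if "s \<in> {0..T}" for s
    using continuous_on_subset[OF cont sub[OF that]] by (auto intro!: integrable_continuous_real continuous_intros)
  \<comment> \<open>This closes the loop: \<open>R\<close> is built from \<open>db\<close> and
    \<open>ds\<close>, which are in turn bounded by \<open>sqrt R\<close>. As \<open>\<rho>\<close>
    comes from indefinite integrals, it is continuous even if \<open>db\<close> and
    \<open>ds\<close> are not.\<close>
  have "\<rho> s \<le> w * exp ((L\<^sub>b + L\<^sub>\<sigma>\<^sup>2 / 2) * s)" if "s \<in> {0..T}" for s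
  proof (rule Gronwall_square[OF cont nn(1,2) _ that])
    fix s assume s: "s \<in> {0..T}"
    have "\<bar>integral {0..s} (\<lambda>r. exp (\<beta> * r) * db r)\<bar> \<le> integral {0..s} (\<lambda>r. L\<^sub>b * \<rho> r)"
      unfolding real_norm_def[symmetric]
    proof (rule integral_norm_bound_integral[OF dbi[OF s]])
      show "(\<lambda>r. L\<^sub>b * \<rho> r) integrable_on {0..s}" by (rule integrable_on_mult_right[OF ci(1)[OF s]])
      show "norm (exp (\<beta> * r) * db r) \<le> L\<^sub>b * \<rho> r" if "r \<in> {0..s}" for r
        using db_le[of r] that s by (auto simp: abs_mult \<rho>_def)
    qed
    then have 1: "(w + \<bar>integral {0..s} (\<lambda>r. exp (\<beta> * r) * db r)\<bar>)\<^sup>2 \<le> (w + L\<^sub>b * integral {0..s} \<rho>)\<^sup>2"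
      using nn by (intro power_mono add_left_mono) auto
    have "integral {0..s} (\<lambda>r. (exp (\<beta> * r) * ds r)\<^sup>2) \<le> integral {0..s} (\<lambda>r. L\<^sub>\<sigma>\<^sup>2 * (\<rho> r)\<^sup>2)"
    proof (rule integral_le[OF dsi[OF s]])
      show "(\<lambda>r. L\<^sub>\<sigma>\<^sup>2 * (\<rho> r)\<^sup>2) integrable_on {0..s}" by (rule integrable_on_mult_right[OF ci(2)[OF s]])
      show "(exp (\<beta> * r) * ds r)\<^sup>2 \<le> L\<^sub>\<sigma>\<^sup>2 * (\<rho> r)\<^sup>2" if "r \<in> {0..s}" for r
      proof -
        have "\<bar>exp (\<beta> * r) * ds r\<bar> \<le> L\<^sub>\<sigma> * \<rho> r" using ds_le[of r] that s by (auto simp: abs_mult \<rho>_def)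
        then have "\<bar>exp (\<beta> * r) * ds r\<bar>\<^sup>2 \<le> (L\<^sub>\<sigma> * \<rho> r)\<^sup>2" by (rule power_mono) simp
        then show ?thesis by (simp add: power_mult_distrib)
      qed
    qed
    then have 2: "integral {0..s} (\<lambda>r. (exp (\<beta> * r) * ds r)\<^sup>2) \<le> L\<^sub>\<sigma>\<^sup>2 * integral {0..s} (\<lambda>r. (\<rho> r)\<^sup>2)" by simp
    have "(\<rho> s)\<^sup>2 = R s" using R0[OF s] by (simp add: \<rho>_def)
    then show "(\<rho> s)\<^sup>2 \<le> (w + L\<^sub>b * integral {0..s} \<rho>)\<^sup>2 + L\<^sub>\<sigma>\<^sup>2 * integral {0..s} (\<lambda>r. (\<rho> r)\<^sup>2)"
      using 1 2 by (simp add: R_def)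
  qed
  from this[OF s] have "L\<^sub>b * sqrt (R s) \<le> L\<^sub>b * (w * exp ((L\<^sub>b + L\<^sub>\<sigma>\<^sup>2 / 2) * s))"
    "L\<^sub>\<sigma> * sqrt (R s) \<le> L\<^sub>\<sigma> * (w * exp ((L\<^sub>b + L\<^sub>\<sigma>\<^sup>2 / 2) * s))"
    using nn by (auto simp: \<rho>_def intro!: mult_left_mono)
  then show "exp (\<beta> * s) * \<bar>db s\<bar> \<le> L\<^sub>b * (w * exp ((L\<^sub>b + L\<^sub>\<sigma>\<^sup>2 / 2) * s))"
    and "exp (\<beta> * s) * \<bar>ds s\<bar> \<le> L\<^sub>\<sigma> * (w * exp ((L\<^sub>b + L\<^sub>\<sigma>\<^sup>2 / 2) * s))"
    using db_le[OF s] ds_le[OF s] by linarith+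
qed

section \<open>The log-Harnack inequality\<close>

lemma abs_ln_le:
  fixes x :: real
  assumes "0 < \<epsilon>" "\<epsilon> \<le> x" "x \<le> C"
  shows "\<bar>ln x\<bar> \<le> \<bar>ln \<epsilon>\<bar> + \<bar>ln C\<bar>"
proof -
  have x: "0 < x" "0 < C" using assms by auto
  have "ln \<epsilon> \<le> ln x" "ln x \<le> ln C"
    using ln_le_cancel_iff[OF assms(1) x(1)] ln_le_cancel_iff[OF x] assms by auto
  then show ?thesis by linarith
qed

text \<open>With densities \<open>p\<close> and \<open>q\<close>, integrate \<open>ln u \<le> u - 1\<close> at \<open>u = f q / (c p)\<close> against \<open>p\<close>. As \<open>c\<close> is free, it
  can later be one constant for a whole mixture, which makes Jensen's inequality unnecessary.\<close>

lemma normal_log_harnack: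
  fixes f :: "real \<Rightarrow> real"
  assumes [measurable]: "f \<in> borel_measurable borel"
    and f: "0 < \<epsilon>" "\<And>z. \<epsilon> \<le> f z" "\<And>z. f z \<le> C" and s: "0 < s1" "0 < s2" and c: "0 < c"
  shows "(\<integral>z. normal_density m1 s1 z * ln (f z) \<partial>lborel) - ln c
    \<le> (\<integral>z. normal_density m2 s2 z * f z \<partial>lborel) / c - 1
      + (s1\<^sup>2 / s2\<^sup>2 - 1 - ln (s1\<^sup>2 / s2\<^sup>2)) / 2 + (m1 - m2)\<^sup>2 / (2 * s2\<^sup>2)"
proof -
  let ?p = "normal_density m1 s1" and ?q = "normal_density m2 s2"
  define l where "l z = ln (s2 / s1) - (z - m1)\<^sup>2 / (2 * s1\<^sup>2) + (z - m2)\<^sup>2 / (2 * s2\<^sup>2)" for z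
  have pos: "0 < ?p z" "0 < ?q z" for z using s by (auto intro: normal_density_pos)
  have f0: "0 < f z" for z using f(1) f(2)[of z] by simp
  have l: "l z = ln (?p z / ?q z)" for z
  proof -
    have "?p z = exp (- (z - m1)\<^sup>2 / (2 * s1\<^sup>2)) / (sqrt (2 * pi) * s1)"
      "?q z = exp (- (z - m2)\<^sup>2 / (2 * s2\<^sup>2)) / (sqrt (2 * pi) * s2)"
      using s by (simp_all add: normal_density_def real_sqrt_mult)
    then have "ln (?p z) = - (z - m1)\<^sup>2 / (2 * s1\<^sup>2) - (ln (sqrt (2 * pi)) + ln s1)"
      "ln (?q z) = - (z - m2)\<^sup>2 / (2 * s2\<^sup>2) - (ln (sqrt (2 * pi)) + ln s2)"
      using s by (simp_all add: ln_div ln_mult)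
    then show ?thesis using s pos[of z] by (simp add: l_def ln_div)
  qed
  have point: "?p z * ln (f z) \<le> ?p z * ln c + ?q z * f z / c - ?p z + ?p z * l z" for z
  proof -
    have "ln (f z) - ln c = ln (f z * ?q z / (c * ?p z)) + ln (?p z / ?q z)"
      using pos[of z] f0[of z] c by (simp add: ln_mult ln_div)
    also have "\<dots> \<le> (f z * ?q z / (c * ?p z) - 1) + l z"
      unfolding l using pos[of z] f0[of z] c by (intro add_right_mono ln_le_minus_one) auto
    finally have "?p z * (ln (f z) - ln c) \<le> ?p z * ((f z * ?q z / (c * ?p z) - 1) + l z)"
      using pos(1)[of z] by (intro mult_left_mono) auto
    also have "\<dots> = ?q z * f z / c - ?p z + ?p z * l z"
      using pos(1)[of z] c by (simp add: field_simps)
    finally show ?thesis by (simp add: algebra_simps)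
  qed
  have moments: "has_bochner_integral lborel (\<lambda>z. ?p z * (z - m1)\<^sup>2) (s1\<^sup>2)"
    "has_bochner_integral lborel (\<lambda>z. ?p z * (z - m1)) 0" "has_bochner_integral lborel ?p 1"
    using normal_moment_even[OF s(1), of m1 1] normal_moment_odd[OF s(1), of m1 0] normal_moment_even[OF s(1), of m1 0] s
    by (simp_all add: fact_numeral)
  have lint: "has_bochner_integral lborel (\<lambda>z. ?p z * l z)
     ((s1\<^sup>2 / s2\<^sup>2 - 1 - ln (s1\<^sup>2 / s2\<^sup>2)) / 2 + (m1 - m2)\<^sup>2 / (2 * s2\<^sup>2))"
  proof -
    have hb: "has_bochner_integral lborel (\<lambda>z. (1 / (2 * s2\<^sup>2) - 1 / (2 * s1\<^sup>2)) * (?p z * (z - m1)\<^sup>2)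
        + (m1 - m2) / s2\<^sup>2 * (?p z * (z - m1)) + (ln (s2 / s1) + (m1 - m2)\<^sup>2 / (2 * s2\<^sup>2)) * ?p z)
      ((1 / (2 * s2\<^sup>2) - 1 / (2 * s1\<^sup>2)) * s1\<^sup>2 + (m1 - m2) / s2\<^sup>2 * 0 + (ln (s2 / s1) + (m1 - m2)\<^sup>2 / (2 * s2\<^sup>2)) * 1)"
      by (intro has_bochner_integral_add has_bochner_integral_mult_right moments)
    have integrand: "(1 / (2 * s2\<^sup>2) - 1 / (2 * s1\<^sup>2)) * (?p z * (z - m1)\<^sup>2)
        + (m1 - m2) / s2\<^sup>2 * (?p z * (z - m1)) + (ln (s2 / s1) + (m1 - m2)\<^sup>2 / (2 * s2\<^sup>2)) * ?p z = ?p z * l z" for z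
    proof -
      \<comment> \<open>Expanding about \<open>m1\<close>, the mean of \<open>?p\<close>, makes the
        linear term integrate to zero.\<close>
      have "(z - m2)\<^sup>2 = (z - m1)\<^sup>2 + 2 * ((m1 - m2) * (z - m1)) + (m1 - m2)\<^sup>2"
        by (simp add: power2_eq_square algebra_simps)
      then have lz: "l z = ln (s2 / s1) - (z - m1)\<^sup>2 / (2 * s1\<^sup>2) + (z - m1)\<^sup>2 / (2 * s2\<^sup>2)
          + (m1 - m2) * (z - m1) / s2\<^sup>2 + (m1 - m2)\<^sup>2 / (2 * s2\<^sup>2)"
        by (simp add: l_def add_divide_distrib)
      have "(1 / a - 1 / b) * (P * x) + d / c * (P * y) + (q + e) * P = P * (q - x / b + x / a + d * y / c + e)"
        for a b c d e P q x y :: real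
        by (simp add: algebra_simps)
      then show ?thesis unfolding lz .
    qed
    have "(1 / (2 * s2\<^sup>2) - 1 / (2 * s1\<^sup>2)) * s1\<^sup>2 + (m1 - m2) / s2\<^sup>2 * 0 + (ln (s2 / s1) + (m1 - m2)\<^sup>2 / (2 * s2\<^sup>2)) * 1
        = (s1\<^sup>2 / s2\<^sup>2 - 1 - ln (s1\<^sup>2 / s2\<^sup>2)) / 2 + (m1 - m2)\<^sup>2 / (2 * s2\<^sup>2)"
      using s by (simp add: ln_div ln_realpow field_simps)
    with hb show ?thesis unfolding integrand by (simp only:)
  qed
  have pi: "integrable lborel ?p" "integrable lborel ?q" using s by (auto intro: integrable_normal_density)
  have qf: "integrable lborel (\<lambda>z. ?q z * f z)"
  proof (rule Bochner_Integration.integrable_bound[OF integrable_mult_right[OF pi(2), of C]])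
    show "AE z in lborel. norm (?q z * f z) \<le> norm (C * ?q z)"
    proof (rule AE_I2)
      fix z
      have "?q z * f z \<le> ?q z * C" using f(3)[of z] pos(2)[of z] by (intro mult_left_mono) auto
      moreover have "0 \<le> ?q z * f z" using f0[of z] pos(2)[of z] by simp
      ultimately show "norm (?q z * f z) \<le> norm (C * ?q z)" by (simp add: mult.commute)
    qed
  qed measurable
  have pf: "integrable lborel (\<lambda>z. ?p z * ln (f z))"
  proof (rule Bochner_Integration.integrable_bound[OF integrable_mult_right[OF pi(1), of "\<bar>ln \<epsilon>\<bar> + \<bar>ln C\<bar>"]])
    show "AE z in lborel. norm (?p z * ln (f z)) \<le> norm ((\<bar>ln \<epsilon>\<bar> + \<bar>ln C\<bar>) * ?p z)"
    proof (rule AE_I2)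
      fix z
      note abs_ln_le[OF f(1) f(2)[of z] f(3)[of z]]
      then show "norm (?p z * ln (f z)) \<le> norm ((\<bar>ln \<epsilon>\<bar> + \<bar>ln C\<bar>) * ?p z)"
        using pos(1)[of z] by (simp add: abs_mult mult.commute mult_right_mono)
    qed
  qed measurable
  have "(\<integral>z. ?p z * ln (f z) \<partial>lborel) \<le> (\<integral>z. ?p z * ln c + ?q z * f z / c - ?p z + ?p z * l z \<partial>lborel)"
    using pf pi qf lint by (intro integral_mono point) (auto simp: has_bochner_integral_iff)
  also have "\<dots> = (\<integral>z. ?p z \<partial>lborel) * ln c + (\<integral>z. ?q z * f z \<partial>lborel) / c - (\<integral>z. ?p z \<partial>lborel) + (\<integral>z. ?p z * l z \<partial>lborel)"
    using pi qf lint by (simp add: has_bochner_integral_iff)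
  finally show ?thesis using moments(3) lint by (simp add: has_bochner_integral_iff)
qed

text \<open>With \<open>h\<close> one of the projections of a coupling, the integrals against both
  time-\<open>t\<close> laws become integrals over the same space of pairs, so a bound for pairs of
  normal laws can be integrated. The scaling \<open>a\<close> stays in the argument of
  \<open>\<phi>\<close>, which leaves the normal kernels unscaled.\<close>

lemma integral_gaussian_shift:
  fixes \<phi> :: "real \<Rightarrow> real" and \<rho> :: "'a measure"
  assumes \<rho>: "prob_space \<rho>" and h[measurable]: "h \<in> borel_measurable \<rho>" and \<mu>\<^sub>0: "distr \<rho> borel h = \<mu>\<^sub>0"
    and \<mu>: "\<mu> = distr (\<mu>\<^sub>0 \<Otimes>\<^sub>M std_normal_distribution) borel (\<lambda>(x, g). a * (x + D + s * g))"
    and s: "0 < s" and \<phi>[measurable]: "\<phi> \<in> borel_measurable borel" and C: "\<And>z. \<bar>\<phi> z\<bar> \<le> C"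
  shows "integrable \<rho> (\<lambda>p. \<integral>z. normal_density (h p + D) s z * \<phi> (a * z) \<partial>lborel)"
    and "(\<integral>z. \<phi> z \<partial>\<mu>) = (\<integral>p. (\<integral>z. normal_density (h p + D) s z * \<phi> (a * z) \<partial>lborel) \<partial>\<rho>)"
proof -
  let ?N = std_normal_distribution
  interpret \<rho>: prob_space \<rho> by fact
  interpret \<mu>\<^sub>0: prob_space \<mu>\<^sub>0 unfolding \<mu>\<^sub>0[symmetric] by (rule \<rho>.prob_space_distr) measurable
  interpret N: real_distribution ?N by (rule real_dist_normal_dist)
  interpret P: pair_prob_space \<mu>\<^sub>0 ?N ..
  have sets[measurable_cong]: "sets \<mu>\<^sub>0 = sets borel" unfolding \<mu>\<^sub>0[symmetric] by simp
  let ?F = "\<lambda>x. \<integral>z. normal_density (x + D) s z * \<phi> (a * z) \<partial>lborel"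
  have inner: "(\<integral>g. \<phi> (a * (x + D + s * g)) \<partial>?N) = ?F x" for x
  proof -
    have "?F x = \<bar>s\<bar> * (\<integral>g. normal_density (x + D) s ((x + D) + s * g) * \<phi> (a * ((x + D) + s * g)) \<partial>lborel)"
      using lborel_integral_real_affine[of s "\<lambda>z. normal_density (x + D) s z * \<phi> (a * z)" "x + D"] s by simp
    also have "\<dots> = (\<integral>g. std_normal_density g * \<phi> (a * (x + D + s * g)) \<partial>lborel)"
    proof -
      have "\<bar>s\<bar> * (normal_density (x + D) s ((x + D) + s * g) * y) = std_normal_density g * y" for g y
        using s by (simp add: normal_density_def real_sqrt_mult power_mult_distrib)
      then show ?thesis by (subst integral_mult_right_zero[symmetric]) (simp only:)
    qed
    also have "\<dots> = (\<integral>g. \<phi> (a * (x + D + s * g)) \<partial>?N)"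
      by (subst integral_density) (auto simp: normal_density_nonneg)
    finally show ?thesis by simp
  qed
  have int: "integrable (\<mu>\<^sub>0 \<Otimes>\<^sub>M ?N) (\<lambda>p. \<phi> (a * (fst p + D + s * snd p)))"
    using C by (intro P.integrable_const_bound[of _ C]) auto
  have "(\<integral>z. \<phi> z \<partial>\<mu>) = (\<integral>p. \<phi> (a * (fst p + D + s * snd p)) \<partial>(\<mu>\<^sub>0 \<Otimes>\<^sub>M ?N))"
    unfolding \<mu> by (subst integral_distr) (auto simp: split_beta')
  also have "\<dots> = (\<integral>x. ?F x \<partial>\<mu>\<^sub>0)"
    using P.integral_fst'[OF int] by (simp add: inner)
  finally have 1: "(\<integral>z. \<phi> z \<partial>\<mu>) = (\<integral>x. ?F x \<partial>\<mu>\<^sub>0)" .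
  have 2: "integrable \<mu>\<^sub>0 ?F" using P.integrable_fst'[OF int] by (simp add: inner)
  then have "?F \<in> borel_measurable \<mu>\<^sub>0" by (rule borel_measurable_integrable)
  then have Fm: "?F \<in> borel_measurable borel" by (simp add: measurable_cong_sets[OF sets refl])
  show "integrable \<rho> (\<lambda>p. ?F (h p))"
    using 2 unfolding \<mu>\<^sub>0[symmetric] by (subst (asm) integrable_distr_eq[OF h Fm])
  show "(\<integral>z. \<phi> z \<partial>\<mu>) = (\<integral>p. ?F (h p) \<partial>\<rho>)"
    unfolding 1 unfolding \<mu>\<^sub>0[symmetric] by (rule integral_distr[OF h Fm])
qed

text \<open>With \<open>c\<close> equal to the integral of \<open>f\<close> against
  \<open>\<nu>\<close>, the terms \<open>B p / c\<close> average to 1 and cancel the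
  \<open>- 1\<close>. The variance contribution \<open>r\<close> is the same for every pair of
  starting points; only the difference of the means varies, and it is averaged over the
  coupling.\<close>

lemma gaussian_mixture_log_harnack:
  fixes f :: "real \<Rightarrow> real"
  assumes \<pi>: "\<pi> \<in> couplings \<mu>\<^sub>0 \<nu>\<^sub>0" and P2: "\<mu>\<^sub>0 \<in> \<P>\<^sub>2" "\<nu>\<^sub>0 \<in> \<P>\<^sub>2"
    and \<mu>: "\<mu> = distr (\<mu>\<^sub>0 \<Otimes>\<^sub>M std_normal_distribution) borel (\<lambda>(x, g). a * (x + D1 + s1 * g))"
    and \<nu>: "\<nu> = distr (\<nu>\<^sub>0 \<Otimes>\<^sub>M std_normal_distribution) borel (\<lambda>(x, g). a * (x + D2 + s2 * g))"
    and s: "0 < s1" "0 < s2"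
    and f[measurable]: "f \<in> borel_measurable borel" and e: "0 < \<epsilon>" "\<And>z. \<epsilon> \<le> f z" "\<And>z. f z \<le> C"
  shows "(\<integral>z. ln (f z) \<partial>\<mu>) \<le> ln (\<integral>z. f z \<partial>\<nu>) + (s1\<^sup>2 / s2\<^sup>2 - 1 - ln (s1\<^sup>2 / s2\<^sup>2)) / 2
      + (sqrt (\<integral>p. (fst p - snd p)\<^sup>2 \<partial>\<pi>) + \<bar>D1 - D2\<bar>)\<^sup>2 / (2 * s2\<^sup>2)"
proof -
  note cp = couplingD[OF \<pi> P2]
  interpret \<pi>: prob_space \<pi> by (rule cp(1))
  note [measurable_cong] = cp(2)
  have lnb: "\<bar>ln (f z)\<bar> \<le> \<bar>ln \<epsilon>\<bar> + \<bar>ln C\<bar>" for z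
    by (rule abs_ln_le[OF e(1) e(2) e(3)])
  have fb: "\<bar>f z\<bar> \<le> C" for z using e(1) e(2)[of z] e(3)[of z] by simp
  define A where "A p = (\<integral>z. normal_density (fst p + D1) s1 z * ln (f (a * z)) \<partial>lborel)" for p :: "real \<times> real"
  define B where "B p = (\<integral>z. normal_density (snd p + D2) s2 z * f (a * z) \<partial>lborel)" for p :: "real \<times> real"
  have A: "integrable \<pi> A" "(\<integral>z. ln (f z) \<partial>\<mu>) = (\<integral>p. A p \<partial>\<pi>)"
    using integral_gaussian_shift[OF cp(1) _ cp(3) \<mu> s(1), where \<phi>="\<lambda>z. ln (f z)", OF _ _ lnb]
    unfolding A_def[abs_def] by simp_all
  have B: "integrable \<pi> B" "(\<integral>z. f z \<partial>\<nu>) = (\<integral>p. B p \<partial>\<pi>)"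
    using integral_gaussian_shift[OF cp(1) _ cp(4) \<nu> s(2) f fb] unfolding B_def[abs_def] by simp_all
  define c where "c = (\<integral>z. f z \<partial>\<nu>)"
  define d where "d = D1 - D2"
  define r where "r = (s1\<^sup>2 / s2\<^sup>2 - 1 - ln (s1\<^sup>2 / s2\<^sup>2)) / 2"
  have c: "0 < c"
  proof -
    interpret \<mu>\<^sub>0: prob_space \<nu>\<^sub>0 using prob_measures2D(1)[OF P2(2)] .
    interpret N: real_distribution std_normal_distribution by (rule real_dist_normal_dist)
    interpret P: pair_prob_space \<nu>\<^sub>0 std_normal_distribution ..
    note [measurable_cong] = prob_measures2D(2)[OF P2(2)]
    interpret \<nu>: prob_space \<nu> unfolding \<nu> by (rule P.prob_space_distr) measurable
    have m: "f \<in> borel_measurable \<nu>" unfolding \<nu> by simp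
    have "\<epsilon> = (\<integral>z. \<epsilon> \<partial>\<nu>)" by (simp add: \<nu>.prob_space)
    also have "\<dots> \<le> c" unfolding c_def using e fb order_trans[OF e(2)[of 0] e(3)[of 0]]
      by (intro integral_mono \<nu>.integrable_const_bound[of _ C] m) auto
    finally show ?thesis using e(1) by simp
  qed
  have point: "A p \<le> ln c + B p / c - 1 + r + ((fst p - snd p) + d)\<^sup>2 / (2 * s2\<^sup>2)" for p
    using normal_log_harnack[of "\<lambda>z. f (a * z)" \<epsilon> C s1 s2 c "fst p + D1" "snd p + D2"] e s c
    by (simp add: A_def B_def r_def d_def algebra_simps)
  have q2: "integrable \<pi> (\<lambda>p. ((fst p - snd p) + d)\<^sup>2)"
    using integrable_power2_diff[of "\<lambda>p. fst p - snd p" \<pi> "\<lambda>_. - d"] cp(5) by simp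
  have "(\<integral>z. ln (f z) \<partial>\<mu>) \<le> (\<integral>p. ln c + B p / c - 1 + r + ((fst p - snd p) + d)\<^sup>2 / (2 * s2\<^sup>2) \<partial>\<pi>)"
    unfolding A(2) using A(1) B(1) q2 by (intro integral_mono point) auto
  also have "\<dots> = ln c + (\<integral>p. B p \<partial>\<pi>) / c - 1 + r + (\<integral>p. ((fst p - snd p) + d)\<^sup>2 \<partial>\<pi>) / (2 * s2\<^sup>2)"
    using B(1) q2 by (simp add: \<pi>.prob_space)
  also have "\<dots> = ln c + r + (\<integral>p. ((fst p - snd p) + d)\<^sup>2 \<partial>\<pi>) / (2 * s2\<^sup>2)"
    using c B(2) by (simp add: c_def)
  also have "\<dots> \<le> ln c + r + (sqrt (\<integral>p. (fst p - snd p)\<^sup>2 \<partial>\<pi>) + \<bar>d\<bar>)\<^sup>2 / (2 * s2\<^sup>2)"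
    using cp(5) by (intro add_left_mono divide_right_mono \<pi>.integral_power2_shift_le) auto
  finally show ?thesis unfolding c_def r_def d_def .
qed

section \<open>The constant in the inequality\<close>

lemma integral_exp_ratio:
  assumes "0 \<le> t"
  shows "((\<lambda>s. exp (c * s)) has_integral exp_ratio c t) {0..t}"
proof (cases "c = 0")
  case True
  then show ?thesis using has_integral_const_real[of "1::real" 0 t] assms by (simp add: exp_ratio_def)
next
  case False
  have "((\<lambda>s. exp (c * s)) has_integral exp (c * t) / c - exp (c * 0) / c) {0..t}"
    using assms False by (intro fundamental_theorem_of_calculus)
      (auto intro!: derivative_eq_intros simp: has_real_derivative_iff_has_vector_derivative[symmetric])
  then show ?thesis using False by (simp add: exp_ratio_def diff_divide_distrib)
qed

lemma exp_ratio_pos: "0 < t \<Longrightarrow> 0 < exp_ratio c t"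
  by (auto simp: exp_ratio_def zero_less_divide_iff mult_less_0_iff zero_less_mult_iff)

lemma exp_ratio_minus: "exp_ratio (- c) t = exp (- c * t) * exp_ratio c t"
  by (auto simp: exp_ratio_def field_simps exp_minus)

lemma harnack_Sigma_nonneg:
  assumes "0 < t" "1 \<le> K"
  shows "0 \<le> harnack_Sigma \<beta> K L\<^sub>b L\<^sub>\<sigma> t"
  unfolding harnack_Sigma_def using assms exp_ratio_pos[OF assms(1), of "2 * \<beta>"] exp_ratio_pos[OF assms(1), of "- 2 * \<beta>"]
  by (intro add_nonneg_nonneg mult_nonneg_nonneg divide_nonneg_nonneg) (auto simp: power_int_def)

text \<open>For the mean part, \<open>(w + \<bar>d\<bar>)\<^sup>2 \<le> 2 * (w\<^sup>2 +
  d\<^sup>2)\<close> and \<open>V2 \<ge> E / K\<close> yield the first two terms of the constant. In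
  the variance part \<open>K ^ 3\<close> arises as \<open>K\<^sup>2\<close> from the lower bound
  \<open>E / K\<close> on both variances, times \<open>K\<close> from squaring the factor
  \<open>sqrt K\<close> in \<open>VV\<close>.\<close>

lemma harnack_Sigma_bound:
  assumes t: "0 < t" and K: "1 \<le> K" and w: "0 \<le> w"
    and V: "exp_ratio (2 * \<beta>) t / K \<le> V1" "exp_ratio (2 * \<beta>) t / K \<le> V2"
    and D: "\<bar>d\<bar> \<le> L\<^sub>b * (w * exp_ratio (L\<^sub>b + L\<^sub>\<sigma>\<^sup>2 / 2) t)"
    and VV: "\<bar>V1 - V2\<bar> \<le> 2 * sqrt K * (L\<^sub>\<sigma> * (w * exp_ratio (\<beta> + L\<^sub>b + L\<^sub>\<sigma>\<^sup>2 / 2) t))"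
  shows "(V1 / V2 - 1 - ln (V1 / V2)) / 2 + (w + \<bar>d\<bar>)\<^sup>2 / (2 * V2) \<le> harnack_Sigma \<beta> K L\<^sub>b L\<^sub>\<sigma> t * w\<^sup>2"
proof -
  define E where "E = exp_ratio (2 * \<beta>) t"
  define E1 where "E1 = exp_ratio (L\<^sub>b + L\<^sub>\<sigma>\<^sup>2 / 2) t"
  define E2 where "E2 = exp_ratio (\<beta> + L\<^sub>b + L\<^sub>\<sigma>\<^sup>2 / 2) t"
  have E: "0 < E" unfolding E_def by (rule exp_ratio_pos[OF t])
  have m: "0 < E / K" using E K by simp
  have V2: "0 < V2" using m V by (simp add: E_def)
  have "(w + \<bar>d\<bar>)\<^sup>2 \<le> 2 * (w\<^sup>2 + d\<^sup>2)"
    using sum_squares_bound[of w "\<bar>d\<bar>"] by (simp add: power2_sum)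
  then have "(w + \<bar>d\<bar>)\<^sup>2 / (2 * V2) \<le> 2 * (w\<^sup>2 + d\<^sup>2) / (2 * V2)" using V2 by (intro divide_right_mono) auto
  also have "\<dots> = (w\<^sup>2 + d\<^sup>2) / V2" by (rule mult_divide_mult_cancel_left) simp
  also have "\<dots> \<le> (w\<^sup>2 + d\<^sup>2) / (E / K)" using V(2) mult_pos_pos[OF V2 m]
    by (intro divide_left_mono) (auto simp: E_def)
  also have "\<dots> = K / E * (w\<^sup>2 + d\<^sup>2)" by simp
  also have "\<dots> \<le> K / E * (w\<^sup>2 + (L\<^sub>b * (w * E1))\<^sup>2)"
  proof -
    have "\<bar>d\<bar>\<^sup>2 \<le> (L\<^sub>b * (w * E1))\<^sup>2" using D unfolding E1_def by (rule power_mono) simp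
    then show ?thesis using E K by (intro mult_left_mono) auto
  qed
  finally have 1: "(w + \<bar>d\<bar>)\<^sup>2 / (2 * V2) \<le> (K / E + K / E * L\<^sub>b\<^sup>2 * E1\<^sup>2) * w\<^sup>2"
    by (simp add: power_mult_distrib algebra_simps)
  have "(V1 / V2 - 1 - ln (V1 / V2)) / 2 \<le> (V1 - V2)\<^sup>2 / (2 * (E / K)\<^sup>2) / 2"
    using ratio_entropy_le[OF m] V by (intro divide_right_mono) (auto simp: E_def)
  also have "\<dots> = (V1 - V2)\<^sup>2 * (K\<^sup>2 / (4 * E\<^sup>2))" using E K by (simp add: field_simps power2_eq_square)
  also have "\<dots> \<le> (2 * sqrt K * (L\<^sub>\<sigma> * (w * E2)))\<^sup>2 * (K\<^sup>2 / (4 * E\<^sup>2))"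
  proof -
    have "\<bar>V1 - V2\<bar>\<^sup>2 \<le> (2 * sqrt K * (L\<^sub>\<sigma> * (w * E2)))\<^sup>2" using VV unfolding E2_def by (rule power_mono) simp
    then show ?thesis by (intro mult_right_mono) auto
  qed
  also have "\<dots> = K ^ 3 * L\<^sub>\<sigma>\<^sup>2 * E2\<^sup>2 / E\<^sup>2 * w\<^sup>2"
    using K E by (simp add: power_mult_distrib power3_eq_cube power2_eq_square)
  \<comment> \<open>Since \<open>K \<ge> 1\<close>, the factor \<open>(K + 1) / 2\<close> is at
    least 1 and only enlarges the entropy bound to the required form.\<close>
  also have "\<dots> \<le> (K + 1) / 2 * (K ^ 3 * L\<^sub>\<sigma>\<^sup>2 * E2\<^sup>2 / E\<^sup>2 * w\<^sup>2)"
    using mult_right_mono[of 1 "(K + 1) / 2" "K ^ 3 * L\<^sub>\<sigma>\<^sup>2 * E2\<^sup>2 / E\<^sup>2 * w\<^sup>2"] K by simp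
  finally have 2: "(V1 / V2 - 1 - ln (V1 / V2)) / 2 \<le> (K + 1) / 2 * (K ^ 3 * L\<^sub>\<sigma>\<^sup>2 * E2\<^sup>2 / E\<^sup>2 * w\<^sup>2)" .
  \<comment> \<open>\<open>exp_ratio (- 2 * \<beta>) t\<close> is
    \<open>exp (- 2 * \<beta> * t) * E\<close>, and \<open>exp (- 4 * \<beta> * t)\<close> undoes
    the square of that exponential. What remains of the prefactor is
    \<open>1 / E\<^sup>2\<close>.\<close>
  have "exp (- 4 * \<beta> * t) = (exp (- 2 * \<beta> * t))\<^sup>2"
    by (simp add: exp_double[symmetric])
  moreover have "exp_ratio (- 2 * \<beta>) t = exp (- 2 * \<beta> * t) * E"
    using exp_ratio_minus[of "2 * \<beta>" t] by (simp add: E_def)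
  ultimately have "(exp_ratio (- 2 * \<beta>) t) powi (- 2) * exp (- 4 * \<beta> * t) = 1 / E\<^sup>2"
    using E by (simp add: power_int_minus power_mult_distrib field_simps)
  note scale = this
  have "(K + 1) / 2 * (exp_ratio (- 2 * \<beta>) t) powi (- 2) * K ^ 3 * L\<^sub>\<sigma>\<^sup>2 * exp (- 4 * \<beta> * t) * E2\<^sup>2
      = (K + 1) / 2 * (K ^ 3 * L\<^sub>\<sigma>\<^sup>2 * E2\<^sup>2 * ((exp_ratio (- 2 * \<beta>) t) powi (- 2) * exp (- 4 * \<beta> * t)))"
    by (simp only: mult_ac)
  also have "\<dots> = (K + 1) / 2 * (K ^ 3 * L\<^sub>\<sigma>\<^sup>2 * E2\<^sup>2 / E\<^sup>2)" unfolding scale by simp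
  finally have "(K + 1) / 2 * (exp_ratio (- 2 * \<beta>) t) powi (- 2) * K ^ 3 * L\<^sub>\<sigma>\<^sup>2 * exp (- 4 * \<beta> * t) * E2\<^sup>2
      = (K + 1) / 2 * (K ^ 3 * L\<^sub>\<sigma>\<^sup>2 * E2\<^sup>2 / E\<^sup>2)" .
  then have \<Sigma>: "harnack_Sigma \<beta> K L\<^sub>b L\<^sub>\<sigma> t = (K / E + K / E * L\<^sub>b\<^sup>2 * E1\<^sup>2) + (K + 1) / 2 * (K ^ 3 * L\<^sub>\<sigma>\<^sup>2 * E2\<^sup>2 / E\<^sup>2)"
    unfolding harnack_Sigma_def E_def E1_def E2_def by simp
  have "(x + q * z) * v = x * v + q * (z * v)" for x q z v :: real by (simp add: distrib_right)
  with 1 2 show ?thesis unfolding \<Sigma> by (simp only: add_mono add.commute)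
qed

section \<open>Comparison of two solutions for a fixed initial coupling\<close>

lemma set_integrable_bounded:
  fixes g :: "real \<Rightarrow> real"
  assumes "(\<lambda>r. indicator {a..b} r * g r) \<in> borel_measurable borel" "\<And>r. r \<in> {a..b} \<Longrightarrow> \<bar>g r\<bar> \<le> c"
  shows "set_integrable lborel {a..b} g"
  unfolding set_integrable_def
proof (rule Bochner_Integration.integrable_bound)
  show "integrable lborel (\<lambda>r. c * indicator {a..b} r)" by (cases "a \<le> b") auto
  show "(\<lambda>r. indicator {a..b} r *\<^sub>R g r) \<in> borel_measurable lborel" using assms(1) by simp
  show "AE r in lborel. norm (indicator {a..b} r *\<^sub>R g r) \<le> norm (c * indicator {a..b} r)"
    using assms(2) by (intro AE_I2) (auto split: split_indicator intro: order_trans[OF _ abs_ge_self])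
qed

text \<open>A bridge between two integrals: the laws and the Gronwall argument are phrased with the
  gauge integral over \<open>[a, b]\<close>, the reverse triangle inequality with the Lebesgue
  integral.\<close>

lemma integral_eq_lborel_power2:
  fixes g :: "real \<Rightarrow> real"
  assumes "(\<lambda>r. indicator {a..b} r * g r) \<in> borel_measurable borel" "\<And>r. r \<in> {a..b} \<Longrightarrow> \<bar>g r\<bar> \<le> c"
  shows "integrable lborel (\<lambda>r. (indicator {a..b} r * g r)\<^sup>2)"
    and "integral {a..b} (\<lambda>r. (g r)\<^sup>2) = (\<integral>r. (indicator {a..b} r * g r)\<^sup>2 \<partial>lborel)"
    and "(\<lambda>r. (g r)\<^sup>2) integrable_on {a..b}"
proof -
  have eq: "(indicator {a..b} r * g r)\<^sup>2 = indicator {a..b} r * (g r)\<^sup>2" for r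
    by (simp split: split_indicator)
  have "(\<lambda>r. (indicator {a..b} r * g r)\<^sup>2) \<in> borel_measurable borel"
    using assms(1) by (rule borel_measurable_power)
  then have si: "set_integrable lborel {a..b} (\<lambda>r. (g r)\<^sup>2)"
    unfolding eq
  proof (rule set_integrable_bounded)
    show "\<bar>(g r)\<^sup>2\<bar> \<le> c\<^sup>2" if "r \<in> {a..b}" for r
      using power_mono[OF assms(2)[OF that], of 2] by simp
  qed
  then show "integrable lborel (\<lambda>r. (indicator {a..b} r * g r)\<^sup>2)"
    unfolding eq by (simp add: set_integrable_def)
  show "integral {a..b} (\<lambda>r. (g r)\<^sup>2) = (\<integral>r. (indicator {a..b} r * g r)\<^sup>2 \<partial>lborel)"
    unfolding eq using set_borel_integral_eq_integral(2)[OF si] by (simp add: set_lebesgue_integral_def)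
  show "(\<lambda>r. (g r)\<^sup>2) integrable_on {a..b}"
    by (rule set_borel_integral_eq_integral(1)[OF si])
qed

text \<open>Every estimate starts from the cost \<open>w\<close> of the given coupling instead of
  the Wasserstein distance. The result is therefore available for each \<open>\<pi>\<close>, and the
  infimum can be taken at the very end, with no optimal coupling at hand.\<close>

lemma sde_log_harnack_coupling:
  fixes b \<sigma> :: "real measure \<Rightarrow> real" and f :: "real \<Rightarrow> real"
    and X :: "real \<Rightarrow> 'a \<Rightarrow> real" and Y :: "real \<Rightarrow> 'b \<Rightarrow> real"
  assumes L: "0 \<le> L\<^sub>b" "0 \<le> L\<^sub>\<sigma>" and K: "1 \<le> K"
    and b: "\<And>\<mu> \<nu>. \<mu> \<in> \<P>\<^sub>2 \<Longrightarrow> \<nu> \<in> \<P>\<^sub>2 \<Longrightarrow> \<bar>b \<mu> - b \<nu>\<bar> \<le> L\<^sub>b * \<W>\<^sub>2 \<mu> \<nu>"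
    and \<sigma>: "\<And>\<mu> \<nu>. \<mu> \<in> \<P>\<^sub>2 \<Longrightarrow> \<nu> \<in> \<P>\<^sub>2 \<Longrightarrow> \<bar>\<sigma> \<mu> - \<sigma> \<nu>\<bar> \<le> L\<^sub>\<sigma> * \<W>\<^sub>2 \<mu> \<nu>"
    and \<sigma>K: "\<And>\<mu>. \<mu> \<in> \<P>\<^sub>2 \<Longrightarrow> inverse K \<le> (\<sigma> \<mu>)\<^sup>2 \<and> (\<sigma> \<mu>)\<^sup>2 \<le> K"
    and P2: "\<mu>\<^sub>0 \<in> \<P>\<^sub>2" "\<nu>\<^sub>0 \<in> \<P>\<^sub>2"
    and X: "solves_sde \<gamma> \<beta> b \<sigma> \<mu>\<^sub>0 M F W X" and Y: "solves_sde \<gamma> \<beta> b \<sigma> \<nu>\<^sub>0 N G V Y"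
    and f: "f \<in> borel_measurable borel" "0 < \<epsilon>" "\<And>z. \<epsilon> \<le> f z" "\<And>z. f z \<le> C"
    and t: "0 < t" and \<pi>: "\<pi> \<in> couplings \<mu>\<^sub>0 \<nu>\<^sub>0"
  shows "(\<integral>x. ln (f x) \<partial>law M (X t)) \<le> ln (\<integral>x. f x \<partial>law N (Y t))
    + harnack_Sigma \<beta> K L\<^sub>b L\<^sub>\<sigma> t * (\<integral>p. (fst p - snd p)\<^sup>2 \<partial>\<pi>)"
proof -
  define B1 where "B1 s = b (law M (X s))" for s
  define B2 where "B2 s = b (law N (Y s))" for s
  define S1 where "S1 s = \<sigma> (law M (X s))" for s
  define S2 where "S2 s = \<sigma> (law N (Y s))" for s
  have \<sigma>K': "(\<sigma> \<mu>)\<^sup>2 \<le> K" if "\<mu> \<in> \<P>\<^sub>2" for \<mu> using \<sigma>K[OF that] by simp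
  note Xl = sde_law[OF X \<sigma>K', folded B1_def S1_def]
  note Yl = sde_law[OF Y \<sigma>K', folded B2_def S2_def]
  have lawX: "law M (X s) \<in> \<P>\<^sub>2" and lawY: "law N (Y s) \<in> \<P>\<^sub>2" if "0 \<le> s" for s
    using X Y that by (auto simp: solves_sde_def)
  define D1 where "D1 s = integral {0..s} (\<lambda>r. exp (\<beta> * r) * (\<gamma> + B1 r))" for s
  define D2 where "D2 s = integral {0..s} (\<lambda>r. exp (\<beta> * r) * (\<gamma> + B2 r))" for s
  define V1 where "V1 s = integral {0..s} (\<lambda>r. (exp (\<beta> * r) * S1 r)\<^sup>2)" for s
  define V2 where "V2 s = integral {0..s} (\<lambda>r. (exp (\<beta> * r) * S2 r)\<^sup>2)" for s
  have X3: "law M (X s) = distr (\<mu>\<^sub>0 \<Otimes>\<^sub>M std_normal_distribution) borel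
      (\<lambda>(x, g). exp (- \<beta> * s) * (x + D1 s + sqrt (V1 s) * g))" if "0 \<le> s" for s
    unfolding D1_def V1_def using Xl(3)[OF _ that] by blast
  have Y3: "law N (Y s) = distr (\<nu>\<^sub>0 \<Otimes>\<^sub>M std_normal_distribution) borel
      (\<lambda>(x, g). exp (- \<beta> * s) * (x + D2 s + sqrt (V2 s) * g))" if "0 \<le> s" for s
    unfolding D2_def V2_def using Yl(3)[OF _ that] by blast
  define w where "w = sqrt (\<integral>p. (fst p - snd p)\<^sup>2 \<partial>\<pi>)"
  define db where "db s = B1 s - B2 s" for s
  define ds where "ds s = S1 s - S2 s" for s
  define c where "c = L\<^sub>b + L\<^sub>\<sigma>\<^sup>2 / 2"
  have w: "0 \<le> w" by (simp add: w_def)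
  have S_K: "\<bar>S1 r\<bar> \<le> sqrt K" "\<bar>S2 r\<bar> \<le> sqrt K" if "0 \<le> r" for r
    using \<sigma>K'[OF lawX[OF that]] \<sigma>K'[OF lawY[OF that]] by (auto simp: S1_def S2_def intro: real_le_rsqrt)
  have S_K': "1 / K \<le> (S1 r)\<^sup>2" "1 / K \<le> (S2 r)\<^sup>2" if "0 \<le> r" for r
    using \<sigma>K[OF lawX[OF that]] \<sigma>K[OF lawY[OF that]] by (auto simp: S1_def S2_def inverse_eq_divide)
  have cexp: "continuous_on A (\<lambda>r. exp (\<beta> * r))" for A by (intro continuous_intros)
  have drift: "(\<lambda>r. exp (\<beta> * r) * (\<gamma> + g r)) integrable_on {0..s}" if "g absolutely_integrable_on {0..s}" for g s
  proof -
    have "(\<lambda>r. \<gamma>) absolutely_integrable_on {0..s}" by (intro absolutely_integrable_continuous_real continuous_intros)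
    from abs_integrable_continuous_mult[OF cexp set_integral_add(1)[OF this that]]
    show ?thesis by (simp add: absolutely_integrable_on_def)
  qed
  have db_int: "(\<lambda>r. exp (\<beta> * r) * db r) integrable_on {0..s}"
    and D_diff: "D1 s - D2 s = integral {0..s} (\<lambda>r. exp (\<beta> * r) * db r)" if "0 \<le> s" for s
  proof -
    have eq: "exp (\<beta> * r) * db r = exp (\<beta> * r) * (\<gamma> + B1 r) - exp (\<beta> * r) * (\<gamma> + B2 r)" for r
      by (simp add: db_def algebra_simps)
    note i = drift[OF Xl(1)[OF _ that]] drift[OF Yl(1)[OF _ that]]
    show "(\<lambda>r. exp (\<beta> * r) * db r) integrable_on {0..s}" unfolding eq by (intro integrable_diff i)
    show "D1 s - D2 s = integral {0..s} (\<lambda>r. exp (\<beta> * r) * db r)"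
      unfolding eq D1_def D2_def by (rule Henstock_Kurzweil_Integration.integral_diff[symmetric]) (rule i, assumption)+
  qed
  \<comment> \<open>The absolute value of \<beta> makes one bound on \<open>[0, s]\<close> valid for
    both signs of \<beta>.\<close>
  have bd: "\<bar>exp (\<beta> * r) * g r\<bar> \<le> exp (\<bar>\<beta>\<bar> * s) * c'" if "\<bar>g r\<bar> \<le> c'" "r \<in> {0..s}" for g :: "real \<Rightarrow> real" and r s c'
  proof -
    have "\<beta> * r \<le> \<bar>\<beta>\<bar> * s" using that by (intro mult_mono) auto
    then show ?thesis using that by (simp add: abs_mult mult_mono)
  qed
  have meas: "(\<lambda>r. indicator {0..s} r * (exp (\<beta> * r) * g r)) \<in> borel_measurable borel"
    if g: "(\<lambda>r. indicator {0..s} r * g r) \<in> borel_measurable borel" for g :: "real \<Rightarrow> real" and s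
  proof -
    have "(\<lambda>r. exp (\<beta> * r) * (indicator {0..s} r * g r)) \<in> borel_measurable borel" using g by measurable
    then show ?thesis by (simp add: mult.left_commute)
  qed
  have ds_meas: "(\<lambda>r. indicator {0..s} r * ds r) \<in> borel_measurable borel" if "0 \<le> s" for s
    using Xl(2)[OF _ that] Yl(2)[OF _ that] unfolding ds_def right_diff_distrib by (intro borel_measurable_diff)
  have ds_K: "\<bar>ds r\<bar> \<le> 2 * sqrt K" if "0 \<le> r" for r
    using S_K[OF that] by (simp add: ds_def)
  have sq: "integrable lborel (\<lambda>r. (indicator {0..s} r * (exp (\<beta> * r) * g r))\<^sup>2)"
      "integral {0..s} (\<lambda>r. (exp (\<beta> * r) * g r)\<^sup>2) = (\<integral>r. (indicator {0..s} r * (exp (\<beta> * r) * g r))\<^sup>2 \<partial>lborel)"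
      "(\<lambda>r. (exp (\<beta> * r) * g r)\<^sup>2) integrable_on {0..s}"
    if m: "(\<lambda>r. indicator {0..s} r * g r) \<in> borel_measurable borel" and g: "\<And>r. 0 \<le> r \<Longrightarrow> \<bar>g r\<bar> \<le> c'" for g :: "real \<Rightarrow> real" and s c'
  proof -
    have "\<bar>exp (\<beta> * r) * g r\<bar> \<le> exp (\<bar>\<beta>\<bar> * s) * c'" if r: "r \<in> {0..s}" for r
      using bd[of g r c' s] g[of r] r by simp
    note integral_eq_lborel_power2[OF meas[OF m] this]
    then show "integrable lborel (\<lambda>r. (indicator {0..s} r * (exp (\<beta> * r) * g r))\<^sup>2)"
      "integral {0..s} (\<lambda>r. (exp (\<beta> * r) * g r)\<^sup>2) = (\<integral>r. (indicator {0..s} r * (exp (\<beta> * r) * g r))\<^sup>2 \<partial>lborel)"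
      "(\<lambda>r. (exp (\<beta> * r) * g r)\<^sup>2) integrable_on {0..s}" by blast+
  qed
  have S1_meas: "(\<lambda>r. indicator {0..s} r * S1 r) \<in> borel_measurable borel"
    and S2_meas: "(\<lambda>r. indicator {0..s} r * S2 r) \<in> borel_measurable borel" if "0 \<le> s" for s
    using Xl(2)[OF _ that] Yl(2)[OF _ that] by blast+
  have V1_int: "integrable lborel (\<lambda>r. (indicator {0..s} r * (exp (\<beta> * r) * S1 r))\<^sup>2)"
      "V1 s = (\<integral>r. (indicator {0..s} r * (exp (\<beta> * r) * S1 r))\<^sup>2 \<partial>lborel)"
      "(\<lambda>r. (exp (\<beta> * r) * S1 r)\<^sup>2) integrable_on {0..s}" if s: "0 \<le> s" for s
    unfolding V1_def using sq[OF S1_meas[OF s] S_K(1)] by blast+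
  have V2_int: "integrable lborel (\<lambda>r. (indicator {0..s} r * (exp (\<beta> * r) * S2 r))\<^sup>2)"
      "V2 s = (\<integral>r. (indicator {0..s} r * (exp (\<beta> * r) * S2 r))\<^sup>2 \<partial>lborel)"
      "(\<lambda>r. (exp (\<beta> * r) * S2 r)\<^sup>2) integrable_on {0..s}" if s: "0 \<le> s" for s
    unfolding V2_def using sq[OF S2_meas[OF s] S_K(2)] by blast+
  have ds_int: "integral {0..s} (\<lambda>r. (exp (\<beta> * r) * ds r)\<^sup>2) = (\<integral>r. (indicator {0..s} r * (exp (\<beta> * r) * ds r))\<^sup>2 \<partial>lborel)"
      "(\<lambda>r. (exp (\<beta> * r) * ds r)\<^sup>2) integrable_on {0..s}" if s: "0 \<le> s" for s
    using sq(2,3)[OF ds_meas[OF s] ds_K] by blast+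
  have V_diff: "(sqrt (V1 s) - sqrt (V2 s))\<^sup>2 \<le> integral {0..s} (\<lambda>r. (exp (\<beta> * r) * ds r)\<^sup>2)" if s: "0 \<le> s" for s
  proof -
    have "(sqrt (V1 s) - sqrt (V2 s))\<^sup>2 \<le> (\<integral>r. (indicator {0..s} r * (exp (\<beta> * r) * S1 r)
        - indicator {0..s} r * (exp (\<beta> * r) * S2 r))\<^sup>2 \<partial>lborel)"
      unfolding V1_int(2)[OF s] V2_int(2)[OF s]
    proof (rule L2_norm_diff_le)
      show "(\<lambda>r. indicator {0..s} r * (exp (\<beta> * r) * S1 r)) \<in> borel_measurable lborel"
        using meas[OF S1_meas[OF s]] by simp
      show "(\<lambda>r. indicator {0..s} r * (exp (\<beta> * r) * S2 r)) \<in> borel_measurable lborel"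
        using meas[OF S2_meas[OF s]] by simp
    qed (rule V1_int(1)[OF s] V2_int(1)[OF s])+
    also have "\<dots> = integral {0..s} (\<lambda>r. (exp (\<beta> * r) * ds r)\<^sup>2)"
      unfolding ds_int(1)[OF s] by (simp add: ds_def right_diff_distrib)
    finally show ?thesis .
  qed
  \<comment> \<open>The weight cancels the factor \<open>exp (- \<beta> * s)\<close> in the laws, so
    \<beta> does not enter the Gronwall rate \<open>c\<close>.\<close>
  have W2: "exp (\<beta> * s) * \<W>\<^sub>2 (law M (X s)) (law N (Y s))
      \<le> sqrt ((w + \<bar>integral {0..s} (\<lambda>r. exp (\<beta> * r) * db r)\<bar>)\<^sup>2 + integral {0..s} (\<lambda>r. (exp (\<beta> * r) * ds r)\<^sup>2))"
    if s: "0 \<le> s" for s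
  proof -
    have "\<W>\<^sub>2 (law M (X s)) (law N (Y s))
        \<le> exp (- \<beta> * s) * sqrt ((w + \<bar>D1 s - D2 s\<bar>)\<^sup>2 + (sqrt (V1 s) - sqrt (V2 s))\<^sup>2)"
      unfolding X3[OF s] Y3[OF s] w_def by (rule W2_gaussian_shift_le[OF \<pi> P2]) simp
    then have "exp (\<beta> * s) * \<W>\<^sub>2 (law M (X s)) (law N (Y s))
        \<le> exp (\<beta> * s) * (exp (- \<beta> * s) * sqrt ((w + \<bar>D1 s - D2 s\<bar>)\<^sup>2 + (sqrt (V1 s) - sqrt (V2 s))\<^sup>2))"
      by (rule mult_left_mono) simp
    also have "\<dots> = sqrt ((w + \<bar>D1 s - D2 s\<bar>)\<^sup>2 + (sqrt (V1 s) - sqrt (V2 s))\<^sup>2)"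
      by (simp add: mult.assoc[symmetric] exp_add[symmetric])
    also have "\<dots> \<le> sqrt ((w + \<bar>D1 s - D2 s\<bar>)\<^sup>2 + integral {0..s} (\<lambda>r. (exp (\<beta> * r) * ds r)\<^sup>2))"
      using V_diff[OF s] by (intro real_sqrt_le_mono add_left_mono)
    finally show ?thesis unfolding D_diff[OF s] .
  qed
  have t0: "0 \<le> t" using t by simp
  have db_le: "exp (\<beta> * r) * \<bar>db r\<bar>
      \<le> L\<^sub>b * sqrt ((w + \<bar>integral {0..r} (\<lambda>r. exp (\<beta> * r) * db r)\<bar>)\<^sup>2 + integral {0..r} (\<lambda>r. (exp (\<beta> * r) * ds r)\<^sup>2))"
    and ds_le: "exp (\<beta> * r) * \<bar>ds r\<bar>
      \<le> L\<^sub>\<sigma> * sqrt ((w + \<bar>integral {0..r} (\<lambda>r. exp (\<beta> * r) * db r)\<bar>)\<^sup>2 + integral {0..r} (\<lambda>r. (exp (\<beta> * r) * ds r)\<^sup>2))"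
    if "r \<in> {0..t}" for r
  proof -
    have r: "0 \<le> r" using that by simp
    have "exp (\<beta> * r) * \<bar>db r\<bar> \<le> exp (\<beta> * r) * (L\<^sub>b * \<W>\<^sub>2 (law M (X r)) (law N (Y r)))"
      using b[OF lawX[OF r] lawY[OF r]] by (intro mult_left_mono) (auto simp: db_def B1_def B2_def)
    also have "\<dots> = L\<^sub>b * (exp (\<beta> * r) * \<W>\<^sub>2 (law M (X r)) (law N (Y r)))" by simp
    also have "\<dots> \<le> L\<^sub>b * sqrt ((w + \<bar>integral {0..r} (\<lambda>r. exp (\<beta> * r) * db r)\<bar>)\<^sup>2 + integral {0..r} (\<lambda>r. (exp (\<beta> * r) * ds r)\<^sup>2))"
      by (rule mult_left_mono[OF W2[OF r] L(1)])
    finally show "exp (\<beta> * r) * \<bar>db r\<bar>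
      \<le> L\<^sub>b * sqrt ((w + \<bar>integral {0..r} (\<lambda>r. exp (\<beta> * r) * db r)\<bar>)\<^sup>2 + integral {0..r} (\<lambda>r. (exp (\<beta> * r) * ds r)\<^sup>2))" .
    have "exp (\<beta> * r) * \<bar>ds r\<bar> \<le> exp (\<beta> * r) * (L\<^sub>\<sigma> * \<W>\<^sub>2 (law M (X r)) (law N (Y r)))"
      using \<sigma>[OF lawX[OF r] lawY[OF r]] by (intro mult_left_mono) (auto simp: ds_def S1_def S2_def)
    also have "\<dots> = L\<^sub>\<sigma> * (exp (\<beta> * r) * \<W>\<^sub>2 (law M (X r)) (law N (Y r)))" by simp
    also have "\<dots> \<le> L\<^sub>\<sigma> * sqrt ((w + \<bar>integral {0..r} (\<lambda>r. exp (\<beta> * r) * db r)\<bar>)\<^sup>2 + integral {0..r} (\<lambda>r. (exp (\<beta> * r) * ds r)\<^sup>2))"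
      by (rule mult_left_mono[OF W2[OF r] L(2)])
    finally show "exp (\<beta> * r) * \<bar>ds r\<bar>
      \<le> L\<^sub>\<sigma> * sqrt ((w + \<bar>integral {0..r} (\<lambda>r. exp (\<beta> * r) * db r)\<bar>)\<^sup>2 + integral {0..r} (\<lambda>r. (exp (\<beta> * r) * ds r)\<^sup>2))" .
  qed
  have stab: "exp (\<beta> * s) * \<bar>db s\<bar> \<le> L\<^sub>b * (w * exp (c * s))" "exp (\<beta> * s) * \<bar>ds s\<bar> \<le> L\<^sub>\<sigma> * (w * exp (c * s))"
    if "s \<in> {0..t}" for s
    unfolding c_def
    using coefficient_stability[OF db_int[OF t0] ds_int(2)[OF t0] w L db_le ds_le that] by blast+
  have D_le: "\<bar>D1 t - D2 t\<bar> \<le> L\<^sub>b * (w * exp_ratio c t)"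
  proof -
    have hi: "((\<lambda>s. L\<^sub>b * (w * exp (c * s))) has_integral L\<^sub>b * (w * exp_ratio c t)) {0..t}"
      by (intro has_integral_mult_right integral_exp_ratio t0)
    have "norm (integral {0..t} (\<lambda>r. exp (\<beta> * r) * db r)) \<le> integral {0..t} (\<lambda>s. L\<^sub>b * (w * exp (c * s)))"
      by (rule integral_norm_bound_integral[OF db_int[OF t0] has_integral_integrable[OF hi]])
        (use stab(1) in \<open>simp add: abs_mult\<close>)
    then show ?thesis unfolding D_diff[OF t0] integral_unique[OF hi] by simp
  qed
  have V_le: "\<bar>V1 t - V2 t\<bar> \<le> 2 * sqrt K * (L\<^sub>\<sigma> * (w * exp_ratio (\<beta> + c) t))"
  proof -
    \<comment> \<open>A difference of squares is split into a product. One factor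
      \<open>exp (\<beta> * r)\<close> is consumed by the stability bound for \<open>ds\<close>; the
      other remains and turns the rate \<open>c\<close> into \<open>\<beta> + c\<close>. The sum of
      the two coefficients contributes \<open>2 * sqrt K\<close>.\<close>
    let ?g = "\<lambda>r. (exp (\<beta> * r) * S1 r)\<^sup>2 - (exp (\<beta> * r) * S2 r)\<^sup>2"
    have hi: "((\<lambda>s. 2 * sqrt K * (L\<^sub>\<sigma> * (w * exp ((\<beta> + c) * s)))) has_integral
        2 * sqrt K * (L\<^sub>\<sigma> * (w * exp_ratio (\<beta> + c) t))) {0..t}"
      by (intro has_integral_mult_right integral_exp_ratio t0)
    have "norm (integral {0..t} ?g) \<le> integral {0..t} (\<lambda>s. 2 * sqrt K * (L\<^sub>\<sigma> * (w * exp ((\<beta> + c) * s))))"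
    proof (rule integral_norm_bound_integral[OF _ has_integral_integrable[OF hi]])
      show "?g integrable_on {0..t}" by (intro integrable_diff V1_int(3) V2_int(3) t0)
      fix r assume r: "r \<in> {0..t}"
      then have r0: "0 \<le> r" by simp
      have "\<bar>S1 r + S2 r\<bar> \<le> 2 * sqrt K" using S_K[OF r0] by linarith
      then have "exp (\<beta> * r) * \<bar>S1 r + S2 r\<bar> \<le> exp (\<beta> * r) * (2 * sqrt K)" by (intro mult_left_mono) auto
      then have "(exp (\<beta> * r) * \<bar>ds r\<bar>) * (exp (\<beta> * r) * \<bar>S1 r + S2 r\<bar>) \<le> (L\<^sub>\<sigma> * (w * exp (c * r))) * (exp (\<beta> * r) * (2 * sqrt K))"
        using stab(2)[OF r] w L by (intro mult_mono[of "exp (\<beta> * r) * \<bar>ds r\<bar>"]) auto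
      moreover have "norm (?g r) = (exp (\<beta> * r) * \<bar>ds r\<bar>) * (exp (\<beta> * r) * \<bar>S1 r + S2 r\<bar>)"
      proof -
        have "?g r = (exp (\<beta> * r) * ds r) * (exp (\<beta> * r) * (S1 r + S2 r))"
          by (simp add: ds_def power2_eq_square algebra_simps)
        then show ?thesis by (simp add: abs_mult)
      qed
      moreover have "(L\<^sub>\<sigma> * (w * exp (c * r))) * (exp (\<beta> * r) * (2 * sqrt K)) = 2 * sqrt K * (L\<^sub>\<sigma> * (w * exp ((\<beta> + c) * r)))"
        by (simp add: distrib_right exp_add)
      ultimately show "norm (?g r) \<le> 2 * sqrt K * (L\<^sub>\<sigma> * (w * exp ((\<beta> + c) * r)))" by simp
    qed
    moreover have "V1 t - V2 t = integral {0..t} ?g"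
      unfolding V1_def V2_def by (rule Henstock_Kurzweil_Integration.integral_diff[symmetric]) (intro V1_int(3) V2_int(3) t0)+
    ultimately show ?thesis unfolding integral_unique[OF hi] by simp
  qed
  have low: "exp_ratio (2 * \<beta>) t / K \<le> integral {0..t} (\<lambda>r. (exp (\<beta> * r) * S r)\<^sup>2)"
    if i: "(\<lambda>r. (exp (\<beta> * r) * S r)\<^sup>2) integrable_on {0..t}" and S: "\<And>r. 0 \<le> r \<Longrightarrow> 1 / K \<le> (S r)\<^sup>2" for S
  proof -
    have hi: "((\<lambda>s. exp (2 * \<beta> * s) / K) has_integral exp_ratio (2 * \<beta>) t / K) {0..t}"
      by (intro has_integral_divide integral_exp_ratio t0)
    have "integral {0..t} (\<lambda>s. exp (2 * \<beta> * s) / K) \<le> integral {0..t} (\<lambda>r. (exp (\<beta> * r) * S r)\<^sup>2)"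
    proof (rule integral_le[OF has_integral_integrable[OF hi] i])
      fix r assume "r \<in> {0..t}"
      then have "exp (2 * \<beta> * r) * (1 / K) \<le> exp (2 * \<beta> * r) * (S r)\<^sup>2" using S by (intro mult_left_mono) auto
      then show "exp (2 * \<beta> * r) / K \<le> (exp (\<beta> * r) * S r)\<^sup>2"
        by (simp add: power_mult_distrib exp_double[symmetric] mult.assoc)
    qed
    then show ?thesis unfolding integral_unique[OF hi] .
  qed
  have V_low: "exp_ratio (2 * \<beta>) t / K \<le> V1 t" "exp_ratio (2 * \<beta>) t / K \<le> V2 t"
    unfolding V1_def V2_def using low[OF V1_int(3)[OF t0] S_K'(1)] low[OF V2_int(3)[OF t0] S_K'(2)] by blast+
  moreover have "0 < exp_ratio (2 * \<beta>) t / K" using exp_ratio_pos[OF t] K by simp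
  ultimately have V_pos: "0 < V1 t" "0 < V2 t" by linarith+
  have "(\<integral>x. ln (f x) \<partial>law M (X t)) \<le> ln (\<integral>x. f x \<partial>law N (Y t))
      + ((sqrt (V1 t))\<^sup>2 / (sqrt (V2 t))\<^sup>2 - 1 - ln ((sqrt (V1 t))\<^sup>2 / (sqrt (V2 t))\<^sup>2)) / 2
      + (sqrt (\<integral>p. (fst p - snd p)\<^sup>2 \<partial>\<pi>) + \<bar>D1 t - D2 t\<bar>)\<^sup>2 / (2 * (sqrt (V2 t))\<^sup>2)"
    using V_pos
    by (intro gaussian_mixture_log_harnack[OF \<pi> P2 X3[OF t0] Y3[OF t0] _ _ f]) simp_all
  also have "\<dots> = ln (\<integral>x. f x \<partial>law N (Y t))
      + ((V1 t / V2 t - 1 - ln (V1 t / V2 t)) / 2 + (w + \<bar>D1 t - D2 t\<bar>)\<^sup>2 / (2 * V2 t))"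
    using V_pos by (simp add: w_def)
  also have "\<dots> \<le> ln (\<integral>x. f x \<partial>law N (Y t)) + harnack_Sigma \<beta> K L\<^sub>b L\<^sub>\<sigma> t * w\<^sup>2"
    using harnack_Sigma_bound[OF t K w V_low, of "D1 t - D2 t" L\<^sub>b L\<^sub>\<sigma>] D_le V_le
    by (intro add_left_mono) (simp add: c_def add.assoc)
  finally show ?thesis by (simp add: w_def)
qed

section \<open>Unbounded logarithms and the infimum over couplings\<close>

lemma ext_integral_mono: "(\<And>x. g x \<le> h x) \<Longrightarrow> ext_integral \<mu> g \<le> ext_integral \<mu> h"
  unfolding ext_integral_def
  by (intro ereal_minus_mono) (auto simp: less_eq_ennreal.rep_eq[symmetric] intro!: nn_integral_mono ennreal_leI)

lemma ext_integral_integrable: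
  assumes "integrable \<mu> g"
  shows "ext_integral \<mu> g = ereal (\<integral>x. g x \<partial>\<mu>)"
proof -
  have fin: "(\<integral>\<^sup>+x. ennreal (g x) \<partial>\<mu>) \<noteq> \<infinity>" "(\<integral>\<^sup>+x. ennreal (- g x) \<partial>\<mu>) \<noteq> \<infinity>"
    using assms unfolding real_integrable_def by auto
  then obtain p q where pq: "0 \<le> p" "(\<integral>\<^sup>+x. ennreal (g x) \<partial>\<mu>) = ennreal p" "0 \<le> q" "(\<integral>\<^sup>+x. ennreal (- g x) \<partial>\<mu>) = ennreal q"
    by (metis ennreal_cases infinity_ennreal_def)
  then show ?thesis unfolding ext_integral_def real_lebesgue_integral_def[OF assms] by simp
qed

theorem theorem3p1:
  fixes \<gamma> \<beta> L\<^sub>b L\<^sub>\<sigma> K t :: real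
    and b \<sigma> :: "real measure \<Rightarrow> real"
    and f :: "real \<Rightarrow> real"
    and \<mu>\<^sub>0 \<nu>\<^sub>0 :: "real measure"
    and M :: "'a measure" and F :: "real \<Rightarrow> 'a measure" and W X :: "real \<Rightarrow> 'a \<Rightarrow> real"
    and N :: "'b measure" and G :: "real \<Rightarrow> 'b measure" and V Y :: "real \<Rightarrow> 'b \<Rightarrow> real"
  assumes "b \<in> borel_measurable borel_weak" and "\<sigma> \<in> borel_measurable borel_weak"
    and "L\<^sub>b \<ge> 0" and "L\<^sub>\<sigma> \<ge> 0" and "K \<ge> 1"
    and "\<And>\<mu> \<nu>. \<mu> \<in> \<P>\<^sub>2 \<Longrightarrow> \<nu> \<in> \<P>\<^sub>2 \<Longrightarrow> \<bar>b \<mu> - b \<nu>\<bar> \<le> L\<^sub>b * \<W>\<^sub>2 \<mu> \<nu>"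
    and "\<And>\<mu> \<nu>. \<mu> \<in> \<P>\<^sub>2 \<Longrightarrow> \<nu> \<in> \<P>\<^sub>2 \<Longrightarrow> \<bar>\<sigma> \<mu> - \<sigma> \<nu>\<bar> \<le> L\<^sub>\<sigma> * \<W>\<^sub>2 \<mu> \<nu>"
    and "\<And>\<mu>. \<mu> \<in> \<P>\<^sub>2 \<Longrightarrow> inverse K \<le> (\<sigma> \<mu>)\<^sup>2 \<and> (\<sigma> \<mu>)\<^sup>2 \<le> K"
    and "\<mu>\<^sub>0 \<in> \<P>\<^sub>2" and "\<nu>\<^sub>0 \<in> \<P>\<^sub>2"
    and "solves_sde \<gamma> \<beta> b \<sigma> \<mu>\<^sub>0 M F W X"
    and "solves_sde \<gamma> \<beta> b \<sigma> \<nu>\<^sub>0 N G V Y"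
    and "f \<in> borel_measurable borel" and "bounded (range f)" and "\<And>x. f x > 0"
    and "t > 0"
  shows "ext_integral (law M (X t)) (\<lambda>x. ln (f x))
    \<le> ereal (ln (\<integral>x. f x \<partial>law N (Y t)) + harnack_Sigma \<beta> K L\<^sub>b L\<^sub>\<sigma> t * (\<W>\<^sub>2 \<mu>\<^sub>0 \<nu>\<^sub>0)\<^sup>2)"
proof -
  note P2 = \<open>\<mu>\<^sub>0 \<in> \<P>\<^sub>2\<close> \<open>\<nu>\<^sub>0 \<in> \<P>\<^sub>2\<close> and f = \<open>f \<in> borel_measurable borel\<close>
  let ?\<mu> = "law M (X t)" and ?\<nu> = "law N (Y t)" and ?\<Sigma> = "harnack_Sigma \<beta> K L\<^sub>b L\<^sub>\<sigma> t"
  let ?x = "ext_integral ?\<mu> (\<lambda>x. ln (f x))"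
  have laws: "?\<mu> \<in> \<P>\<^sub>2" "?\<nu> \<in> \<P>\<^sub>2" using assms(11,12,16) by (auto simp: solves_sde_def)
  interpret \<mu>: prob_space ?\<mu> by (rule prob_measures2D(1)[OF laws(1)])
  interpret \<nu>: prob_space ?\<nu> by (rule prob_measures2D(1)[OF laws(2)])
  obtain C where C: "\<And>x. \<bar>f x\<bar> \<le> C" using \<open>bounded (range f)\<close> by (auto simp: bounded_iff)
  have f_le: "f x \<le> C" for x using C[of x] by simp
  have fm: "f \<in> borel_measurable ?\<nu>" "f \<in> borel_measurable ?\<mu>" using f by simp_all
  have fint: "integrable ?\<nu> f" using C by (intro \<nu>.integrable_const_bound[of _ C] fm) auto
  define I where "I = (\<integral>x. f x \<partial>?\<nu>)"
  \<comment> \<open>Strict positivity makes \<open>ln\<close> continuous at \<open>I\<close>, as the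
    final limit requires.\<close>
  have I: "0 < I"
  proof -
    have "I \<noteq> 0"
    proof
      assume "I = 0"
      then have "AE x in ?\<nu>. f x = 0"
        using integral_nonneg_eq_0_iff_AE[OF fint] \<open>\<And>x. f x > 0\<close> by (auto simp: I_def less_imp_le)
      then show False using \<open>\<And>x. f x > 0\<close> by (auto simp: less_imp_neq[symmetric] \<nu>.AE_False)
    qed
    moreover have "0 \<le> I" unfolding I_def using \<open>\<And>x. f x > 0\<close> by (intro integral_nonneg_AE AE_I2) (simp add: less_imp_le)
    ultimately show ?thesis by simp
  qed
  have \<Sigma>: "0 \<le> ?\<Sigma>" using assms(5,16) by (intro harnack_Sigma_nonneg)
  \<comment> \<open>Adding \<epsilon> bounds the logarithm from below and makes it integrable, while
    the extended integral can only grow. The value \<open>- \<infinity>\<close> on the left is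
    thereby included.\<close>
  have coupling: "?x \<le> ereal (ln (I + \<epsilon>) + ?\<Sigma> * (sqrt (\<integral>p. (fst p - snd p)\<^sup>2 \<partial>\<pi>))\<^sup>2)"
    if \<pi>: "\<pi> \<in> couplings \<mu>\<^sub>0 \<nu>\<^sub>0" and \<epsilon>: "0 < \<epsilon>" for \<pi> \<epsilon>
  proof -
    have ge: "\<epsilon> \<le> f x + \<epsilon>" for x using \<open>f x > 0\<close> by simp
    have "?x \<le> ext_integral ?\<mu> (\<lambda>x. ln (f x + \<epsilon>))"
      using \<epsilon> \<open>\<And>x. f x > 0\<close> by (intro ext_integral_mono) (simp add: add_pos_pos)
    also have "\<dots> = ereal (\<integral>x. ln (f x + \<epsilon>) \<partial>?\<mu>)"
    proof (rule ext_integral_integrable, rule \<mu>.integrable_const_bound)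
      show "AE x in ?\<mu>. norm (ln (f x + \<epsilon>)) \<le> \<bar>ln \<epsilon>\<bar> + \<bar>ln (C + \<epsilon>)\<bar>"
        using abs_ln_le[OF \<epsilon> ge, of _ "C + \<epsilon>"] f_le by (intro AE_I2) simp
    qed (use fm(2) in measurable)
    also have "\<dots> \<le> ereal (ln (\<integral>x. f x + \<epsilon> \<partial>?\<nu>) + ?\<Sigma> * (\<integral>p. (fst p - snd p)\<^sup>2 \<partial>\<pi>))"
      unfolding ereal_less_eq
      by (rule sde_log_harnack_coupling[OF assms(3-12) _ \<epsilon> ge _ assms(16) \<pi>, of _ "C + \<epsilon>"])
        (use f f_le in auto)
    also have "(\<integral>x. f x + \<epsilon> \<partial>?\<nu>) = I + \<epsilon>" using fint \<nu>.prob_space by (simp add: I_def)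
    finally show ?thesis by simp
  qed
  let ?cost = "\<lambda>\<pi>. sqrt (\<integral>(x, y). \<bar>x - y\<bar>\<^sup>2 \<partial>\<pi>)"
  \<comment> \<open>The product measure is a coupling. Over an empty set the infimum would be a
    default value and could not be approached by costs.\<close>
  have ne: "couplings \<mu>\<^sub>0 \<nu>\<^sub>0 \<noteq> {}"
  proof -
    interpret \<mu>\<^sub>0: prob_space \<mu>\<^sub>0 by (rule prob_measures2D(1)[OF P2(1)])
    interpret \<nu>\<^sub>0: prob_space \<nu>\<^sub>0 by (rule prob_measures2D(1)[OF P2(2)])
    interpret P: pair_prob_space \<mu>\<^sub>0 \<nu>\<^sub>0 ..
    have s: "sets \<mu>\<^sub>0 = sets borel" "sets \<nu>\<^sub>0 = sets borel" using prob_measures2D(2) P2 by auto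
    note [measurable_cong] = s
    have "distr (\<mu>\<^sub>0 \<Otimes>\<^sub>M \<nu>\<^sub>0) borel fst = distr (\<mu>\<^sub>0 \<Otimes>\<^sub>M \<nu>\<^sub>0) \<mu>\<^sub>0 fst"
      by (rule distr_cong) (simp_all add: s)
    then have "distr (\<mu>\<^sub>0 \<Otimes>\<^sub>M \<nu>\<^sub>0) borel fst = \<mu>\<^sub>0" unfolding \<nu>\<^sub>0.distr_pair_fst .
    moreover have "distr (\<mu>\<^sub>0 \<Otimes>\<^sub>M \<nu>\<^sub>0) borel snd = \<nu>\<^sub>0"
    proof (rule measure_eqI)
      fix A assume "A \<in> sets (distr (\<mu>\<^sub>0 \<Otimes>\<^sub>M \<nu>\<^sub>0) borel snd)"
      then have A: "A \<in> sets borel" by simp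
      have "snd -` A \<inter> space (\<mu>\<^sub>0 \<Otimes>\<^sub>M \<nu>\<^sub>0) = space \<mu>\<^sub>0 \<times> A"
        using sets_eq_imp_space_eq[OF s(2)] by (auto simp: space_pair_measure)
      moreover have "emeasure (\<mu>\<^sub>0 \<Otimes>\<^sub>M \<nu>\<^sub>0) (space \<mu>\<^sub>0 \<times> A) = emeasure \<nu>\<^sub>0 A"
      proof -
        have "A \<in> sets \<nu>\<^sub>0" using A s by simp
        then show ?thesis
          by (simp add: \<nu>\<^sub>0.emeasure_pair_measure_Times[OF sets.top] \<mu>\<^sub>0.emeasure_space_1)
      qed
      ultimately show "emeasure (distr (\<mu>\<^sub>0 \<Otimes>\<^sub>M \<nu>\<^sub>0) borel snd) A = emeasure \<nu>\<^sub>0 A"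
        using A by (subst emeasure_distr) auto
    qed (simp add: s)
    ultimately have "\<mu>\<^sub>0 \<Otimes>\<^sub>M \<nu>\<^sub>0 \<in> couplings \<mu>\<^sub>0 \<nu>\<^sub>0"
      using s by (simp add: couplings_def cong: sets_pair_measure_cong)
    then show ?thesis by blast
  qed
  \<comment> \<open>The same \<open>1 / real (Suc n)\<close> serves as the shift of \<open>f\<close>
    and as the distance to the infimum, so a single limit removes both.\<close>
  have bound: "?x \<le> ereal (ln (I + 1 / real (Suc n)) + ?\<Sigma> * (\<W>\<^sub>2 \<mu>\<^sub>0 \<nu>\<^sub>0 + 1 / real (Suc n))\<^sup>2)" for n
  proof -
    have "\<W>\<^sub>2 \<mu>\<^sub>0 \<nu>\<^sub>0 < \<W>\<^sub>2 \<mu>\<^sub>0 \<nu>\<^sub>0 + 1 / real (Suc n)" by simp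
    then obtain \<pi> where \<pi>: "\<pi> \<in> couplings \<mu>\<^sub>0 \<nu>\<^sub>0" "?cost \<pi> < \<W>\<^sub>2 \<mu>\<^sub>0 \<nu>\<^sub>0 + 1 / real (Suc n)"
      unfolding W2_def using cInf_lessD[of "?cost ` couplings \<mu>\<^sub>0 \<nu>\<^sub>0"] ne by blast
    then have "(sqrt (\<integral>p. (fst p - snd p)\<^sup>2 \<partial>\<pi>))\<^sup>2 \<le> (\<W>\<^sub>2 \<mu>\<^sub>0 \<nu>\<^sub>0 + 1 / real (Suc n))\<^sup>2"
      by (intro power_mono) (auto simp: split_beta')
    then have "?\<Sigma> * (sqrt (\<integral>p. (fst p - snd p)\<^sup>2 \<partial>\<pi>))\<^sup>2 \<le> ?\<Sigma> * (\<W>\<^sub>2 \<mu>\<^sub>0 \<nu>\<^sub>0 + 1 / real (Suc n))\<^sup>2"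
      using \<Sigma> by (rule mult_left_mono)
    then have "ereal (ln (I + 1 / real (Suc n)) + ?\<Sigma> * (sqrt (\<integral>p. (fst p - snd p)\<^sup>2 \<partial>\<pi>))\<^sup>2)
        \<le> ereal (ln (I + 1 / real (Suc n)) + ?\<Sigma> * (\<W>\<^sub>2 \<mu>\<^sub>0 \<nu>\<^sub>0 + 1 / real (Suc n))\<^sup>2)" by simp
    with coupling[OF \<pi>(1), of "1 / real (Suc n)"] show ?thesis by (rule order_trans) simp
  qed
  have inv: "(\<lambda>n. 1 / real (Suc n)) \<longlonglongrightarrow> 0" using LIMSEQ_inverse_real_of_nat by (simp add: inverse_eq_divide)
  have "(\<lambda>n. ln (I + 1 / real (Suc n)) + ?\<Sigma> * (\<W>\<^sub>2 \<mu>\<^sub>0 \<nu>\<^sub>0 + 1 / real (Suc n))\<^sup>2)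
      \<longlonglongrightarrow> ln (I + 0) + ?\<Sigma> * (\<W>\<^sub>2 \<mu>\<^sub>0 \<nu>\<^sub>0 + 0)\<^sup>2"
    using I by (intro tendsto_intros inv) auto
  then have "(\<lambda>n. ereal (ln (I + 1 / real (Suc n)) + ?\<Sigma> * (\<W>\<^sub>2 \<mu>\<^sub>0 \<nu>\<^sub>0 + 1 / real (Suc n))\<^sup>2))
      \<longlonglongrightarrow> ereal (ln I + ?\<Sigma> * (\<W>\<^sub>2 \<mu>\<^sub>0 \<nu>\<^sub>0)\<^sup>2)" by simp
  from LIMSEQ_le_const[OF this] bound show ?thesis unfolding I_def by blast
qed

end
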